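(* Let $d>1$ be an integer, $\mu\ge0$, and let $\{\psi_\xi\}_{\xi\in\mathcal{X}}$, $\mathcal{X}=\bigcup_{j\ge0}\mathcal{X}_j$, be the needlet system on $B^d$ with weight $W_\mu$. For any $k>0$ there exists a constant $c_k>0$ depending only on $k$, $\mu$, $d$, and $\widehat a$ such that for $\xi\in\mathcal{X}_j$, $j=0,1,\dots$, $$ |\psi_\xi(x)|\le c_k\frac{2^{jd/2}}{\sqrt{\mathcal{W}_\mu(2^j;x)}\,(1+2^jd(x,\xi))^k},\qquad x\in B^d. $$
   Context: $B^d$ is the closed unit ball of $\mathbb{R}^d$, $|\cdot|$ the Euclidean norm, $W_\mu(x)=(1-|x|^2)^{\mu-1/2}$, $d(x,y)=\arccos\{\langle x,y\rangle+\sqrt{1-|x|^2}\sqrt{1-|y|^2}\}$ for $x,y\in B^d$, $B_\xi(r)=\{x\in B^d:d(x,\xi)\le r\}$, and $\mathcal{W}_\mu(n;x)=(\sqrt{1-|x|^2}+n^{-1})^{2\mu}$. $\mathcal{V}_n^d$ is the space of polynomials of degree $n$ in $d$ variables orthogonal in $L^2(B^d,W_\mu)$ to all polynomials of lower degree. With $(b_d^\mu)^{-1}=\int_{B^d}W_\mu(x)\,dx$, $P_n(W_\mu;x,y)$ is the polynomial kernel for which the orthogonal projector onto $\mathcal{V}_n^d$ is $(\operatorname{Proj}_nf)(x)=b_d^\mu\int_{B^d}f(y)P_n(W_\mu;x,y)W_\mu(y)\,dy$. $\widehat a$ is a function with $\widehat a\in C^\infty[0,\infty)$, $\widehat a\ge0$,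 $\operatorname{supp}\widehat a\subset[1/2,2]$; $\widehat a(t)>c>0$ for $t\in[3/5,5/3]$; and $\widehat a^2(t)+\widehat a^2(2t)=1$ for $t\in[1/2,1]$. Kernels: $L_0(x,y):=1$ and $L_j(x,y):=\sum_{\nu=0}^\infty\widehat a\big(\nu/2^{j-1}\big)P_\nu(W_\mu;x,y)$, $j=1,2,\dots$. Cubature: for each $j\ge0$, $\mathcal{X}_j\subset B^d$ is a finite set of almost uniformly $\varepsilon_j$-distributed points with $\varepsilon_j=c^\diamond2^{-j-2}$ ($c^\diamond>0$ a constant depending only on $d$ and $\mu$), and $\lambda_\xi>0$ ($\xi\in\mathcal{X}_j$) are coefficients such that $\int_{B^d}f(x)W_\mu(x)\,dx=\sum_{\xi\in\mathcal{X}_j}\lambda_\xi f(\xi)$ for all polynomials $f$ of total degree $\le2^{j+2}$, with $\lambda_\xi\sim\int_{B_\xi(2^{-j})}W_\mu(x)\,dx$ and $\#\mathcal{X}_j\sim2^{jd}$, where $A\sim B$ means $c_1A\le B\le c_2A$ with positive constants depending only on $d$ and $\mu$. Almost uniformly $\varepsilon$-distributed means: $\mathcal{X}_\varepsilon$ is the set of centers of the members of a partition $\mathcal{R}_\varepsilon$ of $B^d$ into non-overlapping projections (dropping the last coordinate) of spherical simplices in the upper hemisphere $S^d_+\subset\mathbb{R}^{d+1}$, such that each $R\in\mathcal{R}_\varepsilon$ has a unique $\xi\in\mathcal{X}_\varepsilon$ with $B_\xi(c^*\varepsilon)\subset R\subset B_\xi(\varepsilon)$, and $\#\mathcal{X}_\varepsilon=\#\mathcal{R}_\varepsilon\le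 c^{**}\varepsilon^{-d}$, where $c^*,c^{**}>0$ are fixed constants depending only on $d$. Here a spherical simplex is $\{z/|z|:z\in\operatorname{conv}(w_1,\dots,w_{d+1})\}$ with $w_1,\dots,w_{d+1}$ linearly independent points of $\{z\in\mathbb{R}^{d+1}:s_iz_i\ge0\ \forall i,\ \sum_is_iz_i=1\}$ for some $s\in\{-1,1\}^{d+1}$ with $s_{d+1}=1$; its center is $w/|w|$, $w=\frac1{d+1}\sum_iw_i$, and the center of its projection is the projection of its center. Needlets: $\psi_\xi(x):=\sqrt{\lambda_\xi}\,L_j(x,\xi)$ for $\xi\in\mathcal{X}_j$, $j=0,1,\dots$. *)

theory Defs
  imports "HOL-Analysis.Analysis"
begin

section \<open>The weighted ball\<close>

text \<open>
  Vectors of \<open>\<real>\<^sup>d\<close> are \<open>real ^ 'd\<close>, with \<open>d = CARD('d)\<close>; the closed unit ball is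
  \<open>cball 0 1\<close>.  For \<open>\<mu> \<le> 1/2\<close> the weight takes the junk value 0 on the unit sphere
  (a null set; the weight only occurs under integrals).
\<close>

definition ball_weight :: "real \<Rightarrow> real ^ 'd \<Rightarrow> real" where
  "ball_weight \<mu> x = (1 - (norm x)\<^sup>2) powr (\<mu> - 1/2)"

definition ball_dist :: "real ^ 'd \<Rightarrow> real ^ 'd \<Rightarrow> real" where
  "ball_dist x y = arccos (x \<bullet> y + sqrt (1 - (norm x)\<^sup>2) * sqrt (1 - (norm y)\<^sup>2))"

definition ball_cap :: "real ^ 'd \<Rightarrow> real \<Rightarrow> (real ^ 'd) set" where
  "ball_cap \<xi> r = {x \<in> cball 0 1. ball_dist x \<xi> \<le> r}"

definition local_weight :: "real \<Rightarrow> real \<Rightarrow> real ^ 'd \<Rightarrow> real" where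
  "local_weight \<mu> n x = (sqrt (1 - (norm x)\<^sup>2) + 1 / n) powr (2 * \<mu>)"

definition weighted_integral :: "real \<Rightarrow> (real ^ 'd) set \<Rightarrow> (real ^ 'd \<Rightarrow> real) \<Rightarrow> real" where
  "weighted_integral \<mu> A f = (LINT x:A|lborel. f x * ball_weight \<mu> x)"

section \<open>Orthogonal polynomials and the projection kernels\<close>

definition monomial :: "('d::finite \<Rightarrow> nat) \<Rightarrow> real ^ 'd \<Rightarrow> real" where
  "monomial \<alpha> x = (\<Prod>i\<in>UNIV. (x $ i) ^ \<alpha> i)"

definition poly_deg_le :: "nat \<Rightarrow> (real ^ 'd \<Rightarrow> real) \<Rightarrow> bool" where
  "poly_deg_le n f \<longleftrightarrow> (\<exists>c. \<forall>x. f x = (\<Sum>\<alpha> | (\<Sum>i\<in>UNIV. \<alpha> i) \<le> n. c \<alpha> * monomial \<alpha> x))"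

text \<open>
  The zero polynomial belongs to \<open>orth_polys \<mu> n\<close>; its nonzero members have degree exactly \<open>n\<close>,
  since a member of lower degree is orthogonal to itself.
\<close>

definition orth_polys :: "real \<Rightarrow> nat \<Rightarrow> (real ^ 'd \<Rightarrow> real) set" where
  "orth_polys \<mu> n = {p. poly_deg_le n p \<and>
     (\<forall>m q. m < n \<longrightarrow> poly_deg_le m q \<longrightarrow> weighted_integral \<mu> (cball 0 1) (\<lambda>x. p x * q x) = 0)}"

definition weighted_L2 :: "real \<Rightarrow> (real ^ 'd \<Rightarrow> real) set" where
  "weighted_L2 \<mu> = {f. f \<in> borel_measurable borel \<and>
     set_integrable lborel (cball 0 1) (\<lambda>x. (f x)\<^sup>2 * ball_weight \<mu> x)}"

definition is_orth_projection ::
    "real \<Rightarrow> nat \<Rightarrow> (real ^ 'd \<Rightarrow> real) \<Rightarrow> (real ^ 'd \<Rightarrow> real) \<Rightarrow> bool" where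
  "is_orth_projection \<mu> n f g \<longleftrightarrow> g \<in> orth_polys \<mu> n \<and>
     (\<forall>q \<in> orth_polys \<mu> n. weighted_integral \<mu> (cball 0 1) (\<lambda>x. (f x - g x) * q x) = 0)"

definition ball_const :: "'d::finite itself \<Rightarrow> real \<Rightarrow> real" where
  "ball_const _ \<mu> = inverse (weighted_integral \<mu> (cball (0 :: real ^ 'd) 1) (\<lambda>_. 1))"

definition is_projection_kernel ::
    "real \<Rightarrow> nat \<Rightarrow> (real ^ 'd \<Rightarrow> real ^ 'd \<Rightarrow> real) \<Rightarrow> bool" where
  "is_projection_kernel \<mu> n K \<longleftrightarrow>
     real_polynomial_function (\<lambda>(x, y). K x y) \<and>
     (\<forall>f \<in> weighted_L2 \<mu>. is_orth_projection \<mu> n f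
        (\<lambda>x. ball_const TYPE('d) \<mu> * weighted_integral \<mu> (cball 0 1) (\<lambda>y. f y * K x y)))"

text \<open>
  For \<open>\<mu> > -1/2\<close> such a kernel exists and is unique: if \<open>\<phi>\<close> runs through an orthonormal basis of
  \<open>orth_polys \<mu> n\<close>, it is the sum of \<open>\<phi>(x) \<phi>(y)\<close> divided by \<open>ball_const TYPE('d) \<mu>\<close>.
\<close>

definition proj_kernel :: "real \<Rightarrow> nat \<Rightarrow> real ^ 'd \<Rightarrow> real ^ 'd \<Rightarrow> real" where
  "proj_kernel \<mu> n = (THE K. is_projection_kernel \<mu> n K)"

section \<open>The cutoff function\<close>

text \<open>Derivatives at the end point 0 are one-sided.\<close>

definition smooth_on_halfline :: "(real \<Rightarrow> real) \<Rightarrow> bool" where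
  "smooth_on_halfline a \<longleftrightarrow> (\<exists>D :: nat \<Rightarrow> real \<Rightarrow> real. (\<forall>t\<ge>0. D 0 t = a t) \<and>
     (\<forall>n. \<forall>t\<ge>0. (D n has_real_derivative D (Suc n) t) (at t within {0..})))"

definition admissible_cutoff :: "(real \<Rightarrow> real) \<Rightarrow> bool" where
  "admissible_cutoff a \<longleftrightarrow>
     smooth_on_halfline a \<and>
     (\<forall>t\<ge>0. a t \<ge> 0) \<and>
     closure {t. t \<ge> 0 \<and> a t \<noteq> 0} \<subseteq> {1/2..2} \<and>
     (\<exists>c>0. \<forall>t\<in>{3/5..5/3}. a t > c) \<and>
     (\<forall>t\<in>{1/2..1}. (a t)\<^sup>2 + (a (2 * t))\<^sup>2 = 1)"

section \<open>Almost uniformly distributed points\<close>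

text \<open>
  \<open>\<real>\<^bsup>d+1\<^esup>\<close> is \<open>real ^ 'd \<times> real\<close>, the last coordinate being the second component.  A spherical
  simplex is given by the set \<open>V\<close> of its \<open>d + 1\<close> vertices \<open>w\<^sub>i\<close>; the requirement that the sign of the
  last coordinate be \<open>+1\<close> is built in.
\<close>

definition simplex_vertices :: "((real ^ 'd) \<times> real) set \<Rightarrow> bool" where
  "simplex_vertices V \<longleftrightarrow> card V = CARD('d) + 1 \<and> independent V \<and>
     (\<exists>s :: 'd \<Rightarrow> real. (\<forall>i. s i \<in> {-1, 1}) \<and>
        (\<forall>z \<in> V. (\<forall>i. s i * fst z $ i \<ge> 0) \<and> snd z \<ge> 0 \<and>
           (\<Sum>i\<in>UNIV. s i * fst z $ i) + snd z = 1))"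

definition spherical_simplex :: "((real ^ 'd) \<times> real) set \<Rightarrow> ((real ^ 'd) \<times> real) set" where
  "spherical_simplex V = (\<lambda>z. z /\<^sub>R norm z) ` (convex hull V)"

definition simplex_center :: "((real ^ 'd) \<times> real) set \<Rightarrow> (real ^ 'd) \<times> real" where
  "simplex_center V = (let w = (\<Sum>v\<in>V. v) /\<^sub>R (real CARD('d) + 1) in w /\<^sub>R norm w)"

definition projected_simplex_with_center :: "(real ^ 'd) set \<Rightarrow> real ^ 'd \<Rightarrow> bool" where
  "projected_simplex_with_center R \<xi> \<longleftrightarrow>
     (\<exists>V. simplex_vertices V \<and> R = fst ` spherical_simplex V \<and> \<xi> = fst (simplex_center V))"

text \<open>\<open>cs\<close> and \<open>css\<close> are the constants \<open>c\<^sup>*\<close> and \<open>c\<^sup>*\<^sup>*\<close>.\<close>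

definition almost_uniformly_distributed ::
    "real \<Rightarrow> real \<Rightarrow> real \<Rightarrow> (real ^ 'd) set \<Rightarrow> bool" where
  "almost_uniformly_distributed cs css \<epsilon> X \<longleftrightarrow> (\<exists>\<R>.
     finite \<R> \<and>
     (\<forall>R \<in> \<R>. \<exists>\<xi>. projected_simplex_with_center R \<xi>) \<and>
     \<Union> \<R> = cball 0 1 \<and>
     pairwise (\<lambda>R R'. interior R \<inter> interior R' = {}) \<R> \<and>
     X = {\<xi>. \<exists>R \<in> \<R>. projected_simplex_with_center R \<xi>} \<and>
     (\<forall>R \<in> \<R>. \<exists>!\<xi>. \<xi> \<in> X \<and> ball_cap \<xi> (cs * \<epsilon>) \<subseteq> R \<and> R \<subseteq> ball_cap \<xi> \<epsilon>) \<and>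
     card X = card \<R> \<and>
     real (card \<R>) \<le> css * (1 / \<epsilon>) ^ CARD('d))"

section \<open>Cubature and needlets\<close>

definition sim :: "real \<Rightarrow> real \<Rightarrow> real \<Rightarrow> real \<Rightarrow> bool" where
  "sim c1 c2 A B \<longleftrightarrow> c1 * A \<le> B \<and> B \<le> c2 * A"

text \<open>
  The levels are kept apart: \<open>lam j \<xi>\<close> is the coefficient of \<open>\<xi>\<close> as a node of level \<open>j\<close>, so a point
  occurring in several \<open>X j\<close> carries a separate coefficient (and needlet) for each of them.
  \<open>cd\<close> is \<open>c\<^sup>\<diamond>\<close>; \<open>c1, c2\<close> and \<open>c3, c4\<close> are the constants of the two relations \<open>\<sim>\<close>.
\<close>

definition needlet_cubature ::
    "real \<Rightarrow> real \<Rightarrow> real \<Rightarrow> real \<Rightarrow> real \<Rightarrow> real \<Rightarrow> real \<Rightarrow> real \<Rightarrow>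
     (nat \<Rightarrow> (real ^ 'd) set) \<Rightarrow> (nat \<Rightarrow> real ^ 'd \<Rightarrow> real) \<Rightarrow> bool" where
  "needlet_cubature \<mu> cs css cd c1 c2 c3 c4 X lam \<longleftrightarrow> (\<forall>j.
     finite (X j) \<and> X j \<subseteq> cball 0 1 \<and>
     almost_uniformly_distributed cs css (cd / 2 ^ (j + 2)) (X j) \<and>
     (\<forall>\<xi> \<in> X j. lam j \<xi> > 0) \<and>
     (\<forall>f. poly_deg_le (2 ^ (j + 2)) f \<longrightarrow>
        weighted_integral \<mu> (cball 0 1) f = (\<Sum>\<xi> \<in> X j. lam j \<xi> * f \<xi>)) \<and>
     (\<forall>\<xi> \<in> X j. sim c1 c2 (lam j \<xi>) (weighted_integral \<mu> (ball_cap \<xi> (1 / 2 ^ j)) (\<lambda>_. 1))) \<and>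
     sim c3 c4 (real (card (X j))) (2 ^ (j * CARD('d))))"

text \<open>For admissible \<open>a\<close> only finitely many terms of the series are nonzero.\<close>

definition needlet_kernel :: "real \<Rightarrow> (real \<Rightarrow> real) \<Rightarrow> nat \<Rightarrow> real ^ 'd \<Rightarrow> real ^ 'd \<Rightarrow> real" where
  "needlet_kernel \<mu> a j x y =
     (if j = 0 then 1 else (\<Sum>\<nu>. a (real \<nu> / 2 ^ (j - 1)) * proj_kernel \<mu> \<nu> x y))"

definition needlet ::
    "real \<Rightarrow> (real \<Rightarrow> real) \<Rightarrow> (nat \<Rightarrow> real ^ 'd \<Rightarrow> real) \<Rightarrow> nat \<Rightarrow> real ^ 'd \<Rightarrow> real ^ 'd \<Rightarrow> real" where
  "needlet \<mu> a lam j \<xi> x = sqrt (lam j \<xi>) * needlet_kernel \<mu> a j x \<xi>"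

end

theory Submission
  imports Defs "HOL-Computational_Algebra.Polynomial" "HOL-Real_Asymp.Real_Asymp"
begin

text \<open>
  Write \<open>X = (x, sqrt (1 - norm x ^ 2))\<close>, a point of the unit sphere of one dimension more, and let
  \<open>T g x y\<close> be the mean of \<open>g (x \<bullet> y + u * sqrt (1 - norm x ^ 2) * sqrt (1 - norm y ^ 2))\<close>
  over \<open>u\<close> with density proportional to \<open>(1 - u ^ 2) powr (\<mu> - 1)\<close>. Integrating \<open>T g x y * q y\<close> against the
  weight amounts, degree by degree, to a Gaussian integral of \<open>g (X \<bullet> z) * q (fst z)\<close>; a reflection
  taking \<open>X\<close> to the last basis vector turns it into a one-variable Gegenbauer integral. Hence \<open>T\<close> of the
  Gegenbauer kernel of degree \<open>n\<close> is the projection kernel.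

  In one variable, multiplying by \<open>1 - t\<close> acts on the coefficients of a Gegenbauer kernel sum as a
  second-order difference operator, so with coefficients \<open>a (n / N)\<close> each factor \<open>1 - t\<close> gains
  \<open>N ^ - 2\<close>; averaging over \<open>u\<close> gives the decay of the needlet kernels. The
  cubature coefficients are bounded by testing the formula with a nonnegative polynomial peaked at
  the node, so the geometry of the nodes plays no role.
\<close>

section \<open>Orthogonal invariance of Lebesgue measure\<close>

text \<open>The law of \<open>u\<close> enters only through its moments: at \<mu> = 0 its density is
  not integrable and the law degenerates to two point masses, so \<open>mom\<close> and
  \<open>mfun\<close> treat all \<mu> alike, and only \<open>mfun_decay\<close> and
  \<open>mfun_lower\<close> split off \<mu> = 0. Gaussian integrals stand in for surface measure
  because they are rotation invariant, factor over coordinates, and are proportional to ball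
  integrals in each homogeneous degree. The exponents balance as follows. With l = \<mu> + (d - 1) /
  2 a kernel sum of degree about N has size \<open>N powr (2 * l + 1)\<close>, that is
  \<open>N powr (d + 2 * \<mu>)\<close>. Averaging over \<open>u\<close> gains the power -\<mu> of
  \<open>1 + N ^ 2 * (height x * height \<xi>)\<close>. Separating this into a factor for x and one
  for \<xi> costs the power \<mu> of \<open>1 + N * ball_dist x \<xi>\<close>, so decay of order k +
  \<mu> is proved where k is wanted. The kernel bound then carries the square roots of the local
  weights at both points; the bound for \<open>lam j \<xi>\<close> cancels the one at \<xi>,
  together with half of the power N^d.\<close>

lemma lborel_distr_basis_iso:
  fixes f :: "'a::euclidean_space \<Rightarrow> 'b::euclidean_space"
  assumes "linear f" and bij: "bij_betw f Basis Basis"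
  shows "distr lborel borel f = lborel"
proof (rule lborel_eqI[symmetric])
  have inner_f: "f x \<bullet> f b = x \<bullet> b" if "b \<in> Basis" for x b
  proof -
    have "f x = f (\<Sum>c\<in>Basis. (x \<bullet> c) *\<^sub>R c)"
      by (simp add: euclidean_representation)
    also have "\<dots> = (\<Sum>c\<in>Basis. (x \<bullet> c) *\<^sub>R f c)"
      using \<open>linear f\<close> by (simp add: linear_sum linear_cmul)
    finally have "f x \<bullet> f b = (\<Sum>c\<in>Basis. (x \<bullet> c) * (f c \<bullet> f b))"
      by (simp add: inner_sum_left)
    also have "\<dots> = (\<Sum>c\<in>Basis. if c = b then x \<bullet> b else 0)"
    proof (rule sum.cong, rule refl)
      fix c :: 'a assume "c \<in> Basis"
      then have "f c \<in> Basis" "f b \<in> Basis" "f c = f b \<longleftrightarrow> c = b"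
        using bij that by (auto simp: bij_betw_def inj_on_def)
      then show "(x \<bullet> c) * (f c \<bullet> f b) = (if c = b then x \<bullet> b else 0)"
        by (simp add: inner_Basis)
    qed
    finally show ?thesis using that by simp
  qed
  have f_meas [measurable]: "f \<in> borel_measurable borel"
    using \<open>linear f\<close> by (simp add: borel_measurable_continuous_onI linear_continuous_on linear_linear)
  fix l u :: 'b
  assume le: "\<And>b. b \<in> Basis \<Longrightarrow> l \<bullet> b \<le> u \<bullet> b"
  \<comment> \<open>A basis bijection permutes coordinates, so the preimage of a box is a box with
    relabelled edges and the same volume.\<close>
  define l' u' where "l' = (\<Sum>b\<in>Basis. (l \<bullet> f b) *\<^sub>R b)" and "u' = (\<Sum>b\<in>Basis. (u \<bullet> f b) *\<^sub>R b)"
  have l': "l' \<bullet> b = l \<bullet> f b" and u': "u' \<bullet> b = u \<bullet> f b" if "b \<in> Basis" for b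
    using that by (simp_all add: l'_def u'_def)
  have fB: "f ` Basis = Basis" and inj: "inj_on f Basis"
    using bij by (auto simp: bij_betw_def)
  have "f -` box l u = box l' u'"
  proof (rule set_eqI)
    fix x
    have "x \<in> f -` box l u \<longleftrightarrow> (\<forall>b\<in>f ` Basis. l \<bullet> b < f x \<bullet> b \<and> f x \<bullet> b < u \<bullet> b)"
      unfolding fB by (simp add: mem_box)
    also have "\<dots> \<longleftrightarrow> x \<in> box l' u'"
      by (simp add: mem_box inner_f l' u')
    finally show "x \<in> f -` box l u \<longleftrightarrow> x \<in> box l' u'" .
  qed
  then have "emeasure (distr lborel borel f) (box l u) = emeasure lborel (box l' u')"
    by (simp add: emeasure_distr)
  also have "\<dots> = (\<Prod>b\<in>Basis. (u' - l') \<bullet> b)"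
  proof (rule emeasure_lborel_box)
    fix b :: 'a assume "b \<in> Basis"
    then show "l' \<bullet> b \<le> u' \<bullet> b" using le[of "f b"] fB by (auto simp: l' u')
  qed
  also have "(\<Prod>b\<in>Basis. (u' - l') \<bullet> b) = (\<Prod>b\<in>Basis. (u - l) \<bullet> f b)"
    by (intro prod.cong) (simp_all add: l' u' inner_diff_left)
  also have "\<dots> = (\<Prod>b\<in>Basis. (u - l) \<bullet> b)"
    using prod.reindex[OF inj, of "\<lambda>b. (u - l) \<bullet> b"] fB by simp
  finally show "emeasure (distr lborel borel f) (box l u) = (\<Prod>b\<in>Basis. (u - l) \<bullet> b)" .
qed simp

text \<open>
  The library's invariance of Lebesgue measure under orthogonal maps needs a well-ordered index
  type; this one has \<open>CARD('d) + 1\<close> elements.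
\<close>

typedef 'd succ_index = "{..CARD('d::finite)}"
  by blast

setup_lifting type_definition_succ_index

instantiation succ_index :: (finite) linorder
begin

lift_definition less_eq_succ_index :: "'a succ_index \<Rightarrow> 'a succ_index \<Rightarrow> bool" is "(\<le>)" .

lift_definition less_succ_index :: "'a succ_index \<Rightarrow> 'a succ_index \<Rightarrow> bool" is "(<)" .

instance by standard (transfer; auto)+

end

instance succ_index :: (finite) wellorder
proof
  fix P :: "'a succ_index \<Rightarrow> bool" and x
  assume step: "\<And>x. (\<And>y. y < x \<Longrightarrow> P y) \<Longrightarrow> P x"
  show "P x"
    by (induction "Rep_succ_index x" arbitrary: x rule: less_induct)
      (auto intro: step simp: less_succ_index.rep_eq)
qed

lemma card_succ_index: "CARD('d::finite succ_index) = CARD('d) + 1"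
  using type_definition.card[OF type_definition_succ_index] by simp

instance succ_index :: (finite) finite
proof
  show "finite (UNIV :: 'a succ_index set)"
    by (rule finite_imageD[of Rep_succ_index], rule finite_subset[of _ "{..CARD('a)}"])
      (auto simp: inj_on_def Rep_succ_index_inject intro: Rep_succ_index[simplified])
qed

text \<open>Boxes determine \<open>lborel\<close>, and the preimage of a box is its image under the
  inverse map. Invariance is known for the completed measure, hence the passage through
  \<open>lebesgue\<close>.\<close>

lemma lborel_distr_orthogonal_vec:
  fixes R :: "real ^ 'n::{finite,wellorder} \<Rightarrow> real ^ 'n::{finite,wellorder}"
  assumes "orthogonal_transformation R"
  shows "distr lborel borel R = lborel"
proof (rule lborel_eqI[symmetric])
  have R_meas [measurable]: "R \<in> borel_measurable borel"
    using assms by (simp add: borel_measurable_continuous_onI linear_continuous_on linear_linear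
      orthogonal_transformation_linear)
  fix l u :: "real ^ 'n::{finite,wellorder}"
  assume le: "\<And>b. b \<in> Basis \<Longrightarrow> l \<bullet> b \<le> u \<bullet> b"
  have bij: "bij R" using assms by (rule orthogonal_transformation_bij)
  have inv: "orthogonal_transformation (inv R)"
    using assms by (rule orthogonal_transformation_inv)
  have eq: "R -` box l u = inv R ` box l u"
    using bij by (rule bij_vimage_eq_inv_image)
  have fin: "emeasure lebesgue (inv R ` box l u) < \<infinity>"
    using measurable_orthogonal_image[OF inv lmeasurable_box, of l u]
    by (simp only: fmeasurable_def mem_Collect_eq infinity_ennreal_def)
  have sets: "inv R ` box l u \<in> sets borel"
    using measurable_sets_borel[OF R_meas, of "box l u"] by (simp add: eq)
  have "emeasure (distr lborel borel R) (box l u) = emeasure lborel (inv R ` box l u)"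
    by (simp add: emeasure_distr eq)
  also have "\<dots> = emeasure lebesgue (inv R ` box l u)"
    using sets by (simp add: emeasure_completion)
  also have "\<dots> = ennreal (measure lebesgue (inv R ` box l u))"
    using fin by (simp add: emeasure_eq_ennreal_measure less_top)
  also have "\<dots> = ennreal (measure lebesgue (box l u))"
    using measure_orthogonal_image[OF inv lmeasurable_box, of l u] by simp
  also have "\<dots> = (\<Prod>b\<in>Basis. (u - l) \<bullet> b)"
    using le by (simp add: measure_completion measure_lborel_box_eq)
  finally show "emeasure (distr lborel borel R) (box l u) = (\<Prod>b\<in>Basis. (u - l) \<bullet> b)" .
qed simp

text \<open>Relabelling one basis by the other identifies two Euclidean spaces of equal dimension
  isometrically. It carries \<open>(real ^ 'd) \<times> real\<close> to
  \<open>real ^ 'd succ_index\<close> and back.\<close>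

lemma ex_basis_iso:
  assumes "DIM('a::euclidean_space) = DIM('b::euclidean_space)"
  obtains f :: "'a::euclidean_space \<Rightarrow> 'b::euclidean_space" and g :: "'b \<Rightarrow> 'a" where "linear f" "linear g"
    "bij_betw f Basis Basis" "bij_betw g Basis Basis" "\<And>x. g (f x) = x" "\<And>y. f (g y) = y"
    "\<And>x. norm (f x) = norm x" "\<And>y. norm (g y) = norm y"
proof -
  obtain \<pi> :: "'a \<Rightarrow> 'b" where \<pi>: "bij_betw \<pi> Basis Basis"
    using finite_same_card_bij[of "Basis :: 'a set" "Basis :: 'b set"] assms by auto
  define \<rho> where "\<rho> = inv_into Basis \<pi>"
  have \<rho>: "bij_betw \<rho> Basis Basis" unfolding \<rho>_def using \<pi> by (rule bij_betw_inv_into)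
  define f where "f x = (\<Sum>b\<in>Basis. (x \<bullet> b) *\<^sub>R \<pi> b)" for x
  define g where "g y = (\<Sum>b\<in>Basis. (y \<bullet> b) *\<^sub>R \<rho> b)" for y
  have lin: "linear f" "linear g"
    unfolding f_def g_def
    by (auto intro!: linearI simp: inner_add_left scaleR_add_left sum.distrib scaleR_sum_right)
  have fb: "f b = \<pi> b" if "b \<in> Basis" for b
  proof -
    have "f b = (\<Sum>c\<in>Basis. if c = b then \<pi> b else 0)"
      unfolding f_def using that by (intro sum.cong) (auto simp: inner_Basis)
    then show ?thesis using that by simp
  qed
  have gb: "g b = \<rho> b" if "b \<in> Basis" for b
  proof -
    have "g b = (\<Sum>c\<in>Basis. if c = b then \<rho> b else 0)"
      unfolding g_def using that by (intro sum.cong) (auto simp: inner_Basis)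
    then show ?thesis using that by simp
  qed
  have bij: "bij_betw f Basis Basis" "bij_betw g Basis Basis"
    using \<pi> \<rho> by (auto simp: fb gb cong: bij_betw_cong)
  have \<pi>B: "\<pi> b \<in> Basis" "\<rho> (\<pi> b) = b" if "b \<in> Basis" for b
    using \<pi> that by (auto simp: bij_betw_def \<rho>_def)
  have \<rho>B: "\<rho> b \<in> Basis" "\<pi> (\<rho> b) = b" if "b \<in> Basis" for b
    using \<pi> \<rho> that by (auto simp: bij_betw_def \<rho>_def f_inv_into_f)
  have gf: "g (f x) = x" for x
  proof -
    have "g (f x) = (\<Sum>b\<in>Basis. (x \<bullet> b) *\<^sub>R g (\<pi> b))"
      unfolding f_def using lin(2) by (simp add: linear_sum linear_cmul)
    also have "\<dots> = (\<Sum>b\<in>Basis. (x \<bullet> b) *\<^sub>R b)"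
      by (intro sum.cong) (simp_all add: gb \<pi>B)
    finally show ?thesis by (simp add: euclidean_representation)
  qed
  have fg: "f (g y) = y" for y
  proof -
    have "f (g y) = (\<Sum>b\<in>Basis. (y \<bullet> b) *\<^sub>R f (\<rho> b))"
      unfolding g_def using lin(1) by (simp add: linear_sum linear_cmul)
    also have "\<dots> = (\<Sum>b\<in>Basis. (y \<bullet> b) *\<^sub>R b)"
      by (intro sum.cong) (simp_all add: fb \<rho>B)
    finally show ?thesis by (simp add: euclidean_representation)
  qed
  have nf: "norm (f x) = norm x" for x
  proof -
    have "f x \<bullet> f x = (\<Sum>b\<in>Basis. (x \<bullet> b) * (\<pi> b \<bullet> f x))"
      by (subst (1) f_def) (simp add: inner_sum_left)
    also have "\<dots> = (\<Sum>b\<in>Basis. (x \<bullet> b) * (x \<bullet> b))"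
    proof (rule sum.cong, rule refl)
      fix b :: 'a assume b: "b \<in> Basis"
      have "\<pi> b \<bullet> f x = (\<Sum>c\<in>Basis. (x \<bullet> c) * (\<pi> b \<bullet> \<pi> c))"
        by (simp add: f_def inner_sum_right)
      also have "\<dots> = (\<Sum>c\<in>Basis. if c = b then x \<bullet> b else 0)"
        using b \<pi>B by (intro sum.cong) (auto simp: inner_Basis, metis)
      finally show "(x \<bullet> b) * (\<pi> b \<bullet> f x) = (x \<bullet> b) * (x \<bullet> b)" using b by simp
    qed
    also have "\<dots> = x \<bullet> x" by (rule euclidean_inner[symmetric])
    finally show ?thesis by (simp add: norm_eq_sqrt_inner)
  qed
  have ng: "norm (g y) = norm y" for y by (metis nf fg)
  show thesis by (rule that[of f g]) (fact lin bij gf fg nf ng)+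
qed

text \<open>Conjugating \<open>R\<close> with the basis identification gives an orthogonal map of
  \<open>real ^ 'd succ_index\<close>; each of the three maps in the resulting composition preserves
  \<open>lborel\<close>.\<close>

lemma lborel_distr_orthogonal_prod:
  fixes R :: "(real ^ 'd) \<times> real \<Rightarrow> (real ^ 'd) \<times> real"
  assumes "linear R" and norm: "\<And>z. norm (R z) = norm z"
  shows "distr lborel borel R = lborel"
proof -
  have "DIM((real ^ 'd) \<times> real) = DIM(real ^ 'd succ_index)"
    by (simp add: card_succ_index)
  then obtain f :: "(real ^ 'd) \<times> real \<Rightarrow> real ^ 'd succ_index" and g where
    lin: "linear f" "linear g" and bij: "bij_betw f Basis Basis" "bij_betw g Basis Basis"
    and inv: "\<And>x. g (f x) = x" and nrm: "\<And>x. norm (f x) = norm x" "\<And>y. norm (g y) = norm y"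
    by (rule ex_basis_iso) blast
  have "orthogonal_transformation (f \<circ> R \<circ> g)"
    unfolding orthogonal_transformation
    using lin \<open>linear R\<close> by (auto intro!: linear_compose simp: nrm norm)
  then have *: "distr lborel borel (f \<circ> R \<circ> g) = lborel" by (rule lborel_distr_orthogonal_vec)
  have meas [measurable]: "f \<in> borel_measurable borel" "g \<in> borel_measurable borel" "R \<in> borel_measurable borel"
    using lin \<open>linear R\<close>
    by (auto intro!: borel_measurable_continuous_onI linear_continuous_on simp: linear_linear)
  have "R = g \<circ> ((f \<circ> R \<circ> g) \<circ> f)" by (auto simp: inv)
  then have "distr lborel borel R = distr lborel borel (g \<circ> ((f \<circ> R \<circ> g) \<circ> f))" by simp
  also have "\<dots> = distr (distr (distr lborel borel f) borel (f \<circ> R \<circ> g)) borel g"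
    by (subst distr_distr; (subst distr_distr)?; simp add: o_assoc)
  also have "\<dots> = lborel"
    by (simp only: lborel_distr_basis_iso[OF lin(1) bij(1)] * lborel_distr_basis_iso[OF lin(2) bij(2)])
  finally show ?thesis .
qed

section \<open>Gaussian integrals and weighted integrals over the ball\<close>

lemma nn_integral_lborel_scale:
  fixes f :: "'a::euclidean_space \<Rightarrow> ennreal"
  assumes [measurable]: "f \<in> borel_measurable borel" and "c > 0"
  shows "(\<integral>\<^sup>+y. f y \<partial>lborel) = ennreal (c ^ DIM('a)) * (\<integral>\<^sup>+y. f (c *\<^sub>R y) \<partial>lborel)"
proof -
  have "(\<integral>\<^sup>+y. f y \<partial>lborel) =
      (\<integral>\<^sup>+y. f y \<partial>density (distr lborel borel (\<lambda>x. 0 + c *\<^sub>R x)) (\<lambda>_. \<bar>c\<bar> ^ DIM('a)))"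
    using lborel_affine[of c "0 :: 'a"] \<open>c > 0\<close> by simp
  also have "\<dots> = ennreal (c ^ DIM('a)) * (\<integral>\<^sup>+y. f (c *\<^sub>R y) \<partial>lborel)"
    using \<open>c > 0\<close> by (subst nn_integral_density; simp add: nn_integral_distr nn_integral_cmult)
  finally show ?thesis .
qed

lemma nn_integral_powr_exp:
  fixes z :: real
  assumes "z > 0"
  shows "(\<integral>\<^sup>+t. ennreal (if 0 < t then t powr (z - 1) * exp (- t) else 0) \<partial>lborel) = ennreal (Gamma z)"
proof -
  have "ennreal (Gamma z) = (\<integral>\<^sup>+t. ennreal (indicator {0..} t * t powr (z - 1) / exp t) \<partial>lborel)"
    using assms by (rule Gamma_conv_nn_integral_real)
  also have "\<dots> = (\<integral>\<^sup>+t. ennreal (if 0 < t then t powr (z - 1) * exp (- t) else 0) \<partial>lborel)"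
    by (intro nn_integral_cong) (auto simp: indicator_def exp_minus field_simps)
  finally show ?thesis ..
qed

text \<open>
  Both sides are the double integral of \<open>q y * (\<tau> - norm y ^ 2) powr s * exp (- \<tau>)\<close> over
  \<open>norm y ^ 2 < \<tau>\<close>: integrate first over \<open>\<tau>\<close>, or first over \<open>y\<close> after rescaling by \<open>sqrt \<tau>\<close>.
\<close>

lemma nn_integral_gaussian_eq_ball:
  fixes q :: "'a::euclidean_space \<Rightarrow> real"
  assumes [measurable]: "q \<in> borel_measurable borel" and nonneg: "\<And>y. q y \<ge> 0"
    and hom: "\<And>c y. c > 0 \<Longrightarrow> q (c *\<^sub>R y) = c ^ m * q y" and s: "s > -1"
  shows "ennreal (Gamma (s + 1)) * (\<integral>\<^sup>+y. ennreal (q y * exp (- (norm y)\<^sup>2)) \<partial>lborel) =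
    ennreal (Gamma (s + 1 + (m + DIM('a)) / 2)) *
      (\<integral>\<^sup>+y. ennreal (indicator (cball 0 1) y * (q y * (1 - (norm y)\<^sup>2) powr s)) \<partial>lborel)"
proof -
  define \<Phi> where "\<Phi> y \<tau> = (if (norm y)\<^sup>2 < \<tau> then q y * ((\<tau> - (norm y)\<^sup>2) powr s * exp (- \<tau>)) else 0)"
    for y :: 'a and \<tau> :: real
  define I where "I = (\<integral>\<^sup>+y. ennreal (indicator (cball 0 1) y * (q y * (1 - (norm y)\<^sup>2) powr s)) \<partial>(lborel :: 'a measure))"
  have meas: "(\<lambda>(y, \<tau>). ennreal (\<Phi> y \<tau>)) \<in> borel_measurable (lborel \<Otimes>\<^sub>M lborel)"
    unfolding \<Phi>_def by measurable
  have "(\<integral>\<^sup>+\<tau>. ennreal (\<Phi> y \<tau>) \<partial>lborel) = ennreal (Gamma (s + 1)) * ennreal (q y * exp (- (norm y)\<^sup>2))" for y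
  proof -
    let ?r = "(norm y)\<^sup>2"
    have [measurable]: "(\<lambda>\<tau>. ennreal (\<Phi> y \<tau>)) \<in> borel_measurable borel"
      unfolding \<Phi>_def by measurable
    have "(\<integral>\<^sup>+\<tau>. ennreal (\<Phi> y \<tau>) \<partial>lborel) = (\<integral>\<^sup>+t. ennreal (\<Phi> y (?r + 1 * t)) \<partial>lborel)"
      by (subst nn_integral_real_affine[where c = 1 and t = ?r]) simp_all
    also have "\<dots> = (\<integral>\<^sup>+t. ennreal (q y * exp (- ?r)) *
        ennreal (if 0 < t then t powr (s + 1 - 1) * exp (- t) else 0) \<partial>lborel)"
      by (intro nn_integral_cong)
        (auto simp: \<Phi>_def nonneg exp_add exp_diff exp_minus field_simps ennreal_mult'[symmetric])
    also have "\<dots> = ennreal (q y * exp (- ?r)) * ennreal (Gamma (s + 1))"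
      using s by (subst nn_integral_cmult) (simp_all add: nn_integral_powr_exp[of "s + 1", simplified])
    finally show ?thesis by (simp add: mult.commute)
  qed
  then have "ennreal (Gamma (s + 1)) * (\<integral>\<^sup>+y. ennreal (q y * exp (- (norm y)\<^sup>2)) \<partial>lborel) =
      (\<integral>\<^sup>+y. (\<integral>\<^sup>+\<tau>. ennreal (\<Phi> y \<tau>) \<partial>lborel) \<partial>lborel)"
    by (subst nn_integral_cmult[symmetric]) simp_all
  also have "\<dots> = (\<integral>\<^sup>+\<tau>. (\<integral>\<^sup>+y. ennreal (\<Phi> y \<tau>) \<partial>lborel) \<partial>lborel)"
    using lborel_pair.Fubini'[of "\<lambda>y \<tau>. ennreal (\<Phi> y \<tau>)"] meas by simp
  also have "\<dots> = (\<integral>\<^sup>+\<tau>. I * ennreal (if 0 < \<tau>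
      then \<tau> powr ((s + 1 + (m + DIM('a)) / 2) - 1) * exp (- \<tau>) else 0) \<partial>lborel)"
  proof (rule nn_integral_cong)
    fix \<tau> :: real
    show "(\<integral>\<^sup>+y. ennreal (\<Phi> y \<tau>) \<partial>lborel) = I * ennreal (if 0 < \<tau>
      then \<tau> powr ((s + 1 + (m + DIM('a)) / 2) - 1) * exp (- \<tau>) else 0)"
    proof (cases "\<tau> > 0")
      case False
      then have "\<Phi> y \<tau> = 0" for y
        using zero_le_power2[of "norm y"] unfolding \<Phi>_def by (smt (verit))
      then show ?thesis using False by simp
    next
      case True
      define c where "c = sqrt \<tau>"
      have c: "c > 0" "c\<^sup>2 = \<tau>" using True by (simp_all add: c_def)
      have cp: "c ^ n = \<tau> powr (n / 2)" for n
        using True by (simp add: c_def powr_half_sqrt[symmetric] powr_powr flip: powr_realpow)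
      \<comment> \<open>Rescaling by the square root of \<tau> turns the region into the unit ball
        and pulls all powers of \<tau> out of the integrand.\<close>
      have \<Phi>c: "\<Phi> (c *\<^sub>R y) \<tau> = (\<tau> powr (m / 2) * \<tau> powr s * exp (- \<tau>)) *
          (indicator (cball 0 1) y * (q y * (1 - (norm y)\<^sup>2) powr s))" for y
      proof -
        have n: "(norm (c *\<^sub>R y))\<^sup>2 = \<tau> * (norm y)\<^sup>2"
          using c by (simp add: power_mult_distrib)
        consider "(norm y)\<^sup>2 < 1" | "(norm y)\<^sup>2 = 1" | "(norm y)\<^sup>2 > 1" by linarith
        then show ?thesis
        proof cases
          case 1
          then have "\<tau> * (norm y)\<^sup>2 < \<tau>" using True by simp
          moreover have "norm y \<le> 1" using 1 by (simp add: power2_less_1_iff abs_square_less_1)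
          moreover have "(\<tau> - \<tau> * (norm y)\<^sup>2) powr s = \<tau> powr s * (1 - (norm y)\<^sup>2) powr s"
            using True 1 by (subst powr_mult[symmetric]) (auto simp: algebra_simps)
          ultimately show ?thesis
            using hom[OF c(1), of y] by (simp add: \<Phi>_def n cp del: norm_scaleR)
        next
          \<comment> \<open>On the unit sphere both sides vanish: the strict inequality in
            \<open>\<Phi>\<close> fails, and \<open>0 powr s = 0\<close>.\<close>
          case 2
          then show ?thesis using True by (simp add: \<Phi>_def n del: norm_scaleR)
        next
          case 3
          then have "norm y > 1" "\<not> (norm y)\<^sup>2 < 1" by (simp_all add: power2_gt_1_iff abs_square_le_1 not_le[symmetric])
          then show ?thesis using True by (simp add: \<Phi>_def n del: norm_scaleR)
        qed
      qed
      have [measurable]: "(\<lambda>y. ennreal (\<Phi> y \<tau>)) \<in> borel_measurable borel"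
        unfolding \<Phi>_def by measurable
      have "(\<integral>\<^sup>+y. ennreal (\<Phi> y \<tau>) \<partial>lborel) = ennreal (c ^ DIM('a)) * (\<integral>\<^sup>+y. ennreal (\<Phi> (c *\<^sub>R y) \<tau>) \<partial>lborel)"
        using c(1) by (rule nn_integral_lborel_scale[rotated]) simp
      also have "\<dots> = ennreal (c ^ DIM('a)) * (ennreal (\<tau> powr (m / 2) * \<tau> powr s * exp (- \<tau>)) * I)"
        unfolding \<Phi>c I_def
        by (subst nn_integral_cmult[symmetric]) (auto simp: ennreal_mult'[symmetric] nonneg indicator_def intro!: nn_integral_cong)
      also have "\<dots> = I * ennreal (c ^ DIM('a) * (\<tau> powr (m / 2) * \<tau> powr s * exp (- \<tau>)))"
        using c by (simp add: ennreal_mult' mult_ac)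
      also have "c ^ DIM('a) * (\<tau> powr (m / 2) * \<tau> powr s * exp (- \<tau>)) =
          \<tau> powr ((s + 1 + (m + DIM('a)) / 2) - 1) * exp (- \<tau>)"
        unfolding cp by (simp add: add_divide_distrib powr_add mult_ac)
      finally show ?thesis using True by simp
    qed
  qed
  also have "\<dots> = I * ennreal (Gamma (s + 1 + (m + DIM('a)) / 2))"
  proof -
    have "s + 1 + (m + DIM('a)) / 2 > 0" using s by (intro add_pos_nonneg[of "s + 1"]) auto
    then show ?thesis by (subst nn_integral_cmult) (simp_all only: nn_integral_powr_exp, simp_all)
  qed
  finally show ?thesis by (simp add: I_def mult.commute)
qed


text \<open>Integrability is bootstrapped. At exponent 0 the ball integrand is bounded, so the
  identity of \<open>nn_integral_gaussian_eq_ball\<close> makes the Gaussian integral finite; read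
  at exponent \<open>s\<close>, the same identity carries finiteness back to the possibly singular
  weight.\<close>

lemma homogeneous_gaussian_ball_nonneg:
  fixes q :: "'a::euclidean_space \<Rightarrow> real"
  assumes cont: "continuous_on UNIV q" and nonneg: "\<And>y. q y \<ge> 0"
    and hom: "\<And>c y. c > 0 \<Longrightarrow> q (c *\<^sub>R y) = c ^ m * q y" and s: "s > -1"
  shows "integrable lborel (\<lambda>y. q y * exp (- (norm y)\<^sup>2))"
    and "integrable lborel (\<lambda>y. indicator (cball 0 1) y * (q y * (1 - (norm y)\<^sup>2) powr s))"
    and "Gamma (s + 1) * (LINT y|lborel. q y * exp (- (norm y)\<^sup>2)) =
      Gamma (s + 1 + (m + DIM('a)) / 2) *
        (LINT y|lborel. indicator (cball 0 1) y * (q y * (1 - (norm y)\<^sup>2) powr s))"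
proof -
  define g where "g y = q y * exp (- (norm y)\<^sup>2)" for y
  define b where "b s y = indicator (cball 0 1) y * (q y * (1 - (norm y)\<^sup>2) powr s)" for s y
  have [measurable]: "q \<in> borel_measurable borel" using cont by (rule borel_measurable_continuous_onI)
  have [measurable]: "cball (0 :: 'a) 1 \<in> sets borel" by simp
  have [measurable]: "g \<in> borel_measurable borel" "b s \<in> borel_measurable borel" for s
    unfolding g_def[abs_def] b_def[abs_def] by measurable
  have g0: "g y \<ge> 0" and b0: "b s y \<ge> 0" for s y by (auto simp: g_def b_def nonneg)
  have Gpos: "Gamma (s + 1 + (m + DIM('a)) / 2) > 0" "Gamma (s + 1) > 0" if "s > -1" for s :: real
    using that by (auto intro!: Gamma_real_pos add_pos_nonneg[of "s + 1"])
  have eq: "ennreal (Gamma (s + 1)) * (\<integral>\<^sup>+y. ennreal (g y) \<partial>lborel) =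
      ennreal (Gamma (s + 1 + (m + DIM('a)) / 2)) * (\<integral>\<^sup>+y. ennreal (b s y) \<partial>lborel)" if "s > -1" for s
    unfolding g_def b_def by (rule nn_integral_gaussian_eq_ball) (use hom nonneg that in auto)
  have int_g: "integrable lborel g"
  proof (rule integrableI_nonneg)
    obtain B where B: "\<And>y. y \<in> cball 0 1 \<Longrightarrow> norm (q y) \<le> B"
      using compact_continuous_image[OF continuous_on_subset[OF cont], of "cball 0 1"]
      by (fastforce simp: compact_eq_bounded_closed bounded_iff)
    have "(\<integral>\<^sup>+y. ennreal (b 0 y) \<partial>lborel) \<le> (\<integral>\<^sup>+y. ennreal B * indicator (cball 0 1) y \<partial>(lborel :: 'a measure))"
      using B by (intro nn_integral_mono) (force simp: b_def indicator_def nonneg intro: ennreal_leI)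
    also have "\<dots> = ennreal B * emeasure lborel (cball (0 :: 'a) 1)" by (simp add: nn_integral_cmult)
    also have "\<dots> < \<infinity>" using emeasure_lborel_cball_finite[of "0 :: 'a" 1] by (simp add: ennreal_mult_less_top)
    finally have "ennreal (Gamma (0 + 1)) * (\<integral>\<^sup>+y. ennreal (g y) \<partial>lborel) < \<infinity>"
      unfolding eq[of 0, simplified] by (simp add: ennreal_mult_less_top)
    then show "(\<integral>\<^sup>+y. ennreal (g y) \<partial>lborel) < \<infinity>"
      by (simp add: ennreal_mult_less_top Gamma_1 split: if_splits)
  qed (auto simp: g0)
  have int_b: "integrable lborel (b s)"
  proof (rule integrableI_nonneg)
    have "ennreal (Gamma (s + 1)) * (\<integral>\<^sup>+y. ennreal (g y) \<partial>lborel) < \<infinity>"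
      using int_g by (simp add: nn_integral_eq_integral g0 ennreal_mult_less_top)
    then show "(\<integral>\<^sup>+y. ennreal (b s y) \<partial>lborel) < \<infinity>"
      unfolding eq[OF s] using Gpos[OF s] by (auto simp: ennreal_mult_less_top)
  qed (auto simp: b0)
  have "ennreal (Gamma (s + 1) * integral\<^sup>L lborel g) = ennreal (Gamma (s + 1 + (m + DIM('a)) / 2) * integral\<^sup>L lborel (b s))"
    using eq[OF s] Gpos[OF s] int_g int_b
    by (simp add: nn_integral_eq_integral g0 b0 ennreal_mult integral_nonneg)
  then have "Gamma (s + 1) * integral\<^sup>L lborel g = Gamma (s + 1 + (m + DIM('a)) / 2) * integral\<^sup>L lborel (b s)"
    using Gpos[OF s] by (subst (asm) ennreal_inj) (auto intro!: mult_nonneg_nonneg simp: g0 b0)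
  with int_g int_b show "integrable lborel (\<lambda>y. q y * exp (- (norm y)\<^sup>2))"
    "integrable lborel (\<lambda>y. indicator (cball 0 1) y * (q y * (1 - (norm y)\<^sup>2) powr s))"
    "Gamma (s + 1) * (LINT y|lborel. q y * exp (- (norm y)\<^sup>2)) =
      Gamma (s + 1 + (m + DIM('a)) / 2) *
        (LINT y|lborel. indicator (cball 0 1) y * (q y * (1 - (norm y)\<^sup>2) powr s))"
    by (simp_all add: g_def[abs_def] b_def[abs_def])
qed

text \<open>Homogeneity is asked for positive factors only, so the positive and the negative part of
  \<open>q\<close> inherit it and the nonnegative case applies to each.\<close>

lemma homogeneous_gaussian_ball:
  fixes q :: "'a::euclidean_space \<Rightarrow> real"
  assumes cont: "continuous_on UNIV q"
    and hom: "\<And>c y. c > 0 \<Longrightarrow> q (c *\<^sub>R y) = c ^ m * q y" and s: "s > -1"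
  shows "integrable lborel (\<lambda>y. q y * exp (- (norm y)\<^sup>2))"
    and "integrable lborel (\<lambda>y. indicator (cball 0 1) y * (q y * (1 - (norm y)\<^sup>2) powr s))"
    and "Gamma (s + 1) * (LINT y|lborel. q y * exp (- (norm y)\<^sup>2)) =
      Gamma (s + 1 + (m + DIM('a)) / 2) *
        (LINT y|lborel. indicator (cball 0 1) y * (q y * (1 - (norm y)\<^sup>2) powr s))"
proof -
  define p where "p y = max (q y) 0" for y
  define n where "n y = max (- q y) 0" for y
  have q: "q y = p y - n y" for y by (simp add: p_def n_def)
  have "continuous_on UNIV p" "continuous_on UNIV n"
    unfolding p_def n_def by (intro continuous_intros cont)+
  moreover have "p (c *\<^sub>R y) = c ^ m * p y" "n (c *\<^sub>R y) = c ^ m * n y" if "c > 0" for c y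
    using that zero_less_power[OF that, of m]
    by (auto simp: p_def n_def hom max_def mult_le_0_iff zero_le_mult_iff simp del: zero_less_power)
  moreover have "p y \<ge> 0" "n y \<ge> 0" for y by (simp_all add: p_def n_def)
  ultimately have P: "integrable lborel (\<lambda>y. p y * exp (- (norm y)\<^sup>2))"
      "integrable lborel (\<lambda>y. indicator (cball 0 1) y * (p y * (1 - (norm y)\<^sup>2) powr s))"
      "Gamma (s + 1) * (LINT y|lborel. p y * exp (- (norm y)\<^sup>2)) =
        Gamma (s + 1 + (m + DIM('a)) / 2) *
        (LINT y|lborel. indicator (cball 0 1) y * (p y * (1 - (norm y)\<^sup>2) powr s))"
    and N: "integrable lborel (\<lambda>y. n y * exp (- (norm y)\<^sup>2))"
      "integrable lborel (\<lambda>y. indicator (cball 0 1) y * (n y * (1 - (norm y)\<^sup>2) powr s))"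
      "Gamma (s + 1) * (LINT y|lborel. n y * exp (- (norm y)\<^sup>2)) =
        Gamma (s + 1 + (m + DIM('a)) / 2) *
        (LINT y|lborel. indicator (cball 0 1) y * (n y * (1 - (norm y)\<^sup>2) powr s))"
    using homogeneous_gaussian_ball_nonneg[of p m s] homogeneous_gaussian_ball_nonneg[of n m s] s by auto
  show "integrable lborel (\<lambda>y. q y * exp (- (norm y)\<^sup>2))"
    using Bochner_Integration.integrable_diff[OF P(1) N(1)] by (simp add: q algebra_simps)
  show "integrable lborel (\<lambda>y. indicator (cball 0 1) y * (q y * (1 - (norm y)\<^sup>2) powr s))"
    using Bochner_Integration.integrable_diff[OF P(2) N(2)] by (simp add: q algebra_simps)
  have 1: "(LINT y|lborel. q y * exp (- (norm y)\<^sup>2)) =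
      (LINT y|lborel. p y * exp (- (norm y)\<^sup>2)) - (LINT y|lborel. n y * exp (- (norm y)\<^sup>2))"
    by (subst Bochner_Integration.integral_diff[OF P(1) N(1), symmetric]) (simp add: q algebra_simps)
  have 2: "(LINT y|lborel. indicator (cball 0 1) y * (q y * (1 - (norm y)\<^sup>2) powr s)) =
      (LINT y|lborel. indicator (cball 0 1) y * (p y * (1 - (norm y)\<^sup>2) powr s)) -
      (LINT y|lborel. indicator (cball 0 1) y * (n y * (1 - (norm y)\<^sup>2) powr s))"
    by (subst Bochner_Integration.integral_diff[OF P(2) N(2), symmetric]) (simp add: q algebra_simps)
  show "Gamma (s + 1) * (LINT y|lborel. q y * exp (- (norm y)\<^sup>2)) =
      Gamma (s + 1 + (m + DIM('a)) / 2) *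
        (LINT y|lborel. indicator (cball 0 1) y * (q y * (1 - (norm y)\<^sup>2) powr s))"
    unfolding 1 2 right_diff_distrib P(3) N(3) ..
qed

section \<open>Homogeneous polynomials and moment functionals\<close>

text \<open>Coordinate-free generation by linear functionals makes closure under composition with
  linear maps, in particular reflections, a plain induction. The zero function has every
  degree.\<close>

inductive hom_poly :: "nat \<Rightarrow> ('a::real_normed_vector \<Rightarrow> real) \<Rightarrow> bool" where
  hom_poly_const: "hom_poly 0 (\<lambda>_. c)"
| hom_poly_linear: "bounded_linear f \<Longrightarrow> hom_poly 1 f"
| hom_poly_add: "hom_poly n f \<Longrightarrow> hom_poly n g \<Longrightarrow> hom_poly n (\<lambda>x. f x + g x)"
| hom_poly_mult: "hom_poly m f \<Longrightarrow> hom_poly n g \<Longrightarrow> hom_poly (m + n) (\<lambda>x. f x * g x)"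

lemma hom_poly_continuous: "hom_poly n f \<Longrightarrow> continuous_on UNIV f"
  by (induction rule: hom_poly.induct)
    (auto intro: continuous_on_add continuous_on_mult linear_continuous_on)

lemma hom_poly_scaleR: "hom_poly n f \<Longrightarrow> f (c *\<^sub>R x) = c ^ n * f x"
  by (induction rule: hom_poly.induct)
    (auto simp: linear_simps algebra_simps power_add)

lemma hom_poly_compose: "hom_poly n f \<Longrightarrow> bounded_linear R \<Longrightarrow> hom_poly n (\<lambda>x. f (R x))"
  by (induction rule: hom_poly.induct)
    (auto intro: hom_poly.intros hom_poly_linear[simplified] bounded_linear_compose simp: o_def)

lemma hom_poly_cmult: "hom_poly n f \<Longrightarrow> hom_poly n (\<lambda>x. c * f x)"
  using hom_poly_mult[OF hom_poly_const] by fastforce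

lemma hom_poly_power: "hom_poly n f \<Longrightarrow> hom_poly (k * n) (\<lambda>x. f x ^ k)"
  by (induction k) (auto intro: hom_poly_mult hom_poly_const)

lemma hom_poly_zero: "hom_poly n (\<lambda>_. 0)"
proof (induction n)
  case (Suc n)
  then show ?case
    using hom_poly_mult[OF hom_poly_linear[OF bounded_linear_zero] Suc] by simp
qed (rule hom_poly_const)

lemma hom_poly_sum:
  "(\<And>i. i \<in> A \<Longrightarrow> hom_poly n (f i)) \<Longrightarrow> hom_poly n (\<lambda>x. \<Sum>i\<in>A. f i x)"
  by (induction A rule: infinite_finite_induct) (auto intro: hom_poly_zero hom_poly_add)

lemma hom_poly_at_0: "hom_poly n f \<Longrightarrow> n > 0 \<Longrightarrow> f 0 = 0"
  using hom_poly_scaleR[of n f 0 0] by (simp add: zero_power)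

lemma hom_poly_0_eq: "hom_poly 0 f \<Longrightarrow> f x = f 0"
  using hom_poly_scaleR[of 0 f 0 x] by simp

text \<open>Sorting by powers of the last coordinate. The conjunct that \<open>h m\<close> vanishes
  beyond \<open>n\<close> is what the Cauchy product formula \<open>polynomial_product\<close> needs
  in the multiplication case.\<close>

lemma hom_poly_decompose:
  fixes H :: "'a::real_normed_vector \<times> real \<Rightarrow> real"
  assumes "hom_poly n H"
  shows "\<exists>h. (\<forall>m\<le>n. hom_poly (n - m) (h m)) \<and> (\<forall>m>n. h m = (\<lambda>_. 0)) \<and>
    (\<forall>y s. H (y, s) = (\<Sum>m\<le>n. h m y * s ^ m))"
  using assms
proof (induction rule: hom_poly.induct)
  case (hom_poly_const c)
  show ?case
    by (rule exI[of _ "\<lambda>m. if m = 0 then (\<lambda>_. c) else (\<lambda>_. 0)"]) (auto intro: hom_poly.hom_poly_const)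
next
  case (hom_poly_linear f)
  then interpret bounded_linear f .
  have decomp: "f (y, s) = f (y, 0) + f (0, 1) * s" for y s
    using add[of "(y, 0)" "(0, s)"] scaleR[of s "(0, 1)"] by simp
  have f0: "hom_poly 1 (\<lambda>y. f (y, 0))"
    by (rule hom_poly.hom_poly_linear) (intro bounded_linear_compose[OF hom_poly_linear]
      bounded_linear_Pair bounded_linear_ident bounded_linear_zero)
  define h where
    "h m = (if m = 0 then (\<lambda>y. f (y, 0)) else if m = 1 then (\<lambda>_. f (0, 1)) else (\<lambda>_. 0))" for m :: nat
  have "hom_poly (1 - m) (h m)" if "m \<le> 1" for m
    using that hom_poly.hom_poly_const[of "f (0, 1)"] f0 by (cases m) (simp_all add: h_def)
  moreover have "h m = (\<lambda>_. 0)" if "m > 1" for m using that by (simp add: h_def)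
  moreover have "f (y, s) = (\<Sum>m\<le>1. h m y * s ^ m)" for y s
    using decomp[of y s] by (simp add: h_def)
  ultimately show ?case by blast
next
  case (hom_poly_add n f g)
  then obtain h k where
    "\<forall>m\<le>n. hom_poly (n - m) (h m)" "\<forall>m>n. h m = (\<lambda>_. 0)" "\<And>y s. f (y, s) = (\<Sum>m\<le>n. h m y * s ^ m)"
    "\<forall>m\<le>n. hom_poly (n - m) (k m)" "\<forall>m>n. k m = (\<lambda>_. 0)" "\<And>y s. g (y, s) = (\<Sum>m\<le>n. k m y * s ^ m)"
    by blast
  then show ?case
    by (intro exI[of _ "\<lambda>m y. h m y + k m y"])
      (auto intro: hom_poly.hom_poly_add simp: sum.distrib algebra_simps)
next
  case (hom_poly_mult n1 f n2 g)
  then obtain h k where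
    hk: "\<forall>m\<le>n1. hom_poly (n1 - m) (h m)" "\<forall>m>n1. h m = (\<lambda>_. 0)"
      "\<forall>y s. f (y, s) = (\<Sum>m\<le>n1. h m y * s ^ m)"
      "\<forall>m\<le>n2. hom_poly (n2 - m) (k m)" "\<forall>m>n2. k m = (\<lambda>_. 0)"
      "\<forall>y s. g (y, s) = (\<Sum>m\<le>n2. k m y * s ^ m)"
    by blast
  note h = hk(1-3)[rule_format] and k = hk(4-6)[rule_format]
  define c where "c r y = (\<Sum>i\<le>r. h i y * k (r - i) y)" for r y
  have "hom_poly (n1 + n2 - r) (c r)" if "r \<le> n1 + n2" for r
    unfolding c_def
  proof (rule hom_poly_sum)
    fix i assume "i \<in> {..r}"
    show "hom_poly (n1 + n2 - r) (\<lambda>y. h i y * k (r - i) y)"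
    proof (cases "i \<le> n1 \<and> r - i \<le> n2")
      case True
      then have eq: "n1 + n2 - r = (n1 - i) + (n2 - (r - i))" using that \<open>i \<in> {..r}\<close> by auto
      show ?thesis unfolding eq using True h(1)[of i] k(1)[of "r - i"] by (intro hom_poly.hom_poly_mult) auto
    next
      case False
      then have "(\<lambda>y. h i y * k (r - i) y) = (\<lambda>_. 0)" using h(2)[of i] k(2)[of "r - i"] by auto
      then show ?thesis by (simp add: hom_poly_zero)
    qed
  qed
  moreover have "c r = (\<lambda>_. 0)" if "r > n1 + n2" for r
  proof -
    have "h i y * k (r - i) y = 0" for i y
      using h(2)[of i] k(2)[of "r - i"] that by (cases "i \<le> n1") auto
    then have "c r y = 0" for y unfolding c_def by (intro sum.neutral) blast
    then show ?thesis by blast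
  qed
  moreover have "f (y, s) * g (y, s) = (\<Sum>r\<le>n1 + n2. c r y * s ^ r)" for y s
    unfolding h(3) k(3) c_def by (rule polynomial_product) (auto simp: h(2) k(2))
  ultimately show ?case by (intro exI[of _ c]) auto
qed

text \<open>
  The even moments of the probability density proportional to \<open>(1 - u ^ 2) powr (\<nu> - 1)\<close> on
  \<open>{-1..1}\<close>; for \<open>\<nu> = 0\<close> those of the uniform distribution on the two end points.
\<close>

definition mom :: "real \<Rightarrow> nat \<Rightarrow> real" where
  "mom \<nu> m = (if even m then pochhammer (1/2) (m div 2) / pochhammer (\<nu> + 1/2) (m div 2) else 0)"

text \<open>The expectation of \<open>p\<close> under the law with moments \<open>mom \<nu>\<close>,
  defined without a measure so that it makes sense uniformly down to \<nu> = 0.\<close>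

definition mfun :: "real \<Rightarrow> real poly \<Rightarrow> real" where
  "mfun \<nu> p = (\<Sum>i\<le>degree p. coeff p i * mom \<nu> i)"

lemma mom_0 [simp]: "mom \<nu> 0 = 1" by (simp add: mom_def)

lemma mom_odd [simp]: "odd m \<Longrightarrow> mom \<nu> m = 0" by (simp add: mom_def)

text \<open>For positive \<nu> this says that the derivative of
  \<open>u ^ (m + 1) * (1 - u ^ 2) powr \<nu>\<close> integrates to 0 over
  \<open>{-1..1}\<close>.\<close>

lemma mom_Suc_Suc:
  assumes "\<nu> \<ge> 0" shows "(real m + 1 + 2 * \<nu>) * mom \<nu> (Suc (Suc m)) = (real m + 1) * mom \<nu> m"
proof (cases "even m")
  case True
  then obtain k where m: "m = 2 * k" by (elim evenE)
  define Q where "Q = \<nu> + 1/2 + real k"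
  have Q: "Q \<noteq> 0" "real m + 1 + 2 * \<nu> = 2 * Q" "real m + 1 = 2 * (1/2 + real k)"
    using assms by (auto simp: Q_def m add_nonneg_eq_0_iff)
  have "mom \<nu> (Suc (Suc m)) = mom \<nu> m * ((1/2 + real k) / Q)"
    by (simp add: mom_def m pochhammer_Suc Q_def)
  then have "2 * Q * mom \<nu> (Suc (Suc m)) = 2 * (1/2 + real k) * mom \<nu> m"
    using Q(1) by (simp add: field_simps)
  then show ?thesis by (simp only: Q(2)) (simp only: Q(3))
qed (simp add: mom_def)

lemma mfun_alt: "degree p \<le> n \<Longrightarrow> mfun \<nu> p = (\<Sum>i\<le>n. coeff p i * mom \<nu> i)"
  unfolding mfun_def by (intro sum.mono_neutral_left) (auto simp: coeff_eq_0)

lemma mfun_add: "mfun \<nu> (p + q) = mfun \<nu> p + mfun \<nu> q"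
  using mfun_alt[of p "max (degree p) (degree q)" \<nu>] mfun_alt[of q "max (degree p) (degree q)" \<nu>]
    mfun_alt[of "p + q" "max (degree p) (degree q)" \<nu>]
  by (simp add: degree_add_le_max sum.distrib algebra_simps)

lemma mfun_smult: "mfun \<nu> (smult c p) = c * mfun \<nu> p"
  by (subst mfun_alt[of _ "degree p"]) (simp_all add: mfun_def sum_distrib_left mult.assoc)

lemma mfun_0 [simp]: "mfun \<nu> 0 = 0" by (simp add: mfun_def)

lemma mfun_diff: "mfun \<nu> (p - q) = mfun \<nu> p - mfun \<nu> q"
  using mfun_add[of \<nu> p "smult (-1) q"] mfun_smult[of \<nu> "-1" q] by simp

lemma mfun_sum: "mfun \<nu> (\<Sum>i\<in>A. p i) = (\<Sum>i\<in>A. mfun \<nu> (p i))"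
  by (induction A rule: infinite_finite_induct) (auto simp: mfun_add)

lemma mfun_monom: "mfun \<nu> (monom c n) = c * mom \<nu> n"
proof -
  have "mfun \<nu> (monom c n) = (\<Sum>i\<le>n. coeff (monom c n) i * mom \<nu> i)"
    by (rule mfun_alt) (rule degree_monom_le)
  also have "\<dots> = (\<Sum>i\<le>n. if n = i then c * mom \<nu> n else 0)"
    by (intro sum.cong) auto
  finally show ?thesis by simp
qed

lemma mfun_1 [simp]: "mfun \<nu> 1 = 1"
  using mfun_monom[of \<nu> 1 0] by (simp add: monom_0 one_pCons)

definition lsq :: "real poly" where "lsq = [:1, 0, -1:]"

lemma poly_lsq [simp]: "poly lsq t = 1 - t\<^sup>2"
  by (simp add: lsq_def power2_eq_square)

lemma monom_mult_lsq_Suc: "monom 1 n * lsq ^ Suc i = monom 1 n * lsq ^ i - monom 1 (n + 2) * lsq ^ i"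
proof -
  have lsq_eq: "lsq = 1 - monom 1 2"
    by (simp add: lsq_def monom_altdef numeral_2_eq_2 one_pCons)
  have "monom (1 :: real) (n + 2) = monom 1 n * monom 1 2"
    by (simp add: mult_monom)
  then show ?thesis
    by (simp only: power_Suc mult.assoc[symmetric] left_diff_distrib[symmetric])
      (simp only: lsq_eq right_diff_distrib mult_1_right)
qed

lemma mfun_lsq_power_odd: "odd n \<Longrightarrow> mfun \<nu> (monom 1 n * lsq ^ i) = 0"
proof (induction i arbitrary: n)
  case (Suc i)
  then show ?case by (simp only: monom_mult_lsq_Suc mfun_diff) simp
qed (simp add: mfun_monom)

text \<open>A beta integral in moment form. Each factor \<open>lsq\<close> is a difference of two
  monomials, so the induction subtracts the formulas for \<open>k\<close> and \<open>Suc k\<close>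
  at the previous \<open>i\<close>.\<close>

lemma mfun_lsq_power:
  assumes "\<nu> > 0"
  shows "mfun \<nu> (monom 1 (2 * k) * lsq ^ i) =
    pochhammer (1/2) k * pochhammer \<nu> i / pochhammer (\<nu> + 1/2) (k + i)"
proof (induction i arbitrary: k)
  case 0
  show ?case by (simp add: mfun_monom mom_def)
next
  case (Suc i)
  have "monom 1 (2 * k) * lsq ^ Suc i = monom 1 (2 * k) * lsq ^ i - monom 1 (2 * Suc k) * lsq ^ i"
    using monom_mult_lsq_Suc[of "2 * k" i] by simp
  then have *: "mfun \<nu> (monom 1 (2 * k) * lsq ^ Suc i) =
      pochhammer (1/2) k * pochhammer \<nu> i / pochhammer (\<nu> + 1/2) (k + i) -
      pochhammer (1/2) (Suc k) * pochhammer \<nu> i / pochhammer (\<nu> + 1/2) (Suc k + i)"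
    by (simp only: mfun_diff Suc)
  define Q where "Q = \<nu> + 1/2 + real (k + i)"
  have Q: "Q \<noteq> 0" and eq: "(1/2 + real k) = Q - (\<nu> + real i)"
    using assms by (auto simp: Q_def add_nonneg_eq_0_iff)
  define A where "A = pochhammer (1/2) k * pochhammer \<nu> i / pochhammer (\<nu> + 1/2) (k + i)"
  have "pochhammer (1/2) (Suc k) * pochhammer \<nu> i / pochhammer (\<nu> + 1/2) (Suc k + i) =
      A * ((Q - (\<nu> + real i)) / Q)"
    unfolding eq[symmetric] by (simp add: A_def Q_def pochhammer_Suc)
  moreover have "pochhammer (1/2) k * pochhammer \<nu> (Suc i) / pochhammer (\<nu> + 1/2) (k + Suc i) =
      A * ((\<nu> + real i) / Q)"
    by (simp add: A_def Q_def pochhammer_Suc)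
  moreover have "A - A * ((Q - b) / Q) = A * (b / Q)" for b
    using Q by (simp add: field_simps)
  ultimately show ?case unfolding * A_def by simp
qed

section \<open>Ball integrals with a free weight exponent, and Gaussian integrals\<close>

definition ball_int :: "real \<Rightarrow> ('a::euclidean_space \<Rightarrow> real) \<Rightarrow> real" where
  "ball_int s h = (LINT y|lborel. indicator (cball 0 1) y * (h y * (1 - (norm y)\<^sup>2) powr s))"

definition ball_integrable :: "real \<Rightarrow> ('a::euclidean_space \<Rightarrow> real) \<Rightarrow> bool" where
  "ball_integrable s h \<longleftrightarrow>
    integrable lborel (\<lambda>y. indicator (cball 0 1) y * (h y * (1 - (norm y)\<^sup>2) powr s))"

definition gauss_int :: "('a::euclidean_space \<Rightarrow> real) \<Rightarrow> real" where
  "gauss_int h = (LINT y|lborel. h y * exp (- (norm y)\<^sup>2))"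

lemma ball_integrable_add:
  "ball_integrable s f \<Longrightarrow> ball_integrable s g \<Longrightarrow> ball_integrable s (\<lambda>y. f y + g y)"
  unfolding ball_integrable_def by (drule (1) Bochner_Integration.integrable_add) (simp add: algebra_simps)

lemma ball_integrable_cmult: "ball_integrable s f \<Longrightarrow> ball_integrable s (\<lambda>y. c * f y)"
  unfolding ball_integrable_def using integrable_mult_right[where c = c] by (fastforce simp: mult_ac)

lemma ball_integrable_zero: "ball_integrable s (\<lambda>_. 0)"
  by (simp add: ball_integrable_def)

lemma ball_integrable_sum:
  "(\<And>i. i \<in> A \<Longrightarrow> ball_integrable s (f i)) \<Longrightarrow> ball_integrable s (\<lambda>y. \<Sum>i\<in>A. f i y)"
  by (induction A rule: infinite_finite_induct) (auto intro: ball_integrable_zero ball_integrable_add)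

lemma ball_int_cmult: "ball_int s (\<lambda>y. c * f y) = c * ball_int s f"
  unfolding ball_int_def by (subst integral_mult_right_zero[symmetric]) (simp add: algebra_simps)

lemma ball_int_zero [simp]: "ball_int s (\<lambda>_. 0) = 0"
  by (simp add: ball_int_def)

lemma ball_int_add:
  "ball_integrable s f \<Longrightarrow> ball_integrable s g \<Longrightarrow> ball_int s (\<lambda>y. f y + g y) = ball_int s f + ball_int s g"
  unfolding ball_int_def ball_integrable_def
  by (subst Bochner_Integration.integral_add[symmetric]) (simp_all add: algebra_simps)

lemma ball_int_sum:
  "(\<And>i. i \<in> A \<Longrightarrow> ball_integrable s (f i)) \<Longrightarrow> ball_int s (\<lambda>y. \<Sum>i\<in>A. f i y) = (\<Sum>i\<in>A. ball_int s (f i))"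
  by (induction A rule: infinite_finite_induct) (auto simp: ball_int_add ball_integrable_sum)

lemma ball_int_cong:
  "(\<And>y. norm y \<le> 1 \<Longrightarrow> f y * (1 - (norm y)\<^sup>2) powr s = g y * (1 - (norm y)\<^sup>2) powr t) \<Longrightarrow> ball_int s f = ball_int t g"
  unfolding ball_int_def by (intro Bochner_Integration.integral_cong) (auto simp: indicator_def)

lemma hom_ball_integrable: "hom_poly m h \<Longrightarrow> s > -1 \<Longrightarrow> ball_integrable s h"
  unfolding ball_integrable_def
  by (rule homogeneous_gaussian_ball(2)[where m = m]) (auto simp: hom_poly_continuous hom_poly_scaleR)

lemma hom_gauss_integrable: "hom_poly m h \<Longrightarrow> integrable lborel (\<lambda>y. h y * exp (- (norm y)\<^sup>2))"
  by (rule homogeneous_gaussian_ball(1)[where m = m and s = 0]) (auto simp: hom_poly_continuous hom_poly_scaleR)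

lemma hom_ball_gauss:
  fixes h :: "'a::euclidean_space \<Rightarrow> real"
  shows "hom_poly m h \<Longrightarrow> s > -1 \<Longrightarrow>
    Gamma (s + 1) * gauss_int h = Gamma (s + 1 + (real m + real DIM('a)) / 2) * ball_int s h"
  unfolding ball_int_def gauss_int_def of_nat_add[symmetric]
  by (rule homogeneous_gaussian_ball(3)) (auto simp: hom_poly_continuous hom_poly_scaleR)

lemma lborel_integral_odd:
  fixes f :: "'a::euclidean_space \<Rightarrow> real"
  assumes [measurable]: "f \<in> borel_measurable borel" and odd: "\<And>y. f (- y) = - f y"
  shows "integral\<^sup>L lborel f = 0"
proof -
  have "lborel = distr lborel borel (uminus :: 'a \<Rightarrow> 'a)"
    using lborel_affine[of "-1" "0 :: 'a"] by (simp add: density_1)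
  then have "integral\<^sup>L lborel f = integral\<^sup>L (distr lborel borel uminus) f" by simp
  also have "\<dots> = - integral\<^sup>L lborel f" by (subst integral_distr) (simp_all add: odd)
  finally show ?thesis by simp
qed

lemma hom_poly_uminus: "hom_poly m h \<Longrightarrow> h (- y) = (-1) ^ m * h y"
  using hom_poly_scaleR[of m h "-1" y] by simp

lemma hom_poly_borel [measurable_dest]:
  fixes h :: "'a::euclidean_space \<Rightarrow> real"
  shows "hom_poly m h \<Longrightarrow> h \<in> borel_measurable borel"
  by (intro borel_measurable_continuous_onI hom_poly_continuous)

lemma ball_int_odd:
  fixes h :: "'a::euclidean_space \<Rightarrow> real"
  assumes "hom_poly m h" "odd m"
  shows "ball_int s h = 0"
proof -
  have [measurable]: "h \<in> borel_measurable borel" using assms(1) by (rule hom_poly_borel)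
  have [measurable]: "cball (0 :: 'a) 1 \<in> sets borel" by simp
  show ?thesis
    unfolding ball_int_def
    by (rule lborel_integral_odd) (use assms in \<open>auto simp: hom_poly_uminus indicator_def\<close>)
qed

text \<open>The moments come from the ball identity itself: at exponent 1 the one-dimensional ball
  integral is an elementary polynomial integral, and its two linear factors cancel against two steps
  of the Gamma recursion.\<close>

lemma gauss_int_power:
  "gauss_int (\<lambda>s :: real. s ^ m) = (if even m then sqrt pi * pochhammer (1/2) (m div 2) else 0)"
proof -
  have hom: "hom_poly m (\<lambda>s :: real. s ^ m)"
    using hom_poly_power[OF hom_poly_linear[OF bounded_linear_ident], of m] by simp
  show ?thesis
  proof (cases "even m")
    case False
    show ?thesis unfolding gauss_int_def using False by (subst lborel_integral_odd) auto
  next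
    case True
    then obtain k where m: "m = 2 * k" by (elim evenE)
    have "ball_int 1 (\<lambda>s :: real. s ^ m) = (LINT s|lborel. indicator {-1..1} s *\<^sub>R (s ^ m - s ^ (m + 2)))"
      unfolding ball_int_def
    proof (intro Bochner_Integration.integral_cong refl)
      fix s :: real
      have "1 - s\<^sup>2 \<ge> 0" if "\<bar>s\<bar> \<le> 1" using that by (simp add: abs_square_le_1)
      then show "indicator (cball 0 1) s * (s ^ m * (1 - (norm s)\<^sup>2) powr 1) =
          indicator {-1..1} s *\<^sub>R (s ^ m - s ^ (m + 2))"
        by (cases "\<bar>s\<bar> \<le> 1") (auto simp: indicator_def algebra_simps power2_eq_square)
    qed
    also have "\<dots> = (1 ^ (m + 1) / (m + 1) - 1 ^ (m + 3) / (m + 3)) -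
        ((-1) ^ (m + 1) / (m + 1) - (-1) ^ (m + 3) / (m + 3))"
    proof (rule integral_FTC_atLeastAtMost)
      fix s :: real
      show "((\<lambda>s. s ^ (m + 1) / (m + 1) - s ^ (m + 3) / (m + 3)) has_vector_derivative
          s ^ m - s ^ (m + 2)) (at s within {-1..1})"
        unfolding has_real_derivative_iff_has_vector_derivative[symmetric]
        by (auto intro!: derivative_eq_intros simp: numeral_eq_Suc simp del: power_Suc)
    qed (auto intro!: continuous_intros)
    also have "\<dots> = 1 / ((real k + 1/2) * (real k + 3/2))"
      by (simp add: m field_simps)
    finally have B: "ball_int 1 (\<lambda>s :: real. s ^ m) = 1 / ((real k + 1/2) * (real k + 3/2))" .
    have "gauss_int (\<lambda>s :: real. s ^ m) = Gamma (real k + 1/2 + 1 + 1) / ((real k + 1/2) * (real k + 3/2))"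
    proof -
      have eq: "1 + 1 + (real m + real DIM(real)) / 2 = real k + 1/2 + 1 + 1" by (simp add: m add_divide_distrib)
      show ?thesis
        using hom_ball_gauss[OF hom, of 1] unfolding eq B by (simp add: Gamma_numeral)
    qed
    also have "\<dots> = Gamma (real k + 1/2)"
    proof -
      have "Gamma (real k + 1/2 + 1 + 1) = (real k + 1/2 + 1) * ((real k + 1/2) * Gamma (real k + 1/2))"
        by (subst Gamma_plus1; (subst Gamma_plus1)?; auto elim!: nonpos_Ints_cases)
      also have "\<dots> = ((real k + 1/2) * (real k + 3/2)) * Gamma (real k + 1/2)"
        by (simp add: field_simps)
      finally show ?thesis
        by (simp only:) (rule nonzero_mult_div_cancel_left, simp add: add_nonneg_eq_0_iff)
    qed
    also have "\<dots> = sqrt pi * pochhammer (1/2) k"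
    proof -
      have "1/2 \<notin> (\<int>\<^sub>\<le>\<^sub>0 :: real set)" by (auto elim!: nonpos_Ints_cases)
      then show ?thesis
        using pochhammer_Gamma[of "1/2 :: real" k] Gamma_one_half_real by (simp add: add.commute field_simps)
    qed
    finally show ?thesis using True by (simp add: m)
  qed
qed


lemma gauss_int_prod:
  fixes h :: "'a::euclidean_space \<Rightarrow> real"
  assumes "hom_poly r h"
  shows "gauss_int (\<lambda>(y, s :: real). h y * s ^ m) = gauss_int h * gauss_int (\<lambda>s :: real. s ^ m)"
    and "integrable lborel (\<lambda>z :: 'a \<times> real. (case z of (y, s) \<Rightarrow> h y * s ^ m) * exp (- (norm z)\<^sup>2))"
proof -
  have "hom_poly (r + m * 1) (\<lambda>z :: 'a \<times> real. h (fst z) * snd z ^ m)"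
    by (rule hom_poly_mult[OF hom_poly_compose[OF assms bounded_linear_fst]
        hom_poly_power[OF hom_poly_linear[OF bounded_linear_snd]]])
  then have int: "integrable lborel (\<lambda>z :: 'a \<times> real. h (fst z) * snd z ^ m * exp (- (norm z)\<^sup>2))"
    by (rule hom_gauss_integrable)
  then show "integrable lborel (\<lambda>z :: 'a \<times> real. (case z of (y, s) \<Rightarrow> h y * s ^ m) * exp (- (norm z)\<^sup>2))"
    by (simp add: case_prod_beta')
  have split: "h y * s ^ m * exp (- (norm (y, s))\<^sup>2) = h y * exp (- (norm y)\<^sup>2) * (s ^ m * exp (- (norm s)\<^sup>2))" for y s
    by (simp add: norm_Pair exp_add[symmetric] exp_diff exp_minus field_simps)
  have "gauss_int (\<lambda>(y, s :: real). h y * s ^ m) =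
      (LINT y|lborel. (LINT s|lborel. h y * s ^ m * exp (- (norm (y, s))\<^sup>2)))"
    unfolding gauss_int_def case_prod_beta'
    using lborel_pair.integral_fst'[OF int[folded lborel_prod]] by (simp add: lborel_prod)
  also have "\<dots> = gauss_int h * gauss_int (\<lambda>s :: real. s ^ m)"
    unfolding split gauss_int_def by simp
  finally show "gauss_int (\<lambda>(y, s :: real). h y * s ^ m) = gauss_int h * gauss_int (\<lambda>s :: real. s ^ m)" .
qed

text \<open>For \<open>H (y, s) = (\<Sum>m\<le>n. h m y * s ^ m)\<close> this is the weighted ball
  integral of the mean over \<open>u\<close> of \<open>H (y, u * sqrt (1 - norm y ^ 2))\<close>: the
  power \<open>s ^ m\<close> contributes its moment and raises the weight exponent by m / 2.\<close>

definition lift_int :: "real \<Rightarrow> nat \<Rightarrow> (nat \<Rightarrow> 'a::euclidean_space \<Rightarrow> real) \<Rightarrow> real" where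
  "lift_int \<mu> n h = (\<Sum>m\<le>n. mom \<mu> m * ball_int (m / 2 + \<mu> - 1/2) (h m))"

text \<open>Raising the exponent by m / 2 compensates for the degree n - m of \<open>h m\<close>, so
  the Gamma factor is the same for all terms. Hence \<open>lift_int\<close> inherits rotation
  invariance from the Gaussian integral, whatever decomposition of \<open>H\<close> is used.\<close>

lemma lift_int_gauss:
  fixes h :: "nat \<Rightarrow> 'a::euclidean_space \<Rightarrow> real"
  assumes "\<mu> \<ge> 0" and hom: "\<And>m. m \<le> n \<Longrightarrow> hom_poly (n - m) (h m)"
    and H: "\<And>y s. H (y, s) = (\<Sum>m\<le>n. h m y * s ^ m)"
  shows "Gamma (\<mu> + 1/2 + (n + DIM('a)) / 2) * (sqrt pi * lift_int \<mu> n h) = Gamma (\<mu> + 1/2) * gauss_int H"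
proof -
  have Hz: "H z = (\<Sum>m\<le>n. h m (fst z) * snd z ^ m)" for z
    using H[of "fst z" "snd z"] by simp
  have "gauss_int H = (\<Sum>m\<le>n. gauss_int (\<lambda>(y, s). h m y * s ^ m))"
    unfolding gauss_int_def case_prod_beta'
    by (subst Bochner_Integration.integral_sum[symmetric])
      (use gauss_int_prod(2)[OF hom] in \<open>auto simp: case_prod_beta' sum_distrib_right Hz\<close>)
  moreover have "Gamma (\<mu> + 1/2 + (n + DIM('a)) / 2) * (sqrt pi * (mom \<mu> m * ball_int (m / 2 + \<mu> - 1/2) (h m))) =
      Gamma (\<mu> + 1/2) * gauss_int (\<lambda>(y, s). h m y * s ^ m)" if "m \<le> n" for m
  proof (cases "even m")
    case False
    then show ?thesis by (simp add: gauss_int_prod(1)[OF hom[OF that]] gauss_int_power)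
  next
    case True
    then obtain k where m: "m = 2 * k" by (elim evenE)
    have G: "Gamma (\<mu> + 1/2) > 0" using \<open>\<mu> \<ge> 0\<close> by (auto intro!: Gamma_real_pos)
    have "\<mu> + 1/2 \<notin> \<int>\<^sub>\<le>\<^sub>0" using \<open>\<mu> \<ge> 0\<close> by (auto elim!: nonpos_Ints_cases)
    then have poch: "Gamma (\<mu> + 1/2 + k) = pochhammer (\<mu> + 1/2) k * Gamma (\<mu> + 1/2)"
      using G by (simp add: pochhammer_Gamma)
    have "m / 2 + \<mu> - 1/2 > -1" using \<open>\<mu> \<ge> 0\<close> by (simp add: add_nonneg_pos)
    from hom_ball_gauss[OF hom[OF that] this]
    have "Gamma (\<mu> + 1/2 + k) * gauss_int (h m) =
        Gamma (\<mu> + 1/2 + (n + DIM('a)) / 2) * ball_int (m / 2 + \<mu> - 1/2) (h m)"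
    proof -
      assume *: "Gamma (m / 2 + \<mu> - 1/2 + 1) * gauss_int (h m) =
        Gamma (m / 2 + \<mu> - 1/2 + 1 + (real (n - m) + DIM('a)) / 2) * ball_int (m / 2 + \<mu> - 1/2) (h m)"
      have "m / 2 + \<mu> - 1/2 + 1 = \<mu> + 1/2 + k" by (simp add: m)
      moreover have "\<mu> + 1/2 + k + (real (n - m) + DIM('a)) / 2 = \<mu> + 1/2 + (n + DIM('a)) / 2"
        using that by (simp add: m of_nat_diff field_simps)
      ultimately show ?thesis using * by (simp only: simp_thms)
    qed
    then have *: "pochhammer (\<mu> + 1/2) k * Gamma (\<mu> + 1/2) * gauss_int (h m) =
        Gamma (\<mu> + 1/2 + (n + DIM('a)) / 2) * ball_int (m / 2 + \<mu> - 1/2) (h m)"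
      by (simp only: poch)
    have ne: "pochhammer (\<mu> + 1/2) k \<noteq> 0" using \<open>\<mu> \<ge> 0\<close> pochhammer_pos[of "\<mu> + 1/2" k] by simp
    have arith: "G2 * (sp * (q / P * b)) = G1 * (g * (sp * q))" if "P \<noteq> 0" "P * G1 * g = G2 * b"
      for P G1 G2 g b sp q :: real
    proof -
      have "G2 * (sp * (q / P * b)) = sp * q / P * (G2 * b)" by simp
      also have "\<dots> = G1 * (g * (sp * q))" unfolding that(2)[symmetric] using that(1) by simp
      finally show ?thesis .
    qed
    have "mom \<mu> m = pochhammer (1/2) k / pochhammer (\<mu> + 1/2) k"
        "gauss_int (\<lambda>s :: real. s ^ m) = sqrt pi * pochhammer (1/2) k"
      by (simp_all only: mom_def gauss_int_power True if_True) (simp_all add: m)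
    then show ?thesis
      unfolding gauss_int_prod(1)[OF hom[OF that]] by (simp only: arith[OF ne *])
  qed
  ultimately show ?thesis
    unfolding lift_int_def by (simp add: sum_distrib_left)
qed

lemma gauss_int_orthogonal:
  fixes H :: "(real ^ 'd) \<times> real \<Rightarrow> real" and R :: "(real ^ 'd) \<times> real \<Rightarrow> (real ^ 'd) \<times> real"
  assumes "hom_poly n H" "linear R" and norm: "\<And>z. norm (R z) = norm z"
  shows "gauss_int (\<lambda>z. H (R z)) = gauss_int H"
proof -
  have [measurable]: "R \<in> borel_measurable borel" "H \<in> borel_measurable borel"
    using assms hom_poly_borel by (auto intro!: borel_measurable_continuous_onI linear_continuous_on simp: linear_linear)
  have "gauss_int H = (LINT z|distr lborel borel R. H z * exp (- (norm z)\<^sup>2))"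
    unfolding gauss_int_def lborel_distr_orthogonal_prod[OF assms(2,3)] ..
  also have "\<dots> = gauss_int (\<lambda>z. H (R z))"
    unfolding gauss_int_def by (subst integral_distr) (simp_all add: norm)
  finally show ?thesis ..
qed

text \<open>The Householder reflection in the hyperplane orthogonal to \<open>X - e\<close>; it
  degenerates to the identity when \<open>X = e\<close>.\<close>

lemma ex_reflection:
  fixes e X :: "'a::real_inner"
  assumes "norm e = 1" "norm X = 1"
  obtains R where "linear R" "\<And>z. norm (R z) = norm z" "R e = X" "\<And>z. X \<bullet> R z = e \<bullet> z"
proof -
  define w where "w = X - e"
  define R where "R z = z - (2 * (w \<bullet> z) / (w \<bullet> w)) *\<^sub>R w" for z
  have "linear R"
    by (rule linearI) (auto simp: R_def inner_add_right algebra_simps add_divide_distrib)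
  have inner: "R z \<bullet> R z' = z \<bullet> z'" for z z'
    by (cases "w = 0") (auto simp: R_def inner_diff_left inner_diff_right inner_commute field_simps)
  have "R e = X"
  proof (cases "w = 0")
    case False
    have "w \<bullet> w = 2 - 2 * (X \<bullet> e)" "w \<bullet> e = X \<bullet> e - 1"
      using assms by (auto simp: w_def inner_diff_left inner_diff_right inner_commute norm_eq_1)
    moreover have "w \<bullet> w \<noteq> 0" using False by simp
    ultimately have "2 * (w \<bullet> e) / (w \<bullet> w) = -1"
      by (simp only: divide_eq_eq) simp
    then show ?thesis by (simp add: R_def w_def)
  qed (simp add: R_def w_def)
  moreover have "norm (R z) = norm z" for z by (simp add: norm_eq_sqrt_inner inner)
  ultimately show thesis using that[of R] \<open>linear R\<close> inner[of e] by metis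
qed

text \<open>Positivity is read off on the Gaussian side, where the integrand vanishes nowhere, and
  transferred by positive Gamma factors.\<close>

lemma ball_int_one_pos:
  assumes "s > -1"
  shows "ball_int s (\<lambda>_ :: 'a::euclidean_space. 1) > 0"
proof -
  have hom: "hom_poly 0 (\<lambda>_ :: 'a. 1)" by (rule hom_poly_const)
  have "gauss_int (\<lambda>_ :: 'a. 1) \<noteq> 0"
  proof
    assume "gauss_int (\<lambda>_ :: 'a. 1) = 0"
    then have "AE y in (lborel :: 'a measure). exp (- (norm y)\<^sup>2) = 0"
      using hom_gauss_integrable[OF hom]
      by (subst (asm) gauss_int_def, subst (asm) integral_nonneg_eq_0_iff_AE) auto
    then have "AE y in (lborel :: 'a measure). False" by simp
    then have "emeasure lborel (UNIV :: 'a set) = 0" by (subst (asm) AE_iff_null) (auto simp: null_sets_def)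
    then show False by (simp add: emeasure_lborel_UNIV)
  qed
  moreover have "gauss_int (\<lambda>_ :: 'a. 1) \<ge> 0"
    unfolding gauss_int_def by (intro Bochner_Integration.integral_nonneg) auto
  ultimately have "0 < Gamma (s + 1) * gauss_int (\<lambda>_ :: 'a. 1)"
    using assms by (intro mult_pos_pos Gamma_real_pos) auto
  moreover have "Gamma (s + 1 + (real 0 + DIM('a)) / 2) > 0"
    using assms by (intro Gamma_real_pos add_pos_nonneg[of "s + 1"]) auto
  ultimately show ?thesis
    unfolding hom_ball_gauss[OF hom assms] by (simp add: zero_less_mult_iff)
qed

text \<open>The Gaussian integral of \<open>h\<close> does not involve the weight exponent, so it
  links the ball integrals at exponents k + \<mu> - 1/2 and \<mu> - 1/2. The resulting quotient of
  Pochhammer symbols is the beta integral of \<open>mfun_lsq_power\<close>. This is how integrating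
  out all coordinates but one yields a one-variable functional with parameter \<mu> + d / 2.\<close>

lemma ball_int_radial:
  fixes h :: "'a::euclidean_space \<Rightarrow> real"
  assumes "\<mu> \<ge> 0" and hom: "hom_poly (2 * i) h"
  defines "\<nu> \<equiv> \<mu> + DIM('a) / 2"
  shows "mom \<mu> (2 * k) * ball_int (k + \<mu> - 1/2) h =
    ball_int (\<mu> - 1/2) h * (pochhammer (\<nu> + 1/2) i / pochhammer \<nu> i) * mfun \<nu> (monom 1 (2 * k) * lsq ^ i)"
proof -
  have \<nu>: "\<nu> > 0" using \<open>\<mu> \<ge> 0\<close> by (simp add: \<nu>_def add_nonneg_pos)
  have G: "Gamma (\<mu> + 1/2) > 0" "Gamma (\<nu> + 1/2 + i) > 0" using \<open>\<mu> \<ge> 0\<close> \<nu> by (auto intro!: Gamma_real_pos)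
  have "\<mu> + 1/2 \<notin> \<int>\<^sub>\<le>\<^sub>0" "\<nu> + 1/2 + i \<notin> \<int>\<^sub>\<le>\<^sub>0" using \<open>\<mu> \<ge> 0\<close> \<nu> by (auto elim!: nonpos_Ints_cases)
  then have poch: "Gamma (\<mu> + 1/2 + k) = pochhammer (\<mu> + 1/2) k * Gamma (\<mu> + 1/2)"
      "Gamma (\<nu> + 1/2 + i + k) = pochhammer (\<nu> + 1/2 + i) k * Gamma (\<nu> + 1/2 + i)"
    using G by (simp_all add: pochhammer_Gamma)
  have *: "Gamma (\<mu> + 1/2 + k) * gauss_int h = Gamma (\<nu> + 1/2 + i + k) * ball_int (k + \<mu> - 1/2) h" for k :: nat
  proof -
    have "k + \<mu> - 1/2 + 1 = \<mu> + 1/2 + k"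
      "\<mu> + 1/2 + k + (real (2 * i) + DIM('a)) / 2 = \<nu> + 1/2 + i + k"
      by (simp_all add: \<nu>_def add_divide_distrib)
    moreover have "k + \<mu> - 1/2 > -1" using \<open>\<mu> \<ge> 0\<close> by (simp add: add_nonneg_pos)
    ultimately show ?thesis using hom_ball_gauss[OF hom, of "k + \<mu> - 1/2"] by (simp only: simp_thms)
  qed
  have 1: "pochhammer (\<mu> + 1/2) k * (Gamma (\<mu> + 1/2) * gauss_int h) =
      Gamma (\<nu> + 1/2 + i) * (pochhammer (\<nu> + 1/2 + i) k * ball_int (k + \<mu> - 1/2) h)"
    using *[of k] unfolding poch by (simp only: mult_ac)
  have 2: "Gamma (\<mu> + 1/2) * gauss_int h = Gamma (\<nu> + 1/2 + i) * ball_int (\<mu> - 1/2) h"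
    using *[of 0] by simp
  have "Gamma (\<nu> + 1/2 + i) * (pochhammer (\<nu> + 1/2 + i) k * ball_int (k + \<mu> - 1/2) h) =
      Gamma (\<nu> + 1/2 + i) * (pochhammer (\<mu> + 1/2) k * ball_int (\<mu> - 1/2) h)"
    unfolding 1[symmetric] 2 by (rule mult.left_commute)
  then have rel: "pochhammer (\<nu> + 1/2 + i) k * ball_int (k + \<mu> - 1/2) h = pochhammer (\<mu> + 1/2) k * ball_int (\<mu> - 1/2) h"
    using G by (simp only: mult_left_cancel[OF less_imp_neq[OF G(2), symmetric]])
  have pos: "pochhammer (\<nu> + 1/2) i > 0" "pochhammer \<nu> i > 0" "pochhammer (\<nu> + 1/2 + i) k > 0" "pochhammer (\<mu> + 1/2) k > 0"
    using \<nu> \<open>\<mu> \<ge> 0\<close> by (auto intro!: pochhammer_pos)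
  have prod: "pochhammer (\<nu> + 1/2) (k + i) = pochhammer (\<nu> + 1/2) i * pochhammer (\<nu> + 1/2 + i) k"
    using pochhammer_product'[of "\<nu> + 1/2" i k] by (simp add: add.commute)
  have B: "ball_int (k + \<mu> - 1/2) h = pochhammer (\<mu> + 1/2) k * ball_int (\<mu> - 1/2) h / pochhammer (\<nu> + 1/2 + i) k"
    using rel pos by (simp add: eq_divide_eq mult.commute)
  show ?thesis
    unfolding mfun_lsq_power[OF \<nu>] prod B mom_def using pos by simp
qed

section \<open>The translation operator\<close>

text \<open>
  The expectation of \<open>(x \<bullet> y + u * sqrt (1 - norm x ^ 2) * sqrt (1 - norm y ^ 2)) ^ j\<close>,
  where \<open>u\<close> has the moments \<open>mom \<mu>\<close>; written out, it is a polynomial in \<open>x\<close> and \<open>y\<close>.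
\<close>

definition trans_mono :: "real \<Rightarrow> nat \<Rightarrow> real ^ 'd \<Rightarrow> real ^ 'd \<Rightarrow> real" where
  "trans_mono \<mu> j x y = (\<Sum>m\<le>j. real (j choose m) * (x \<bullet> y) ^ (j - m) *
     (mom \<mu> m * ((1 - (norm x)\<^sup>2) * (1 - (norm y)\<^sup>2)) ^ (m div 2)))"

text \<open>For even \<open>m\<close> the power of \<open>1 - norm y ^ 2\<close> in
  \<open>trans_mono\<close> is absorbed by the weight, and for odd \<open>m\<close> the moment is 0.
  Thus the left-hand side takes the shape of \<open>lift_int\<close>, with no square root of
  \<open>1 - norm y ^ 2\<close> left.\<close>

lemma trans_mono_lift_int:
  fixes x :: "real ^ 'd" and j :: nat
  assumes \<mu>: "\<mu> \<ge> 0" and x: "norm x \<le> 1" and q: "hom_poly r q"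
  defines "h m \<equiv> (\<lambda>y. real (j choose m) * sqrt (1 - (norm x)\<^sup>2) ^ m * ((x \<bullet> y) ^ (j - m) * q y))"
  shows "ball_int (\<mu> - 1/2) (\<lambda>y. trans_mono \<mu> j x y * q y) = (\<Sum>m\<le>j. mom \<mu> m * ball_int (m / 2 + \<mu> - 1/2) (h m))"
    and "m \<le> j \<Longrightarrow> hom_poly (j + r - m) (h m)"
proof -
  have hom: "hom_poly (j + r - m) (h m)" if "m \<le> j" for m
  proof -
    have "hom_poly ((j - m) * 1 + r) (\<lambda>y. (x \<bullet> y) ^ (j - m) * q y)"
      by (rule hom_poly_mult[OF hom_poly_power[OF hom_poly_linear[OF bounded_linear_inner_right]] q])
    moreover have "(j - m) * 1 + r = j + r - m" using that by simp
    ultimately show ?thesis unfolding h_def by (metis hom_poly_cmult)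
  qed
  then show "m \<le> j \<Longrightarrow> hom_poly (j + r - m) (h m)" .
  define g where "g m y = mom \<mu> m * (1 - (norm y)\<^sup>2) ^ (m div 2) * h m y" for m and y :: "real ^ 'd"
  have s2: "sqrt (1 - (norm x)\<^sup>2) ^ (k * 2) = (1 - (norm x)\<^sup>2) ^ k" for k
    using x by (simp add: power_mult mult.commute[of k] abs_square_le_1)
  have gsum: "trans_mono \<mu> j x y * q y = (\<Sum>m\<le>j. g m y)" for y
    unfolding trans_mono_def sum_distrib_right
  proof (rule sum.cong, rule refl)
    fix m
    show "real (j choose m) * (x \<bullet> y) ^ (j - m) * (mom \<mu> m * ((1 - (norm x)\<^sup>2) * (1 - (norm y)\<^sup>2)) ^ (m div 2)) * q y = g m y"
    proof (cases "even m")
      case True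
      then obtain k where "m = 2 * k" by (elim evenE)
      then show ?thesis by (simp add: g_def h_def s2 power_mult_distrib mult_ac)
    qed (simp add: g_def)
  qed
  have gh: "g m y * (1 - (norm y)\<^sup>2) powr (\<mu> - 1/2) =
      mom \<mu> m * h m y * (1 - (norm y)\<^sup>2) powr (m / 2 + \<mu> - 1/2)" if "norm y \<le> 1" for m y
  proof (cases "even m")
    case True
    then obtain k where m: "m = 2 * k" by (elim evenE)
    have "1 - (norm y)\<^sup>2 \<ge> 0" using that by (simp add: abs_square_le_1)
    then have "(1 - (norm y)\<^sup>2) ^ k * (1 - (norm y)\<^sup>2) powr (\<mu> - 1/2) = (1 - (norm y)\<^sup>2) powr (k + \<mu> - 1/2)"
      by (cases "1 - (norm y)\<^sup>2 = 0") (auto simp: powr_realpow[symmetric] powr_add[symmetric] algebra_simps)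
    then show ?thesis by (simp add: g_def m mult_ac)
  qed (simp add: g_def)
  have int: "ball_integrable (\<mu> - 1/2) (g m)" if "m \<le> j" for m
  proof -
    have "ball_integrable (m / 2 + \<mu> - 1/2) (\<lambda>y. mom \<mu> m * h m y)"
      using hom[OF that] \<mu> by (intro ball_integrable_cmult hom_ball_integrable[of "j + r - m"]) (auto simp: add_nonneg_pos)
    moreover have "indicator (cball 0 1) y * (g m y * (1 - (norm y)\<^sup>2) powr (\<mu> - 1/2)) =
        indicator (cball 0 1) y * (mom \<mu> m * h m y * (1 - (norm y)\<^sup>2) powr (m / 2 + \<mu> - 1/2))" for y :: "real ^ 'd"
      using gh[of y m] by (auto simp: indicator_def)
    ultimately show ?thesis unfolding ball_integrable_def by (simp only:)
  qed
  have "ball_int (\<mu> - 1/2) (\<lambda>y. trans_mono \<mu> j x y * q y) = (\<Sum>m\<le>j. ball_int (\<mu> - 1/2) (g m))"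
    unfolding gsum by (rule ball_int_sum) (use int in auto)
  also have "\<dots> = (\<Sum>m\<le>j. ball_int (m / 2 + \<mu> - 1/2) (\<lambda>y. mom \<mu> m * h m y))"
    by (intro sum.cong refl ball_int_cong gh)
  finally show "ball_int (\<mu> - 1/2) (\<lambda>y. trans_mono \<mu> j x y * q y) = (\<Sum>m\<le>j. mom \<mu> m * ball_int (m / 2 + \<mu> - 1/2) (h m))"
    by (simp add: ball_int_cmult)
qed

text \<open>
  The left-hand integral is the Gaussian integral, over \<open>(real ^ 'd) \<times> real\<close>, of
  \<open>(X \<bullet> z) ^ j * q (fst z)\<close> with \<open>X = (x, sqrt (1 - norm x ^ 2))\<close>, up to a factor depending on the
  degree only. A reflection moves the unit vector \<open>X\<close> to the last basis vector, and integrating out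
  all but the last coordinate leaves a polynomial \<open>p\<close> in one variable.
\<close>

lemma trans_mono_integral:
  fixes x :: "real ^ 'd"
  assumes \<mu>: "\<mu> \<ge> 0" and x: "norm x \<le> 1" and q: "hom_poly r q"
  defines "\<nu> \<equiv> \<mu> + CARD('d) / 2"
  shows "\<exists>p. degree p \<le> r \<and> poly p 1 = q x \<and>
    (\<forall>j. ball_int (\<mu> - 1/2) (\<lambda>y. trans_mono \<mu> j x y * q y) =
      ball_int (\<mu> - 1/2) (\<lambda>_ :: real ^ 'd. 1) * mfun \<nu> (monom 1 j * p))"
proof -
  define \<omega> where "\<omega> = ball_int (\<mu> - 1/2) (\<lambda>_ :: real ^ 'd. 1)"
  have \<omega>: "\<omega> > 0" unfolding \<omega>_def by (rule ball_int_one_pos) (use \<mu> in auto)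
  define a where "a = sqrt (1 - (norm x)\<^sup>2)"
  have a2: "a\<^sup>2 = 1 - (norm x)\<^sup>2" using x by (simp add: a_def abs_square_le_1)
  define X where "X = (x, a)"
  have "norm X = 1" by (simp add: X_def norm_Pair a2)
  then obtain R :: "(real ^ 'd) \<times> real \<Rightarrow> (real ^ 'd) \<times> real" where R: "linear R" "\<And>z. norm (R z) = norm z" "R (0, 1) = X" "\<And>z. X \<bullet> R z = (0, 1) \<bullet> z"
    by (rule ex_reflection[of "(0, 1)", rotated]) (auto simp: norm_Pair)
  have blR: "bounded_linear R" using R(1) by (simp add: linear_conv_bounded_linear)
  have homQ: "hom_poly r (\<lambda>z. q (fst (R z)))"
    by (rule hom_poly_compose[OF q bounded_linear_compose[OF bounded_linear_fst blR]])
  then obtain q' where q': "\<And>m. m \<le> r \<Longrightarrow> hom_poly (r - m) (q' m)"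
      "\<And>y s. q (fst (R (y, s))) = (\<Sum>m\<le>r. q' m y * s ^ m)"
    using hom_poly_decompose[OF homQ] by metis
  define i where "i m = (r - m) div 2" for m
  \<comment> \<open>The coefficient of \<open>s ^ m\<close> in the reflected \<open>q\<close> has
    degree r - m. For even r - m, \<open>ball_int_radial\<close> with i = (r - m) / 2 replaces it by
    a multiple of \<open>lsq ^ i\<close>; for odd r - m it integrates to 0.\<close>
  define p where "p = (\<Sum>m\<le>r. if even (r - m) then
    smult (ball_int (\<mu> - 1/2) (q' m) / \<omega> * (pochhammer (\<nu> + 1/2) (i m) / pochhammer \<nu> (i m)))
      (monom 1 m * lsq ^ i m) else 0)"
  have dlsq: "degree lsq = 2" by (simp add: lsq_def)
  have "degree p \<le> r" unfolding p_def
  proof (rule degree_sum_le)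
    fix m assume m: "m \<in> {..r}"
    show "degree (if even (r - m) then
      smult (ball_int (\<mu> - 1/2) (q' m) / \<omega> * (pochhammer (\<nu> + 1/2) (i m) / pochhammer \<nu> (i m)))
      (monom 1 m * lsq ^ i m) else 0) \<le> r"
    proof (cases "even (r - m)")
      case True
      have "degree (monom (1 :: real) m * lsq ^ i m) \<le> m + 2 * i m"
        by (rule order.trans[OF degree_mult_le]) (simp add: degree_monom_eq degree_power_eq dlsq lsq_def)
      also have "\<dots> = r" using True m by (simp add: i_def)
      finally show ?thesis using True by (simp only: if_True) (rule order.trans[OF degree_smult_le])
    qed simp
  qed simp
  moreover have "poly p 1 = q x"
  proof -
    \<comment> \<open>At 1 every positive power of \<open>lsq\<close> vanishes, so only the constant
      \<open>q' r\<close> survives. It is the value of the reflected \<open>q\<close> at the last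
      basis vector, which \<open>R\<close> sends to \<open>X\<close>.\<close>
    have "poly p 1 = (\<Sum>m\<le>r. if m = r then q' r 0 else 0)"
      unfolding p_def poly_sum
    proof (rule sum.cong, rule refl)
      fix m assume m: "m \<in> {..r}"
      have "q' r y = q' r 0" for y using q'(1)[of r] hom_poly_0_eq[of "q' r"] by simp
      then have "ball_int (\<mu> - 1/2) (q' r) = q' r 0 * \<omega>"
        unfolding \<omega>_def ball_int_cmult[symmetric] by (intro ball_int_cong) simp
      then have r: "ball_int (\<mu> - 1/2) (q' r) / \<omega> = q' r 0" using \<omega> by simp
      show "poly (if even (r - m) then
        smult (ball_int (\<mu> - 1/2) (q' m) / \<omega> * (pochhammer (\<nu> + 1/2) (i m) / pochhammer \<nu> (i m)))
        (monom 1 m * lsq ^ i m) else 0) 1 = (if m = r then q' r 0 else 0)"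
      proof (cases "m = r")
        case True
        then show ?thesis using r by (simp add: i_def poly_monom)
      next
        case False
        have "i m > 0" if "even (r - m)"
          using that False m unfolding i_def atMost_iff by presburger
        then show ?thesis using False by (auto simp: poly_monom poly_power)
      qed
    qed
    also have "\<dots> = (\<Sum>m\<le>r. q' m 0 * 1 ^ m)"
      using hom_poly_at_0[OF q'(1)] by (intro sum.cong) auto
    also have "\<dots> = q x" unfolding q'(2)[symmetric] R(3) by (simp add: X_def)
    finally show ?thesis .
  qed
  moreover have "ball_int (\<mu> - 1/2) (\<lambda>y. trans_mono \<mu> j x y * q y) = \<omega> * mfun \<nu> (monom 1 j * p)" for j
  proof -
    define h where "h m = (if m \<le> j then (\<lambda>y. real (j choose m) * sqrt (1 - (norm x)\<^sup>2) ^ m * ((x \<bullet> y) ^ (j - m) * q y))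
      else (\<lambda>_. 0))" for m
    \<comment> \<open>After the reflection \<open>X \<bullet> R (y, s) = s\<close>, so the factor
      \<open>s ^ j\<close> merely shifts the coefficients of \<open>q\<close> by
      \<open>j\<close>.\<close>
    define h' where "h' m = (if j \<le> m then q' (m - j) else (\<lambda>_. 0))" for m
    define H where "H z = (X \<bullet> z) ^ j * q (fst z)" for z
    have homH: "hom_poly (j * 1 + r) H" unfolding H_def
      by (rule hom_poly_mult[OF hom_poly_power[OF hom_poly_linear[OF bounded_linear_inner_right]]
          hom_poly_compose[OF q bounded_linear_fst]])
    have hom_h: "hom_poly (j + r - m) (h m)" for m
      using trans_mono_lift_int(2)[OF \<mu> x q] by (auto simp: h_def hom_poly_zero)
    have hom_h': "hom_poly (j + r - m) (h' m)" if "m \<le> j + r" for m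
      using that q'(1)[of "m - j"] by (auto simp: h'_def hom_poly_zero add.commute[of j r])
    have H1: "H (y, s) = (\<Sum>m\<le>j + r. h m y * s ^ m)" for y s
    proof -
      have "H (y, s) = (a * s + x \<bullet> y) ^ j * q y" by (simp add: H_def X_def add.commute)
      also have "\<dots> = (\<Sum>m\<le>j. h m y * s ^ m)"
        unfolding binomial_ring sum_distrib_right
        by (intro sum.cong) (auto simp: h_def a_def power_mult_distrib mult_ac)
      also have "\<dots> = (\<Sum>m\<le>j + r. h m y * s ^ m)"
        by (intro sum.mono_neutral_left) (auto simp: h_def)
      finally show ?thesis .
    qed
    have sum_shift: "(\<Sum>m\<le>j + r. f m) = (\<Sum>m\<le>r. f (m + j))" if "\<And>m. m < j \<Longrightarrow> f m = 0" for f :: "nat \<Rightarrow> real"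
    proof -
      have "(\<Sum>m\<le>j + r. f m) = (\<Sum>m\<in>{j..j + r}. f m)"
        using that by (intro sum.mono_neutral_right) auto
      also have "\<dots> = (\<Sum>m\<le>r. f (m + j))"
        using sum.shift_bounds_cl_nat_ivl[of f 0 j r] by (simp add: atLeast0AtMost add.commute)
      finally show ?thesis .
    qed
    have H2: "H (R (y, s)) = (\<Sum>m\<le>j + r. h' m y * s ^ m)" for y s
    proof -
      have "H (R (y, s)) = s ^ j * (\<Sum>m\<le>r. q' m y * s ^ m)"
        by (simp add: H_def R(4) q'(2))
      also have "\<dots> = (\<Sum>m\<le>j + r. h' m y * s ^ m)"
        by (subst sum_shift) (auto simp: h'_def sum_distrib_left power_add mult_ac)
      finally show ?thesis .
    qed
    have G: "Gamma (\<mu> + 1/2 + (real (j + r) + DIM(real ^ 'd)) / 2) * sqrt pi > 0"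
      using \<mu> by (intro mult_pos_pos Gamma_real_pos add_pos_nonneg[of "\<mu> + 1/2"]) auto
    \<comment> \<open>\<open>H\<close> and its composition with \<open>R\<close> have equal Gaussian
      integrals, which makes the \<open>lift_int\<close> of their two decompositions agree.\<close>
    have "Gamma (\<mu> + 1/2 + (real (j + r) + DIM(real ^ 'd)) / 2) * sqrt pi * lift_int \<mu> (j + r) h =
        Gamma (\<mu> + 1/2 + (real (j + r) + DIM(real ^ 'd)) / 2) * sqrt pi * lift_int \<mu> (j + r) h'"
      using lift_int_gauss[OF \<mu> hom_h, of H] lift_int_gauss[OF \<mu> hom_h', of "\<lambda>z. H (R z)"]
        H1 H2 gauss_int_orthogonal[OF homH R(1,2)] by (simp add: mult.assoc)
    then have "lift_int \<mu> (j + r) h = lift_int \<mu> (j + r) h'"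
      by (rule mult_left_cancel[OF less_imp_neq[OF G, symmetric], THEN iffD1])
    moreover have "lift_int \<mu> (j + r) h = (\<Sum>m\<le>j. mom \<mu> m * ball_int (m / 2 + \<mu> - 1/2) (h m))"
      unfolding lift_int_def by (intro sum.mono_neutral_right) (auto simp: h_def)
    moreover have "\<dots> = ball_int (\<mu> - 1/2) (\<lambda>y. trans_mono \<mu> j x y * q y)"
      unfolding trans_mono_lift_int(1)[OF \<mu> x q] by (intro sum.cong) (auto simp: h_def)
    moreover have "lift_int \<mu> (j + r) h' = (\<Sum>m\<le>r. mom \<mu> (m + j) * ball_int ((m + j) / 2 + \<mu> - 1/2) (q' m))"
      unfolding lift_int_def by (subst sum_shift) (auto simp: h'_def)
    moreover have "\<dots> = (\<Sum>m\<le>r. \<omega> * mfun \<nu> (monom 1 j * (if even (r - m) then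
        smult (ball_int (\<mu> - 1/2) (q' m) / \<omega> * (pochhammer (\<nu> + 1/2) (i m) / pochhammer \<nu> (i m)))
          (monom 1 m * lsq ^ i m) else 0)))"
    proof (rule sum.cong, rule refl)
      fix m assume m: "m \<in> {..r}"
      let ?c = "ball_int (\<mu> - 1/2) (q' m) / \<omega> * (pochhammer (\<nu> + 1/2) (i m) / pochhammer \<nu> (i m))"
      show "mom \<mu> (m + j) * ball_int ((m + j) / 2 + \<mu> - 1/2) (q' m) =
        \<omega> * mfun \<nu> (monom 1 j * (if even (r - m) then smult ?c (monom 1 m * lsq ^ i m) else 0))"
      proof (cases "even (r - m)")
        case False
        then show ?thesis using ball_int_odd[OF q'(1)[of m]] m by simp
      next
        case even: True
        have prod: "monom 1 j * smult ?c (monom 1 m * lsq ^ i m) = smult ?c (monom 1 (m + j) * lsq ^ i m)"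
          by (simp add: mult_monom add.commute flip: mult.assoc)
        show ?thesis
        proof (cases "even (m + j)")
          case True
          then obtain k where k: "m + j = 2 * k" by (elim evenE)
          have "r - m = 2 * i m" using even by (simp add: i_def)
          then have "hom_poly (2 * i m) (q' m)" using q'(1)[of m] m by simp
          from ball_int_radial[OF \<mu> this, where k = k] show ?thesis
            using \<omega> by (simp only: even if_True prod mfun_smult k) (simp add: \<nu>_def)
        next
          case False
          have "mfun \<nu> (monom 1 (m + j) * lsq ^ i m) = 0" using False by (rule mfun_lsq_power_odd)
          then show ?thesis using False even by (simp only: prod if_True mfun_smult) simp
        qed
      qed
    qed
    moreover have "\<dots> = \<omega> * mfun \<nu> (monom 1 j * p)"
      by (simp only: p_def sum_distrib_left mfun_sum)
    ultimately show ?thesis by simp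
  qed
  ultimately show ?thesis unfolding \<omega>_def by blast
qed

section \<open>Gegenbauer polynomials\<close>

fun gegen :: "real \<Rightarrow> nat \<Rightarrow> real poly" where
  "gegen l 0 = 1"
| "gegen l (Suc 0) = [:0, 2 * l:]"
| "gegen l (Suc (Suc n)) =
    smult (2 * (real n + 1 + l) / (real n + 2)) (pCons 0 (gegen l (Suc n))) -
    smult ((real n + 2 * l) / (real n + 2)) (gegen l n)"

lemma gegen_rec:
  "(real n + 2) * poly (gegen l (Suc (Suc n))) t =
    2 * (real n + 1 + l) * t * poly (gegen l (Suc n)) t - (real n + 2 * l) * poly (gegen l n) t"
proof -
  have "poly (gegen l (Suc (Suc n))) t = (2 * (real n + 1 + l) * t * poly (gegen l (Suc n)) t -
      (real n + 2 * l) * poly (gegen l n) t) / (real n + 2)"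
    by (simp add: diff_divide_distrib)
  then show ?thesis by (subst (asm) nonzero_eq_divide_eq) (linarith, simp only: mult.commute)
qed

lemma gegen_rec_deriv:
  "(real n + 2) * poly (pderiv (gegen l (Suc (Suc n)))) t =
    2 * (real n + 1 + l) * (poly (gegen l (Suc n)) t + t * poly (pderiv (gegen l (Suc n))) t) -
    (real n + 2 * l) * poly (pderiv (gegen l n)) t"
proof -
  have "poly (pderiv (gegen l (Suc (Suc n)))) t =
      2 * (real n + 1 + l) / (real n + 2) * (poly (gegen l (Suc n)) t + t * poly (pderiv (gegen l (Suc n))) t) -
      (real n + 2 * l) / (real n + 2) * poly (pderiv (gegen l n)) t"
    by (simp only: gegen.simps pderiv_diff pderiv_smult pderiv_pCons poly_diff poly_smult poly_add poly_pCons) simp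
  moreover have "real n + 2 \<noteq> 0" by linarith
  ultimately show ?thesis by (simp only: right_diff_distrib) simp
qed

text \<open>The relations are proved jointly: the second at the next degree needs the first, and the
  first at the next degree needs both together with the three-term recurrence.\<close>

lemma gegen_deriv_relations:
  "(real n + 1) * poly (gegen l (Suc n)) t =
      t * poly (pderiv (gegen l (Suc n))) t - poly (pderiv (gegen l n)) t \<and>
    poly (pderiv (gegen l (Suc n))) t =
      t * poly (pderiv (gegen l n)) t + (real n + 2 * l) * poly (gegen l n) t"
proof (induction n)
  case 0
  show ?case by (simp add: pderiv_pCons pderiv_1)
next
  case (Suc n)
  define c0 c1 c2 d0 d1 d2 where "c0 = poly (gegen l n) t" and "c1 = poly (gegen l (Suc n)) t"
    and "c2 = poly (gegen l (Suc (Suc n))) t" and "d0 = poly (pderiv (gegen l n)) t"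
    and "d1 = poly (pderiv (gegen l (Suc n))) t" and "d2 = poly (pderiv (gegen l (Suc (Suc n)))) t"
  note defs = c0_def[symmetric] c1_def[symmetric] c2_def[symmetric]
    d0_def[symmetric] d1_def[symmetric] d2_def[symmetric]
  have A: "(real n + 1) * c1 = t * d1 - d0" and B: "d1 = t * d0 + (real n + 2 * l) * c0"
    using Suc unfolding defs by auto
  have R: "(real n + 2) * c2 = 2 * (real n + 1 + l) * t * c1 - (real n + 2 * l) * c0"
    using gegen_rec[of n l t] unfolding defs .
  have "(real n + 2) * d2 = 2 * (real n + 1 + l) * (c1 + t * d1) - (real n + 2 * l) * d0"
    using gegen_rec_deriv[of n l t] unfolding defs .
  also have "d0 = t * d1 - (real n + 1) * c1" using A by simp
  also have "2 * (real n + 1 + l) * (c1 + t * d1) - (real n + 2 * l) * (t * d1 - (real n + 1) * c1) =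
      (real n + 2) * (t * d1 + (real n + 1 + 2 * l) * c1)"
    by (simp add: algebra_simps)
  finally have B': "d2 = t * d1 + (real n + 1 + 2 * l) * c1"
    by (subst (asm) mult_left_cancel) auto
  have D: "d1 = t * (t * d1 - (real n + 1) * c1) + (real n + 2 * l) * c0"
    using A B by simp
  have "t * d2 - d1 = t * t * d1 + (real n + 1 + 2 * l) * t * c1 - d1"
    unfolding B' by (simp add: algebra_simps)
  also have "\<dots> = 2 * (real n + 1 + l) * t * c1 - (real n + 2 * l) * c0"
    using D by (simp add: algebra_simps)
  finally have A': "(real n + 2) * c2 = t * d2 - d1" using R by simp
  show ?case unfolding defs using A' B' by (simp add: add.commute)
qed

text \<open>The derivative relations give a first-order formula for
  \<open>lsq * pderiv (gegen l n)\<close> in terms of degrees n and n - 1. Differentiating it and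
  eliminating degree n - 1 leaves the equation.\<close>

lemma gegen_ode:
  "lsq * pderiv (pderiv (gegen l n)) =
    smult (2 * l + 1) ([:0, 1:] * pderiv (gegen l n)) - smult (real n * (real n + 2 * l)) (gegen l n)"
proof (cases n)
  case 0
  then show ?thesis by (simp add: pderiv_1)
next
  case (Suc k)
  have "lsq * pderiv (gegen l (Suc k)) =
      smult (- (real k + 1)) ([:0, 1:] * gegen l (Suc k)) + smult (real k + 2 * l) (gegen l k)" (is "?a = ?b")
  proof (rule poly_eq_poly_eq_iff[THEN iffD1], rule ext)
    fix t
    define c1 d1 c0 d0 where "c1 = poly (gegen l (Suc k)) t" and "d1 = poly (pderiv (gegen l (Suc k))) t"
      and "c0 = poly (gegen l k) t" and "d0 = poly (pderiv (gegen l k)) t"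
    have A: "(real k + 1) * c1 = t * d1 - d0" and B: "d1 = t * d0 + (real k + 2 * l) * c0"
      using gegen_deriv_relations[of k l t] by (auto simp: c1_def d1_def c0_def d0_def)
    have "(1 - t\<^sup>2) * d1 = d1 - t * d0 - t * (t * d1 - d0)"
      by (simp add: algebra_simps power2_eq_square)
    also have "\<dots> = - (real k + 1) * (t * c1) + (real k + 2 * l) * c0"
      unfolding A[symmetric] by (subst (1) B) (simp add: algebra_simps)
    finally show "poly ?a t = poly ?b t"
      by (simp add: c1_def d1_def c0_def)
  qed
  then have *: "poly (pderiv ?a) t = poly (pderiv ?b) t" for t by simp
  show ?thesis (is "?l = ?r")
  proof (rule poly_eq_poly_eq_iff[THEN iffD1], rule ext)
    fix t
    define c d e d0 where "c = poly (gegen l (Suc k)) t" and "d = poly (pderiv (gegen l (Suc k))) t"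
      and "e = poly (pderiv (pderiv (gegen l (Suc k)))) t" and "d0 = poly (pderiv (gegen l k)) t"
    have lsq': "pderiv lsq = [:0, -2:]" by (simp add: lsq_def pderiv_pCons)
    have "(1 - t\<^sup>2) * e - 2 * t * d = - (real k + 1) * (c + t * d) + (real k + 2 * l) * d0"
      using *[of t] unfolding c_def d_def e_def d0_def
      by (simp add: pderiv_mult pderiv_add pderiv_smult pderiv_pCons lsq' algebra_simps)
    moreover have "d0 = t * d - (real k + 1) * c"
      using gegen_deriv_relations[of k l t] by (simp add: c_def d_def d0_def)
    ultimately have "(1 - t\<^sup>2) * e = (2 * l + 1) * (t * d) - (real k + 1) * (real k + 1 + 2 * l) * c"
      by (simp add: algebra_simps)
    then show "poly ?l t = poly ?r t" by (simp add: Suc c_def d_def e_def add.commute)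
  qed
qed

section \<open>Degree, value at 1 and size of the Gegenbauer polynomials\<close>

lemma gegen_degree_le: "degree (gegen l n) \<le> n"
proof (induction l n rule: gegen.induct)
  case (3 l n)
  then show ?case
    by (auto intro!: degree_diff_le order.trans[OF degree_smult_le] order.trans[OF degree_pCons_le])
qed auto

lemma gegen_coeff_pos:
  assumes "l > 0"
  shows "coeff (gegen l n) n > 0"
  using assms
proof (induction l n rule: gegen.induct)
  case (3 l n)
  have "coeff (gegen l n) (Suc (Suc n)) = 0"
    by (rule coeff_eq_0) (use gegen_degree_le[of l n] in simp)
  with 3 show ?case by (auto intro!: divide_pos_pos mult_pos_pos)
qed auto

text \<open>At 1 the derivatives drop out of the two derivative relations, leaving a first-order
  recursion for the values.\<close>

lemma gegen_at_1: "poly (gegen l n) 1 = pochhammer (2 * l) n / fact n"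
proof -
  have "(real n + 1) * poly (gegen l (Suc n)) 1 = (real n + 2 * l) * poly (gegen l n) 1" for n
    using gegen_deriv_relations[of n l 1] by simp
  then have "poly (gegen l (Suc n)) 1 = (real n + 2 * l) / (real n + 1) * poly (gegen l n) 1" for n
    by (simp add: field_simps)
  note step = this
  show ?thesis
  proof (induction n)
    case (Suc n)
    show ?case unfolding step Suc by (simp add: pochhammer_Suc fact_Suc add_ac mult_ac)
  qed simp
qed

lemma gegen_at_1_pos: "l > 0 \<Longrightarrow> poly (gegen l n) 1 > 0"
  by (simp add: gegen_at_1 pochhammer_pos)

lemma gegen_uminus: "poly (gegen l n) (- t) = (-1) ^ n * poly (gegen l n) t"
proof (induction l n rule: gegen.induct)
  case (3 l n)
  have ne: "real n + 2 \<noteq> 0" by linarith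
  have "(real n + 2) * poly (gegen l (Suc (Suc n))) (- t) =
      (real n + 2) * ((-1) ^ Suc (Suc n) * poly (gegen l (Suc (Suc n))) t)"
    unfolding mult.left_commute[of "real n + 2"] gegen_rec 3 by (simp add: algebra_simps)
  then show ?case using ne by (simp only: mult_left_cancel[OF ne])
qed auto

text \<open>By the differential equation, the left-hand side (Sonin's function) is monotone in \<open>\<bar>t\<bar>\<close>.\<close>

lemma gegen_sonin:
  assumes l: "l > 0" and n: "n > 0" and t: "\<bar>t\<bar> \<le> 1"
  shows "(poly (gegen l n) t)\<^sup>2 + (1 - t\<^sup>2) * (poly (pderiv (gegen l n)) t)\<^sup>2 / (real n * (real n + 2 * l))
    \<le> (poly (gegen l n) 1)\<^sup>2"
proof -
  define v where "v = real n * (real n + 2 * l)"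
  have v: "v > 0" using l n by (simp add: v_def)
  define w where "w = 1 / v"
  define f where "f t = (poly (gegen l n) t)\<^sup>2 + w * ((1 - t\<^sup>2) * (poly (pderiv (gegen l n)) t)\<^sup>2)" for t
  \<comment> \<open>The differential equation cancels the product of the polynomial and its
    derivative; what remains has the sign of \<open>t\<close>.\<close>
  have f': "(f has_real_derivative 4 * l * t * (poly (pderiv (gegen l n)) t)\<^sup>2 / v) (at t)" for t
  proof -
    define c d e where "c = poly (gegen l n) t" and "d = poly (pderiv (gegen l n)) t"
      and "e = poly (pderiv (pderiv (gegen l n))) t"
    have "poly (lsq * pderiv (pderiv (gegen l n))) t = poly (smult (2 * l + 1) ([:0, 1:] * pderiv (gegen l n)) -
        smult (real n * (real n + 2 * l)) (gegen l n)) t"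
      unfolding gegen_ode ..
    then have ode: "(1 - t\<^sup>2) * e = (2 * l + 1) * t * d - v * c"
      by (simp add: c_def d_def e_def v_def)
    have "(f has_real_derivative 2 * c * d + w * ((- 2 * t) * d\<^sup>2 + (1 - t\<^sup>2) * (2 * d * e))) (at t)"
      unfolding f_def c_def d_def e_def
      by (auto intro!: derivative_eq_intros poly_DERIV simp: algebra_simps power2_eq_square)
    also have "2 * c * d + w * ((- 2 * t) * d\<^sup>2 + (1 - t\<^sup>2) * (2 * d * e)) =
        2 * c * d + w * ((- 2 * t) * d\<^sup>2 + 2 * d * ((2 * l + 1) * t * d - v * c))"
      unfolding ode[symmetric] by (simp add: mult_ac)
    also have "\<dots> = 2 * c * d * (1 - w * v) + w * (4 * l * t * d\<^sup>2)"
      by (simp add: algebra_simps power2_eq_square)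
    also have "\<dots> = 4 * l * t * d\<^sup>2 / v" using v by (simp add: w_def)
    finally show ?thesis by (simp add: d_def)
  qed
  have f1: "f 1 = (poly (gegen l n) 1)\<^sup>2" "f (-1) = (poly (gegen l n) 1)\<^sup>2"
    by (simp_all add: f_def gegen_uminus power_mult_distrib flip: power_mult)
  have "f t \<le> (poly (gegen l n) 1)\<^sup>2"
  proof (cases "t \<ge> 0")
    case True
    have "f t \<le> f 1"
    proof (rule DERIV_nonneg_imp_nondecreasing[of t 1 f])
      show "t \<le> 1" using t by simp
      fix x assume "t \<le> x" "x \<le> 1"
      then have "4 * l * x * (poly (pderiv (gegen l n)) x)\<^sup>2 / v \<ge> 0"
        using True l v by (intro divide_nonneg_pos mult_nonneg_nonneg) auto
      then show "\<exists>y. (f has_real_derivative y) (at x) \<and> 0 \<le> y" using f' by blast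
    qed
    then show ?thesis using f1 by simp
  next
    case False
    have "f t \<le> f (-1)"
    proof (rule DERIV_nonpos_imp_nonincreasing[of "-1" t f])
      show "- 1 \<le> t" using t by simp
      fix x assume "-1 \<le> x" "x \<le> t"
      then have "4 * l * x * (poly (pderiv (gegen l n)) x)\<^sup>2 / v \<le> 0"
        using False l v by (intro divide_nonpos_pos mult_nonpos_nonneg mult_nonneg_nonpos) auto
      then show "\<exists>y. (f has_real_derivative y) (at x) \<and> y \<le> 0" using f' by blast
    qed
    then show ?thesis using f1 by simp
  qed
  then show ?thesis by (simp add: f_def w_def v_def)
qed

lemma gegen_abs_le:
  assumes "l > 0" "\<bar>t\<bar> \<le> 1"
  shows "\<bar>poly (gegen l n) t\<bar> \<le> poly (gegen l n) 1"
proof (cases "n = 0")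
  case False
  have "(1 - t\<^sup>2) * (poly (pderiv (gegen l n)) t)\<^sup>2 / (real n * (real n + 2 * l)) \<ge> 0"
    using assms by (intro divide_nonneg_nonneg mult_nonneg_nonneg) (auto simp: abs_square_le_1)
  then have "(poly (gegen l n) t)\<^sup>2 \<le> (poly (gegen l n) 1)\<^sup>2"
    using gegen_sonin[of l n t] assms False by simp
  then show ?thesis using gegen_at_1_pos[OF assms(1), of n] by (simp add: abs_le_square_iff[symmetric])
qed simp

text \<open>Sonin's bound and n (n + 2 l) \<le> (n + l)^2 limit the derivative in \<theta> by n + l
  times the value at 1; the mean value theorem gives the rest. The polynomial thus stays comparable
  to its peak for angles up to order 1 / n.\<close>

lemma gegen_cos_ge:
  assumes l: "l > 0" and \<theta>: "0 \<le> \<theta>"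
  shows "poly (gegen l n) (cos \<theta>) \<ge> poly (gegen l n) 1 * (1 - (real n + l) * \<theta>)"
proof (cases "n = 0")
  case True
  then show ?thesis using assms by simp
next
  case False
  define g where "g \<theta> = poly (gegen l n) (cos \<theta>)" for \<theta>
  have g': "(g has_real_derivative - sin \<theta> * poly (pderiv (gegen l n)) (cos \<theta>)) (at \<theta>)" for \<theta>
    unfolding g_def by (rule DERIV_cong[OF DERIV_chain2[OF poly_DERIV]]) (auto intro!: derivative_eq_intros)
  have bound: "\<bar>- sin \<theta> * poly (pderiv (gegen l n)) (cos \<theta>)\<bar> \<le> (real n + l) * poly (gegen l n) 1" for \<theta>
  proof -
    let ?v = "real n * (real n + 2 * l)"
    have v: "?v > 0" using l False by simp
    have "(1 - (cos \<theta>)\<^sup>2) * (poly (pderiv (gegen l n)) (cos \<theta>))\<^sup>2 / ?v \<le> (poly (gegen l n) 1)\<^sup>2"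
      using gegen_sonin[OF l _ abs_cos_le_one, of n \<theta>] False
        zero_le_power2[of "poly (gegen l n) (cos \<theta>)"] by linarith
    then have "(sin \<theta>)\<^sup>2 * (poly (pderiv (gegen l n)) (cos \<theta>))\<^sup>2 \<le> ?v * (poly (gegen l n) 1)\<^sup>2"
      using v by (simp add: sin_squared_eq[symmetric] pos_divide_le_eq mult.commute)
    also have "?v * (poly (gegen l n) 1)\<^sup>2 \<le> (real n + l)\<^sup>2 * (poly (gegen l n) 1)\<^sup>2"
      by (intro mult_right_mono) (auto simp: power2_eq_square algebra_simps)
    finally have "(- sin \<theta> * poly (pderiv (gegen l n)) (cos \<theta>))\<^sup>2 \<le> ((real n + l) * poly (gegen l n) 1)\<^sup>2"
      by (simp add: power_mult_distrib)
    moreover have "(real n + l) * poly (gegen l n) 1 \<ge> 0"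
      using gegen_at_1_pos[OF l, of n] l by simp
    ultimately show ?thesis by (simp add: abs_le_square_iff[symmetric])
  qed
  have "g \<theta> \<ge> g 0 - \<theta> * ((real n + l) * poly (gegen l n) 1)"
  proof (cases "\<theta> = 0")
    case False
    then obtain z where "g \<theta> - g 0 = (\<theta> - 0) * (- sin z * poly (pderiv (gegen l n)) (cos z))"
      using MVT2[of 0 \<theta> g "\<lambda>z. - sin z * poly (pderiv (gegen l n)) (cos z)"] g' \<theta> by auto
    moreover have "\<theta> * (- sin z * poly (pderiv (gegen l n)) (cos z)) \<ge> \<theta> * (- ((real n + l) * poly (gegen l n) 1))"
      using bound[of z] \<theta> by (intro mult_left_mono) (auto simp: abs_le_iff)
    ultimately show ?thesis by (simp add: algebra_simps)
  qed simp
  then show ?thesis by (simp add: g_def algebra_simps)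
qed

text \<open>Integration by parts against \<open>(1 - u ^ 2) powr \<nu>\<close>; on monomials it is
  \<open>mom_Suc_Suc\<close>.\<close>

lemma mfun_lsq_pderiv:
  assumes "\<nu> \<ge> 0"
  shows "mfun \<nu> (lsq * pderiv f) = 2 * \<nu> * mfun \<nu> ([:0, 1:] * f)"
proof -
  have pderiv_sum: "pderiv (\<Sum>i\<in>A. g i) = (\<Sum>i\<in>A. pderiv (g i))" for g :: "nat \<Rightarrow> real poly" and A
    by (induction A rule: infinite_finite_induct) (auto simp: pderiv_add)
  have mono: "mfun \<nu> (lsq * pderiv (monom 1 m)) = 2 * \<nu> * mfun \<nu> ([:0, 1:] * monom 1 m)" for m
  proof (cases m)
    case 0
    then show ?thesis by (simp add: monom_0 mfun_def)
  next
    case (Suc k)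
    have "lsq * pderiv (monom 1 m) = smult (real k + 1) (monom 1 k - monom 1 (k + 2))"
    proof -
      have "pderiv (monom 1 m) = smult (real k + 1) (monom 1 k)"
        by (simp add: Suc pderiv_monom smult_monom add.commute)
      moreover have "lsq * monom 1 k = monom 1 k - monom 1 (k + 2)"
        using monom_mult_lsq_Suc[of k 0] by (simp add: mult.commute)
      ultimately show ?thesis by simp
    qed
    moreover have "[:0, 1:] * monom (1 :: real) m = monom 1 (Suc m)"
      by (simp add: monom_Suc)
    ultimately show ?thesis
      using mom_Suc_Suc[OF assms, of k] by (simp add: mfun_smult mfun_diff mfun_monom Suc algebra_simps)
  qed
  have f: "f = (\<Sum>i\<le>degree f. smult (coeff f i) (monom 1 i))"
    by (simp add: smult_monom poly_as_sum_of_monoms)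
  have "mfun \<nu> (lsq * pderiv f) = (\<Sum>i\<le>degree f. coeff f i * mfun \<nu> (lsq * pderiv (monom 1 i)))"
    by (subst f) (simp add: pderiv_sum pderiv_smult sum_distrib_left mfun_sum mfun_smult)
  also have "\<dots> = 2 * \<nu> * (\<Sum>i\<le>degree f. coeff f i * mfun \<nu> ([:0, 1:] * monom 1 i))"
    unfolding mono sum_distrib_left by (simp add: mult_ac)
  also have "(\<Sum>i\<le>degree f. coeff f i * mfun \<nu> ([:0, 1:] * monom 1 i)) = mfun \<nu> ([:0, 1:] * f)"
  proof -
    have "(\<Sum>i\<le>degree f. coeff f i * mfun \<nu> ([:0, 1:] * monom 1 i)) =
        mfun \<nu> ([:0, 1:] * (\<Sum>i\<le>degree f. smult (coeff f i) (monom 1 i)))"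
      by (simp only: sum_distrib_left mult_smult_right mfun_sum mfun_smult)
    then show ?thesis by (simp only: f[symmetric])
  qed
  finally show ?thesis .
qed

text \<open>The differential operator is symmetric for the functional with parameter l + 1/2: the
  right-hand side of \<open>key\<close> is symmetric when \<open>g\<close> is another Gegenbauer
  polynomial. Different degrees have different eigenvalues n (n + 2 l).\<close>

lemma mfun_gegen_orthogonal:
  assumes l: "l > 0" and "m \<noteq> n"
  shows "mfun (l + 1/2) (gegen l m * gegen l n) = 0"
proof -
  let ?L = "mfun (l + 1/2)" and ?v = "\<lambda>n. real n * (real n + 2 * l)"
  have key: "?v n * ?L (gegen l n * g) = ?L (lsq * (pderiv (gegen l n) * pderiv g))" for n g
  proof -
    let ?C = "gegen l n"
    have "lsq * pderiv (pderiv ?C * g) = (smult (2 * l + 1) ([:0, 1:] * pderiv ?C) - smult (?v n) ?C) * g +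
        lsq * (pderiv ?C * pderiv g)"
      unfolding gegen_ode[symmetric] by (simp add: pderiv_mult algebra_simps)
    then have "?L (lsq * pderiv (pderiv ?C * g)) = (2 * l + 1) * ?L ([:0, 1:] * (pderiv ?C * g)) - ?v n * ?L (?C * g) +
        ?L (lsq * (pderiv ?C * pderiv g))"
      by (simp only: mfun_add mfun_diff mfun_smult left_diff_distrib mult_smult_left mult.assoc)
    then show ?thesis using mfun_lsq_pderiv[of "l + 1/2" "pderiv ?C * g"] l by (simp add: algebra_simps)
  qed
  have "?v m * ?L (gegen l m * gegen l n) = ?v n * ?L (gegen l m * gegen l n)"
    using key[of m "gegen l n"] key[of n "gegen l m"] by (simp add: mult.commute)
  moreover have "?v m \<noteq> ?v n"
  proof -
    have "?v m - ?v n = (real m - real n) * (real m + real n + 2 * l)" by (simp add: algebra_simps)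
    moreover have "real m + real n + 2 * l > 0" using l by simp
    ultimately show ?thesis using assms by auto
  qed
  ultimately show ?thesis by simp
qed

text \<open>The functional \<open>T\<close> of t times two consecutive polynomials is evaluated by
  the three-term recurrence in two ways. Orthogonality removes the third polynomial each time, which
  links the squares in degrees n and n + 1 just as the values at 1 are linked.\<close>

lemma mfun_gegen_square:
  assumes l: "l > 0"
  shows "(real n + l) / l * mfun (l + 1/2) (gegen l n * gegen l n) = poly (gegen l n) 1"
proof (induction n)
  case 0
  then show ?case using l by simp
next
  case (Suc n)
  let ?L = "mfun (l + 1/2)"
  define T where "T = ?L ([:0, 1:] * gegen l n * gegen l (Suc n))"
  have rec: "smult (real k + 2) (gegen l (Suc (Suc k))) =
      smult (2 * (real k + 1 + l)) ([:0, 1:] * gegen l (Suc k)) - smult (real k + 2 * l) (gegen l k)" for k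
    by (rule poly_eq_poly_eq_iff[THEN iffD1], rule ext) (simp only: poly_smult gegen_rec poly_diff poly_mult poly_pCons, simp)
  have 1: "(real n + 1) * ?L (gegen l (Suc n) * gegen l (Suc n)) = 2 * (real n + l) * T"
  proof (cases n)
    case 0
    have "[:0, 2 * l:] = smult (2 * l) [:0, 1:]" by simp
    then show ?thesis unfolding T_def 0 by (simp only: gegen.simps of_nat_0 mult_1_right mult_smult_left mfun_smult) simp
  next
    case (Suc k)
    have "(real n + 1) * ?L (gegen l (Suc n) * gegen l (Suc n)) =
        ?L (smult (real k + 2) (gegen l (Suc (Suc k))) * gegen l (Suc n))"
      by (simp only: mult_smult_left mfun_smult Suc) (simp add: add.commute)
    also have "\<dots> = 2 * (real k + 1 + l) * T - (real k + 2 * l) * ?L (gegen l k * gegen l (Suc n))"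
      unfolding rec T_def by (simp only: left_diff_distrib mult_smult_left mfun_smult mfun_diff Suc)
    finally show ?thesis using mfun_gegen_orthogonal[OF l, of k "Suc n"] by (simp add: Suc add_ac)
  qed
  have swap: "[:0, 1:] * gegen l (Suc n) * gegen l n = [:0, 1:] * gegen l n * gegen l (Suc n)"
    by (simp only: mult_ac)
  have "(real n + 2) * ?L (gegen l (Suc (Suc n)) * gegen l n) = ?L (smult (real n + 2) (gegen l (Suc (Suc n))) * gegen l n)"
    by (simp only: mult_smult_left mfun_smult)
  also have "\<dots> = 2 * (real n + 1 + l) * T - (real n + 2 * l) * ?L (gegen l n * gegen l n)"
    unfolding rec T_def swap[symmetric] by (simp only: left_diff_distrib mult_smult_left mfun_smult mfun_diff)
  finally have 2: "2 * (real n + 1 + l) * T = (real n + 2 * l) * ?L (gegen l n * gegen l n)"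
    using mfun_gegen_orthogonal[OF l, of "Suc (Suc n)" n] by simp
  define I J where "I = ?L (gegen l n * gegen l n)" and "J = ?L (gegen l (Suc n) * gegen l (Suc n))"
  have c: "(real n + 1) * poly (gegen l (Suc n)) 1 = (real n + 2 * l) * poly (gegen l n) 1"
    using gegen_deriv_relations[of n l 1] by simp
  have "(real n + 1) * ((real n + 1 + l) * J) = (real n + 1 + l) * (2 * (real n + l) * T)"
    using 1 unfolding J_def[symmetric] by (simp add: mult.left_commute)
  also have "\<dots> = (real n + l) * (2 * (real n + 1 + l) * T)" by (simp add: algebra_simps)
  also have "\<dots> = (real n + l) * ((real n + 2 * l) * I)"
    unfolding 2 I_def ..
  also have "\<dots> = l * ((real n + 2 * l) * ((real n + l) / l * I))" using l by simp
  also have "\<dots> = (real n + 1) * (l * poly (gegen l (Suc n)) 1)"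
    unfolding I_def Suc c[symmetric] by (simp add: mult_ac)
  finally have "(real n + 1 + l) * J = l * poly (gegen l (Suc n)) 1"
    by (subst (asm) mult_left_cancel) auto
  then show ?case using l unfolding J_def by (simp add: field_simps)
qed


text \<open>
  The reproducing kernel of the polynomials orthogonal with respect to \<open>mfun (l + 1/2)\<close>, with one
  argument fixed at \<open>1\<close>.
\<close>

definition zonal :: "real \<Rightarrow> nat \<Rightarrow> real poly" where
  "zonal l n = smult ((real n + l) / l) (gegen l n)"

lemma zonal_degree_le: "degree (zonal l n) \<le> n"
  unfolding zonal_def by (rule order.trans[OF degree_smult_le gegen_degree_le])

lemma zonal_at_1_pos: "l > 0 \<Longrightarrow> poly (zonal l n) 1 > 0"
  by (simp add: zonal_def gegen_at_1_pos add_nonneg_pos)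

lemma zonal_abs_le:
  assumes "l > 0" "\<bar>t\<bar> \<le> 1"
  shows "\<bar>poly (zonal l n) t\<bar> \<le> poly (zonal l n) 1"
proof -
  have "(real n + l) / l * \<bar>poly (gegen l n) t\<bar> \<le> (real n + l) / l * poly (gegen l n) 1"
    using assms by (intro mult_left_mono gegen_abs_le) auto
  then show ?thesis using assms(1) by (simp add: zonal_def abs_mult)
qed

lemma zonal_cos_ge:
  assumes l: "l > 0" and \<theta>: "0 \<le> \<theta>"
  shows "poly (zonal l n) (cos \<theta>) \<ge> poly (zonal l n) 1 * (1 - (real n + l) * \<theta>)"
proof -
  have "(real n + l) / l * (poly (gegen l n) 1 * (1 - (real n + l) * \<theta>)) \<le> (real n + l) / l * poly (gegen l n) (cos \<theta>)"
    using assms by (intro mult_left_mono gegen_cos_ge) auto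
  then show ?thesis by (simp add: zonal_def mult.assoc)
qed

lemma mfun_zonal_zonal:
  assumes l: "l > 0"
  shows "mfun (l + 1/2) (zonal l m * zonal l n) = (if m = n then poly (zonal l n) 1 else 0)"
proof (cases "m = n")
  case True
  show ?thesis
    unfolding True zonal_def mult_smult_left mult_smult_right mfun_smult mfun_gegen_square[OF l] by simp
next
  case False
  then show ?thesis using mfun_gegen_orthogonal[OF l, of m n] by (simp add: zonal_def mfun_smult)
qed

lemma poly_gegen_expansion:
  assumes l: "l > 0" and "degree p \<le> n"
  shows "\<exists>a. p = (\<Sum>m\<le>n. smult (a m) (zonal l m))"
  using assms(2)
proof (induction n arbitrary: p)
  case 0
  then obtain c where "p = [:c:]" by (auto simp: degree_eq_zeroE elim: degree_eq_zeroE)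
  then show ?case using l by (intro exI[of _ "\<lambda>_. c"]) (simp add: zonal_def)
next
  case (Suc n)
  define a where "a = coeff p (Suc n) / coeff (zonal l (Suc n)) (Suc n)"
  have pos: "coeff (zonal l (Suc n)) (Suc n) \<noteq> 0"
    using gegen_coeff_pos[OF l, of "Suc n"] l by (simp add: zonal_def)
  have "degree (p - smult a (zonal l (Suc n))) \<le> n"
  proof (rule degree_le, intro allI impI)
    fix i assume "n < i"
    show "coeff (p - smult a (zonal l (Suc n))) i = 0"
    proof (cases "i = Suc n")
      case True
      then show ?thesis using pos by (simp add: a_def)
    next
      case False
      then show ?thesis using Suc.prems zonal_degree_le[of l "Suc n"] \<open>n < i\<close> by (simp add: coeff_eq_0)
    qed
  qed
  from Suc.IH[OF this] obtain b where b: "p - smult a (zonal l (Suc n)) = (\<Sum>m\<le>n. smult (b m) (zonal l m))" ..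
  have "(\<Sum>m\<le>n. smult ((b(Suc n := a)) m) (zonal l m)) = (\<Sum>m\<le>n. smult (b m) (zonal l m))"
    by (intro sum.cong) auto
  with b have "p = (\<Sum>m\<le>Suc n. smult ((b(Suc n := a)) m) (zonal l m))"
    by (simp add: algebra_simps)
  then show ?case by (intro exI[of _ "b(Suc n := a)"])
qed

lemma mfun_zonal_lower:
  assumes l: "l > 0" and "degree p < n"
  shows "mfun (l + 1/2) (zonal l n * p) = 0"
proof -
  obtain a where a: "p = (\<Sum>m\<le>degree p. smult (a m) (zonal l m))"
    using poly_gegen_expansion[OF l order.refl] by blast
  have "mfun (l + 1/2) (zonal l n * p) = (\<Sum>m\<le>degree p. a m * mfun (l + 1/2) (zonal l n * zonal l m))"
    by (subst a) (simp only: sum_distrib_left mult_smult_right mfun_sum mfun_smult)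
  also have "\<dots> = 0"
    using assms(2) by (intro sum.neutral) (auto simp: mfun_zonal_zonal[OF l])
  finally show ?thesis .
qed

text \<open>The hypotheses kill every coefficient of \<open>p\<close> in the zonal basis except the
  one of degree \<open>n\<close>. They speak of orthogonality only, since the \<open>p\<close>
  supplied by \<open>trans_poly_reproducing\<close> is known through its integrals.\<close>

lemma mfun_zonal_reproducing:
  assumes l: "l > 0" and deg: "degree p \<le> n"
    and orth: "\<And>h. degree h < n \<Longrightarrow> mfun (l + 1/2) (h * p) = 0"
  shows "mfun (l + 1/2) (zonal l n * p) = poly p 1"
proof -
  obtain a where a: "p = (\<Sum>m\<le>n. smult (a m) (zonal l m))"
    using poly_gegen_expansion[OF l deg] by blast
  have zp: "mfun (l + 1/2) (zonal l k * p) = a k * poly (zonal l k) 1" if "k \<le> n" for k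
  proof -
    have "mfun (l + 1/2) (zonal l k * p) = (\<Sum>m\<le>n. a m * mfun (l + 1/2) (zonal l k * zonal l m))"
      by (subst a) (simp only: sum_distrib_left mult_smult_right mfun_sum mfun_smult)
    also have "\<dots> = (\<Sum>m\<le>n. if k = m then a k * poly (zonal l k) 1 else 0)"
      by (intro sum.cong) (auto simp: mfun_zonal_zonal[OF l])
    finally show ?thesis using that by simp
  qed
  have "a k = 0" if "k < n" for k
    using zp[of k] orth[of "zonal l k"] that zonal_degree_le[of l k] zonal_at_1_pos[OF l, of k] by simp
  then have "(\<Sum>m\<le>n. a m * poly (zonal l m) 1) = (\<Sum>m\<le>n. if m = n then a n * poly (zonal l n) 1 else 0)"
    by (intro sum.cong) auto
  moreover have "poly p 1 = (\<Sum>m\<le>n. a m * poly (zonal l m) 1)"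
    by (subst a) (simp add: poly_sum)
  ultimately show ?thesis using zp[of n] by simp
qed

section \<open>Growth of the zonal values at 1\<close>

lemma pos_LIMSEQ_bounds:
  fixes f :: "nat \<Rightarrow> real"
  assumes lim: "f \<longlonglongrightarrow> c" and "c > 0" and pos: "\<And>n. n \<ge> 1 \<Longrightarrow> f n > 0"
  obtains A B where "A > 0" "B > 0" "\<And>n. n \<ge> 1 \<Longrightarrow> A \<le> f n \<and> f n \<le> B"
proof -
  obtain B where B: "B > 0" "\<And>n. norm (f n) \<le> B"
    using convergent_imp_Bseq[of f] lim by (auto simp: convergent_def Bseq_def)
  have "(\<lambda>n. inverse (f n)) \<longlonglongrightarrow> inverse c" using lim \<open>c > 0\<close> by (intro tendsto_inverse) auto
  then obtain C where C: "C > 0" "\<And>n. norm (inverse (f n)) \<le> C"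
    using convergent_imp_Bseq[of "\<lambda>n. inverse (f n)"] by (auto simp: convergent_def Bseq_def)
  have "inverse C \<le> f n \<and> f n \<le> B" if "n \<ge> 1" for n
    using pos[OF that] B(2)[of n] C(2)[of n] le_imp_inverse_le[of "inverse (f n)" C] by simp
  then show thesis using that[of "inverse C" B] B C by simp
qed

text \<open>Divided by \<open>real n powr (2 * l)\<close>, the value is a rational factor times the
  series for 1 / Gamma; it is positive and has a positive limit, hence is bounded on both
  sides.\<close>

lemma zonal_at_1_growth:
  assumes l: "l > 0"
  obtains A B where "A > 0" "B > 0"
    "\<And>n. n \<ge> 1 \<Longrightarrow> A * real n powr (2 * l) \<le> poly (zonal l n) 1 \<and> poly (zonal l n) 1 \<le> B * real n powr (2 * l)"
proof -
  define f where "f n = (real n + l) / l / (2 * l + real n) * rGamma_series (2 * l) n" for n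
  have Z: "poly (zonal l n) 1 = f n * real n powr (2 * l)" if "n \<ge> 1" for n
  proof -
    have "rGamma_series (2 * l) n = pochhammer (2 * l) n * (2 * l + real n) / (fact n * real n powr (2 * l))"
      using that by (simp add: rGamma_series_def pochhammer_Suc powr_def)
    moreover have "2 * l + real n \<noteq> 0" "real n powr (2 * l) \<noteq> 0" using l that by auto
    ultimately show ?thesis by (simp add: zonal_def gegen_at_1 f_def)
  qed
  have pos: "f n > 0" if "n \<ge> 1" for n
  proof -
    have "f n * real n powr (2 * l) > 0" using zonal_at_1_pos[OF l, of n] Z[OF that] by simp
    then show ?thesis by (simp add: zero_less_mult_iff)
  qed
  have "(\<lambda>n. (real n + l) / l / (2 * l + real n)) \<longlonglongrightarrow> inverse l"
    using l by real_asymp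
  then have "f \<longlonglongrightarrow> inverse l * rGamma (2 * l)"
    unfolding f_def by (intro tendsto_mult rGamma_series_LIMSEQ)
  moreover have "inverse l * rGamma (2 * l) > 0"
    using l Gamma_real_pos[of "2 * l"] by (simp add: rGamma_inverse_Gamma)
  ultimately obtain A B where "A > 0" "B > 0" "\<And>n. n \<ge> 1 \<Longrightarrow> A \<le> f n \<and> f n \<le> B"
    using pos_LIMSEQ_bounds[of f] pos by blast
  then show thesis using that[of A B] by (simp add: Z)
qed

section \<open>Difference calculus\<close>

definition fdiff :: "(nat \<Rightarrow> real) \<Rightarrow> nat \<Rightarrow> real" where
  "fdiff F n = F (Suc n) - F n"

text \<open>
  Families of sequences that behave like \<open>N powr - s * f (n / N)\<close> with \<open>f\<close> smooth, in the range
  \<open>n \<ge> N / 4\<close>.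
\<close>

definition smooth_symbol :: "nat \<Rightarrow> (nat \<Rightarrow> nat \<Rightarrow> real) \<Rightarrow> bool" where
  "smooth_symbol s F \<longleftrightarrow> (\<forall>i. \<exists>C. \<forall>N\<ge>1. \<forall>n. N \<le> 4 * n \<longrightarrow> \<bar>(fdiff ^^ i) (F N) n\<bar> * real N ^ (s + i) \<le> C)"

lemma fdiff_add: "(fdiff ^^ i) (\<lambda>n. F n + G n) n = (fdiff ^^ i) F n + (fdiff ^^ i) G n"
  by (induction i arbitrary: n) (auto simp: fdiff_def)

lemma fdiff_cmult: "(fdiff ^^ i) (\<lambda>n. c * F n) n = c * (fdiff ^^ i) F n"
  by (induction i arbitrary: n) (auto simp: fdiff_def algebra_simps)

lemma fdiff_shift: "(fdiff ^^ i) (\<lambda>n. F (Suc n)) n = (fdiff ^^ i) F (Suc n)"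
  by (induction i arbitrary: n) (auto simp: fdiff_def)

lemma fdiff_Suc: "(fdiff ^^ Suc i) F = (fdiff ^^ i) (fdiff F)"
  by (simp add: funpow_swap1)

lemma fdiff_Suc_apply: "(fdiff ^^ Suc i) F n = (fdiff ^^ i) F (Suc n) - (fdiff ^^ i) F n"
  by (simp add: fdiff_def)

lemma smooth_symbolD:
  assumes "smooth_symbol s F"
  obtains C where "C \<ge> 0" "\<And>N n. N \<ge> 1 \<Longrightarrow> N \<le> 4 * n \<Longrightarrow> \<bar>(fdiff ^^ i) (F N) n\<bar> * real N ^ (s + i) \<le> C"
proof -
  obtain C where C: "\<And>N n. N \<ge> 1 \<Longrightarrow> N \<le> 4 * n \<Longrightarrow> \<bar>(fdiff ^^ i) (F N) n\<bar> * real N ^ (s + i) \<le> C"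
    using assms unfolding smooth_symbol_def by blast
  show thesis by (rule that[of "max C 0"]) (use C in \<open>auto simp: le_max_iff_disj\<close>)
qed

lemma smooth_symbol_fdiff: "smooth_symbol s F \<Longrightarrow> smooth_symbol (Suc s) (\<lambda>N. fdiff (F N))"
  unfolding smooth_symbol_def
proof (intro allI)
  fix i
  assume *: "\<forall>i. \<exists>C. \<forall>N\<ge>1. \<forall>n. N \<le> 4 * n \<longrightarrow> \<bar>(fdiff ^^ i) (F N) n\<bar> * real N ^ (s + i) \<le> C"
  show "\<exists>C. \<forall>N\<ge>1. \<forall>n. N \<le> 4 * n \<longrightarrow> \<bar>(fdiff ^^ i) (fdiff (F N)) n\<bar> * real N ^ (Suc s + i) \<le> C"
    using *[rule_format, of "Suc i"] unfolding fdiff_Suc by simp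
qed

lemma smooth_symbol_shift: "smooth_symbol s F \<Longrightarrow> smooth_symbol s (\<lambda>N n. F N (Suc n))"
  unfolding smooth_symbol_def fdiff_shift by (metis le_SucI mult_Suc_right trans_le_add2)

lemma smooth_symbol_cmult:
  assumes "smooth_symbol s F" shows "smooth_symbol s (\<lambda>N n. c * F N n)"
  unfolding smooth_symbol_def
proof (intro allI)
  fix i
  obtain C where C: "C \<ge> 0" "\<And>N n. N \<ge> 1 \<Longrightarrow> N \<le> 4 * n \<Longrightarrow> \<bar>(fdiff ^^ i) (F N) n\<bar> * real N ^ (s + i) \<le> C"
    using smooth_symbolD[OF assms] by metis
  show "\<exists>C. \<forall>N\<ge>1. \<forall>n. N \<le> 4 * n \<longrightarrow> \<bar>(fdiff ^^ i) (\<lambda>n. c * F N n) n\<bar> * real N ^ (s + i) \<le> C"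
    using C by (intro exI[of _ "\<bar>c\<bar> * C"]) (auto simp: fdiff_cmult abs_mult mult.assoc intro: mult_left_mono)
qed

lemma smooth_symbol_add:
  assumes "smooth_symbol s F" "smooth_symbol s G" shows "smooth_symbol s (\<lambda>N n. F N n + G N n)"
  unfolding smooth_symbol_def
proof (intro allI)
  fix i
  obtain C where C: "\<And>N n. N \<ge> 1 \<Longrightarrow> N \<le> 4 * n \<Longrightarrow> \<bar>(fdiff ^^ i) (F N) n\<bar> * real N ^ (s + i) \<le> C"
    using smooth_symbolD[OF assms(1)] by metis
  obtain C' where C': "\<And>N n. N \<ge> 1 \<Longrightarrow> N \<le> 4 * n \<Longrightarrow> \<bar>(fdiff ^^ i) (G N) n\<bar> * real N ^ (s + i) \<le> C'"
    using smooth_symbolD[OF assms(2)] by metis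
  have "\<bar>(fdiff ^^ i) (\<lambda>n. F N n + G N n) n\<bar> * real N ^ (s + i) \<le> C + C'" if "N \<ge> 1" "N \<le> 4 * n" for N n
  proof -
    have "\<bar>(fdiff ^^ i) (\<lambda>n. F N n + G N n) n\<bar> * real N ^ (s + i) \<le>
        (\<bar>(fdiff ^^ i) (F N) n\<bar> + \<bar>(fdiff ^^ i) (G N) n\<bar>) * real N ^ (s + i)"
      unfolding fdiff_add by (intro mult_right_mono abs_triangle_ineq) auto
    then show ?thesis using C[OF that] C'[OF that] by (simp add: algebra_simps)
  qed
  then show "\<exists>C. \<forall>N\<ge>1. \<forall>n. N \<le> 4 * n \<longrightarrow> \<bar>(fdiff ^^ i) (\<lambda>n. F N n + G N n) n\<bar> * real N ^ (s + i) \<le> C"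
    by blast
qed

text \<open>The discrete Leibniz rule shifts one of the factors, so the induction ranges over
  arbitrary pairs of families and uses closure under shifts.\<close>

lemma smooth_symbol_mult:
  assumes "smooth_symbol s F" "smooth_symbol s' G"
  shows "smooth_symbol (s + s') (\<lambda>N n. F N n * G N n)"
proof -
  have "\<exists>C. \<forall>N\<ge>1. \<forall>n. N \<le> 4 * n \<longrightarrow> \<bar>(fdiff ^^ i) (\<lambda>n. F N n * G N n) n\<bar> * real N ^ (s + s' + i) \<le> C" for i
    using assms
  proof (induction i arbitrary: s s' F G)
    case 0
    obtain C where C: "C \<ge> 0" "\<And>N n. N \<ge> 1 \<Longrightarrow> N \<le> 4 * n \<Longrightarrow> \<bar>(fdiff ^^ 0) (F N) n\<bar> * real N ^ (s + 0) \<le> C"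
      using smooth_symbolD[OF 0(1)] by metis
    obtain C' where C': "C' \<ge> 0" "\<And>N n. N \<ge> 1 \<Longrightarrow> N \<le> 4 * n \<Longrightarrow> \<bar>(fdiff ^^ 0) (G N) n\<bar> * real N ^ (s' + 0) \<le> C'"
      using smooth_symbolD[OF 0(2)] by metis
    have "\<bar>F N n * G N n\<bar> * real N ^ (s + s') \<le> C * C'" if "N \<ge> 1" "N \<le> 4 * n" for N n
    proof -
      have "\<bar>F N n * G N n\<bar> * real N ^ (s + s') = (\<bar>F N n\<bar> * real N ^ s) * (\<bar>G N n\<bar> * real N ^ s')"
        by (simp add: abs_mult power_add mult_ac)
      also have "\<dots> \<le> C * C'" using C(2)[OF that] C'(2)[OF that] C(1) by (intro mult_mono) auto
      finally show ?thesis .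
    qed
    then show ?case by auto
  next
    case (Suc i)
    have eq: "(fdiff ^^ Suc i) (\<lambda>n. F N n * G N n) n =
        (fdiff ^^ i) (\<lambda>n. fdiff (F N) n * G N n) n + (fdiff ^^ i) (\<lambda>n. F N (Suc n) * fdiff (G N) n) n" for N n
    proof -
      have "fdiff (\<lambda>n. F N n * G N n) = (\<lambda>n. fdiff (F N) n * G N n + F N (Suc n) * fdiff (G N) n)"
        by (auto simp: fdiff_def algebra_simps)
      then show ?thesis unfolding fdiff_Suc by (simp only: fdiff_add)
    qed
    obtain C where C: "\<forall>N\<ge>1. \<forall>n. N \<le> 4 * n \<longrightarrow>
        \<bar>(fdiff ^^ i) (\<lambda>n. fdiff (F N) n * G N n) n\<bar> * real N ^ (Suc s + s' + i) \<le> C"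
      using Suc.IH[OF smooth_symbol_fdiff[OF Suc.prems(1)] Suc.prems(2)] by blast
    obtain C' where C': "\<forall>N\<ge>1. \<forall>n. N \<le> 4 * n \<longrightarrow>
        \<bar>(fdiff ^^ i) (\<lambda>n. F N (Suc n) * fdiff (G N) n) n\<bar> * real N ^ (s + Suc s' + i) \<le> C'"
      using Suc.IH[OF smooth_symbol_shift[OF Suc.prems(1)] smooth_symbol_fdiff[OF Suc.prems(2)]] by blast
    have "\<bar>(fdiff ^^ Suc i) (\<lambda>n. F N n * G N n) n\<bar> * real N ^ (s + s' + Suc i) \<le> C + C'"
      if "N \<ge> 1" "N \<le> 4 * n" for N n
    proof -
      let ?a = "(fdiff ^^ i) (\<lambda>n. fdiff (F N) n * G N n) n" and ?b = "(fdiff ^^ i) (\<lambda>n. F N (Suc n) * fdiff (G N) n) n"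
      have "\<bar>?a + ?b\<bar> * real N ^ (s + s' + Suc i) \<le> (\<bar>?a\<bar> + \<bar>?b\<bar>) * real N ^ (s + s' + Suc i)"
        by (intro mult_right_mono abs_triangle_ineq) auto
      then show ?thesis using C[rule_format, OF that] C'[rule_format, OF that] unfolding eq by (simp add: algebra_simps)
    qed
    then show ?case by blast
  qed
  then show ?thesis unfolding smooth_symbol_def by blast
qed

lemma fdiff_inverse:
  assumes "\<beta> > 0"
  shows "(fdiff ^^ i) (\<lambda>n. 1 / (real n + \<beta>)) n = (-1) ^ i * fact i / pochhammer (real n + \<beta>) (Suc i)"
proof (induction i arbitrary: n)
  case 0
  show ?case by simp
next
  case (Suc i)
  define x where "x = real n + \<beta>"
  define P where "P = pochhammer (x + 1) i"
  have x: "x > 0" "x + 1 + real i > 0" and P: "P > 0"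
    using assms by (auto simp: x_def P_def intro!: pochhammer_pos)
  have p1: "pochhammer (x + 1) (Suc i) = P * (x + 1 + real i)" by (simp add: P_def pochhammer_Suc)
  have p2: "pochhammer x (Suc i) = x * P" by (simp add: P_def pochhammer_rec)
  have p3: "pochhammer x (Suc (Suc i)) = x * (P * (x + 1 + real i))" unfolding pochhammer_rec[of x] p1 ..
  have "(fdiff ^^ Suc i) (\<lambda>n. 1 / (real n + \<beta>)) n =
      (-1) ^ i * fact i / pochhammer (x + 1) (Suc i) - (-1) ^ i * fact i / pochhammer x (Suc i)"
    unfolding fdiff_Suc_apply Suc x_def by (simp add: add_ac)
  also have "\<dots> = (-1) ^ i * fact i * (1 / (P * (x + 1 + real i)) - 1 / (x * P))"
    unfolding p1 p2 by (simp add: right_diff_distrib)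
  also have "1 / (P * (x + 1 + real i)) - 1 / (x * P) = - (1 + real i) / (x * (P * (x + 1 + real i)))"
    using x P by (simp add: divide_simps)
  finally show ?case unfolding x_def[symmetric] p3 by (simp add: algebra_simps)
qed

text \<open>The iterated differences are explicit reciprocals of Pochhammer symbols. Here the
  restriction to \<open>N \<le> 4 * n\<close> matters: it bounds each factor of the symbol below by
  N / 4.\<close>

lemma smooth_symbol_inverse:
  assumes "\<beta> > 0"
  shows "smooth_symbol 1 (\<lambda>N n. 1 / (real n + \<beta>))"
  unfolding smooth_symbol_def
proof (intro allI exI impI)
  fix i N n :: nat
  assume N: "N \<ge> 1" "N \<le> 4 * n"
  have pow: "pochhammer x k \<ge> x ^ k" if "x \<ge> 0" for x :: real and k
  proof (induction k)
    case (Suc k)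
    have "x ^ Suc k = x ^ k * x" by simp
    also have "\<dots> \<le> pochhammer x k * (x + real k)"
      using that Suc by (intro mult_mono order.trans[OF zero_le_power[OF that] Suc]) auto
    finally show ?case by (simp add: pochhammer_Suc)
  qed simp
  have "(real N / 4) ^ (1 + i) \<le> (real n + \<beta>) ^ (1 + i)"
    using N assms by (intro power_mono) auto
  also have "\<dots> \<le> pochhammer (real n + \<beta>) (1 + i)" using assms by (intro pow) auto
  finally have le: "real N ^ (1 + i) \<le> 4 ^ (1 + i) * pochhammer (real n + \<beta>) (1 + i)"
    by (simp add: power_divide pos_divide_le_eq mult.commute)
  have pos: "pochhammer (real n + \<beta>) (1 + i) > 0" using assms by (intro pochhammer_pos) auto
  have "\<bar>(fdiff ^^ i) (\<lambda>n. 1 / (real n + \<beta>)) n\<bar> * real N ^ (1 + i) =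
      fact i * (real N ^ (1 + i) / pochhammer (real n + \<beta>) (1 + i))"
    unfolding fdiff_inverse[OF assms] using pos by (simp add: abs_mult)
  also have "\<dots> \<le> fact i * 4 ^ (1 + i)"
    using le pos by (intro mult_left_mono) (auto simp: pos_divide_le_eq mult.commute)
  finally show "\<bar>(fdiff ^^ i) (\<lambda>n. 1 / (real n + \<beta>)) n\<bar> * real N ^ (1 + i) \<le> fact i * 4 ^ (1 + i)" .
qed

text \<open>The increments \<open>D m (x + h) - D m x\<close> again form a family linked by
  differentiation, with bounds \<open>h * B (Suc m)\<close> by the mean value theorem. Differencing
  therefore passes to that family, and the induction applies to it.\<close>

lemma fdiff_smooth_bound:
  fixes D :: "nat \<Rightarrow> real \<Rightarrow> real"
  assumes der: "\<And>m t. t \<ge> 0 \<Longrightarrow> (D m has_real_derivative D (Suc m) t) (at t within {0..})"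
    and bound: "\<And>m t. t \<ge> 0 \<Longrightarrow> \<bar>D m t\<bar> \<le> B m" and "h > 0"
  shows "\<bar>(fdiff ^^ i) (\<lambda>n. D m (real n * h)) n\<bar> \<le> h ^ i * B (m + i)"
  using der bound
proof (induction i arbitrary: D B m)
  case 0
  then show ?case using \<open>h > 0\<close> by simp
next
  case (Suc i)
  define D' where "D' m x = D m (x + h) - D m x" for m x
  have interior: "(D m has_real_derivative D (Suc m) t) (at t)" if "t > 0" for m t
  proof -
    have "at t within {0..} = at t" using that by (intro at_within_interior) (simp add: interior_real_atLeast)
    then show ?thesis using Suc.prems(1)[of t m] that by simp
  qed
  have der': "(D' m has_real_derivative D' (Suc m) t) (at t within {0..})" if "t \<ge> 0" for m t
  proof -
    have "(D m has_real_derivative D (Suc m) (t + h)) (at (t + h))" using that \<open>h > 0\<close> by (intro interior) auto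
    then have "((\<lambda>x. D m (x + h)) has_real_derivative D (Suc m) (t + h)) (at t)" by (simp add: DERIV_shift)
    then have "((\<lambda>x. D m (x + h)) has_real_derivative D (Suc m) (t + h)) (at t within {0..})"
      by (rule has_field_derivative_at_within)
    then show ?thesis unfolding D'_def by (intro DERIV_diff Suc.prems(1) that)
  qed
  have bound': "\<bar>D' m t\<bar> \<le> h * B (Suc m)" if t: "t \<ge> 0" for m t
  proof -
    have "continuous_on {t..t + h} (D m)"
      unfolding continuous_on_eq_continuous_within
    proof
      fix x assume "x \<in> {t..t + h}"
      then have "continuous (at x within {0..}) (D m)" using Suc.prems(1)[of x m] t by (auto intro: DERIV_continuous)
      then show "continuous (at x within {t..t + h}) (D m)"
        by (rule continuous_within_subset) (use t in auto)
    qed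
    moreover have "D m differentiable (at x)" if "t < x" for x
      using interior[of x m] that t by (auto simp: real_differentiable_def)
    ultimately obtain l z where z: "t < z" "z < t + h" "DERIV (D m) z :> l" "D m (t + h) - D m t = (t + h - t) * l"
      using MVT[of t "t + h" "D m"] \<open>h > 0\<close> by auto
    have "l = D (Suc m) z" using interior[of z m] z t by (intro DERIV_unique[OF z(3)]) auto
    then have "D' m t = h * D (Suc m) z" using z(4) by (simp add: D'_def)
    then show ?thesis using Suc.prems(2)[of z "Suc m"] z t \<open>h > 0\<close> by (simp add: abs_mult mult_left_mono)
  qed
  have "fdiff (\<lambda>n. D m (real n * h)) = (\<lambda>n. D' m (real n * h))"
    by (auto simp: fdiff_def D'_def algebra_simps)
  then have "(fdiff ^^ Suc i) (\<lambda>n. D m (real n * h)) n = (fdiff ^^ i) (\<lambda>n. D' m (real n * h)) n"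
    unfolding fdiff_Suc by simp
  then show ?case using Suc.IH[of D' "\<lambda>m. h * B (Suc m)" m] der' bound' by (simp add: mult_ac)
qed

section \<open>Localization in one variable\<close>

text \<open>The action of the factor 1 - t on the coefficients of a zonal sum. At
  \<open>n = 0\<close> the spurious \<open>F (n - 1)\<close> carries the factor 0.\<close>

definition gegen_op :: "real \<Rightarrow> (nat \<Rightarrow> real) \<Rightarrow> nat \<Rightarrow> real" where
  "gegen_op l F n = F n - (real n * F (n - 1) + (real n + 2 * l) * F (Suc n)) / (2 * (real n + l))"

definition zonal_sum :: "real \<Rightarrow> nat \<Rightarrow> (nat \<Rightarrow> real) \<Rightarrow> real poly" where
  "zonal_sum l M F = (\<Sum>n\<le>M. smult (F n) (zonal l n))"

text \<open>The three-term recurrence rewrites t times each polynomial by its neighbours, and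
  reindexing moves the shifts onto the coefficients. The degree bound grows by one, as
  multiplication by t requires.\<close>

lemma zonal_sum_mult:
  assumes l: "l > 0" and F: "\<And>n. n > M \<Longrightarrow> F n = 0"
  shows "(1 - t) * poly (zonal_sum l M F) t = poly (zonal_sum l (Suc M) (gegen_op l F)) t"
proof -
  define c where "c n = poly (gegen l n) t" for n
  \<comment> \<open>At \<open>n = 0\<close> natural subtraction would yield \<open>c 0\<close> in
    place of the missing predecessor, so the value is set to 0.\<close>
  define u where "u n = (if n = 0 then 0 else (real n - 1 + 2 * l) * c (n - 1))" for n
  have rec: "2 * (real n + l) * t * c n = (real n + 1) * c (Suc n) + u n" for n
  proof (cases n)
    case 0
    then show ?thesis by (simp add: c_def u_def)
  next
    case (Suc k)
    then show ?thesis using gegen_rec[of k l t] by (simp add: c_def u_def algebra_simps)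
  qed
  have zs: "2 * l * poly (zonal_sum l K G) t = (\<Sum>n\<le>K. G n * (2 * (real n + l) * c n))" for K G
    unfolding zonal_sum_def zonal_def poly_sum poly_smult sum_distrib_left c_def
    using l by (intro sum.cong) auto
  have 1: "(\<Sum>n\<le>M. F n * ((real n + 1) * c (Suc n))) = (\<Sum>n\<le>Suc M. real n * F (n - 1) * c n)"
    by (subst sum.atMost_Suc_shift) (simp add: algebra_simps)
  have 2: "(\<Sum>n\<le>M. F n * u n) = (\<Sum>n\<le>Suc M. (real n + 2 * l) * F (Suc n) * c n)"
  proof -
    have "(\<Sum>n\<le>M. F n * u n) = (\<Sum>n\<le>Suc (Suc M). F n * u n)" using F by simp
    also have "\<dots> = (\<Sum>n\<le>Suc M. F (Suc n) * u (Suc n))" by (subst sum.atMost_Suc_shift) (simp add: u_def)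
    finally show ?thesis by (simp add: u_def algebra_simps)
  qed
  have 3: "(\<Sum>n\<le>M. F n * (2 * (real n + l) * c n)) = (\<Sum>n\<le>Suc M. 2 * (real n + l) * F n * c n)"
    using F by (simp add: mult_ac)
  have "2 * l * ((1 - t) * poly (zonal_sum l M F) t) = (1 - t) * (\<Sum>n\<le>M. F n * (2 * (real n + l) * c n))"
    unfolding zs[symmetric] by (simp only: mult_ac)
  also have "\<dots> = (\<Sum>n\<le>M. F n * (2 * (real n + l) * c n)) - (\<Sum>n\<le>M. F n * (2 * (real n + l) * t * c n))"
    by (simp only: left_diff_distrib mult_1_left sum_distrib_left) (simp only: mult_ac sum_subtractf)
  also have "\<dots> = (\<Sum>n\<le>Suc M. 2 * (real n + l) * F n * c n) -
      ((\<Sum>n\<le>Suc M. real n * F (n - 1) * c n) + (\<Sum>n\<le>Suc M. (real n + 2 * l) * F (Suc n) * c n))"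
    unfolding rec 1[symmetric] 2[symmetric] 3[symmetric] sum.distrib[symmetric] distrib_left[symmetric] ..
  also have "\<dots> = (\<Sum>n\<le>Suc M. (2 * (real n + l)) * gegen_op l F n * c n)"
    unfolding sum.distrib[symmetric] sum_subtractf[symmetric]
  proof (rule sum.cong, rule refl)
    fix n
    have "2 * (real n + l) \<noteq> 0" using l by auto
    then have "2 * (real n + l) * gegen_op l F n = 2 * (real n + l) * F n - (real n * F (n - 1) + (real n + 2 * l) * F (Suc n))"
      unfolding gegen_op_def right_diff_distrib by simp
    then show "2 * (real n + l) * F n * c n - (real n * F (n - 1) * c n + (real n + 2 * l) * F (Suc n) * c n) =
      2 * (real n + l) * gegen_op l F n * c n"
      by (simp only: left_diff_distrib distrib_right mult.assoc)
  qed
  also have "\<dots> = 2 * l * poly (zonal_sum l (Suc M) (gegen_op l F)) t"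
    unfolding zs by (intro sum.cong refl) (simp only: mult_ac)
  finally show ?thesis using l by simp
qed

lemma gegen_op_zero:
  assumes "\<And>n. n > M \<Longrightarrow> F n = 0" "n > Suc M" shows "gegen_op l F n = 0"
  using assms by (simp add: gegen_op_def)

lemma gegen_op_iter_zero:
  "(\<And>n. n > M \<Longrightarrow> F n = 0) \<Longrightarrow> n > M + k \<Longrightarrow> (gegen_op l ^^ k) F n = 0"
proof (induction k arbitrary: n)
  case (Suc k)
  then show ?case by (simp add: gegen_op_zero[of "M + k"])
qed simp

lemma zonal_sum_mult_power:
  assumes l: "l > 0" and F: "\<And>n. n > M \<Longrightarrow> F n = 0"
  shows "(1 - t) ^ k * poly (zonal_sum l M F) t = poly (zonal_sum l (M + k) ((gegen_op l ^^ k) F)) t"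
proof (induction k)
  case (Suc k)
  have "(1 - t) ^ Suc k * poly (zonal_sum l M F) t = (1 - t) * poly (zonal_sum l (M + k) ((gegen_op l ^^ k) F)) t"
    by (simp add: Suc[symmetric] mult_ac)
  also have "\<dots> = poly (zonal_sum l (Suc (M + k)) (gegen_op l ((gegen_op l ^^ k) F))) t"
    using gegen_op_iter_zero[where M = M and F = F and k = k and l = l] F by (intro zonal_sum_mult[OF l]) blast
  finally show ?case by simp
qed simp

text \<open>The subtracted quotient is a weighted mean of two values of \<open>F\<close>, because n
  + (n + 2 l) = 2 (n + l).\<close>

lemma gegen_op_abs_le:
  assumes l: "l > 0" and B: "\<And>n. \<bar>F n\<bar> \<le> B"
  shows "\<bar>gegen_op l F n\<bar> \<le> 2 * B"
proof -
  have p: "2 * (real n + l) > 0" using l by simp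
  have "\<bar>(real n * F (n - 1) + (real n + 2 * l) * F (Suc n)) / (2 * (real n + l))\<bar> \<le> B"
  proof -
    have "\<bar>real n * F (n - 1) + (real n + 2 * l) * F (Suc n)\<bar> \<le> real n * \<bar>F (n - 1)\<bar> + (real n + 2 * l) * \<bar>F (Suc n)\<bar>"
      using l by (intro order.trans[OF abs_triangle_ineq]) (simp add: abs_mult)
    also have "\<dots> \<le> real n * B + (real n + 2 * l) * B"
      using l by (intro add_mono mult_left_mono B) auto
    finally show ?thesis using p by (simp add: abs_divide pos_divide_le_eq algebra_simps)
  qed
  then show ?thesis
    unfolding gegen_op_def by (rule order.trans[OF abs_triangle_ineq4 order.trans[OF add_mono[OF B]]]) simp
qed

lemma gegen_op_iter_abs_le:
  assumes l: "l > 0" and B: "\<And>n. \<bar>F n\<bar> \<le> B"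
  shows "\<bar>(gegen_op l ^^ k) F n\<bar> \<le> 2 ^ k * B"
proof (induction k arbitrary: n)
  case (Suc k)
  have "\<bar>gegen_op l ((gegen_op l ^^ k) F) n\<bar> \<le> 2 * (2 ^ k * B)"
    by (rule gegen_op_abs_le[OF l]) (rule Suc)
  then show ?case by (simp only: funpow.simps o_apply power_Suc mult.assoc)
qed (simp add: B)

lemma gegen_op_iter_zero_low:
  assumes "\<And>n. real n < X \<Longrightarrow> F n = 0"
  shows "real n + real k < X \<Longrightarrow> (gegen_op l ^^ k) F n = 0"
proof (induction k arbitrary: n)
  case (Suc k)
  then show ?case by (simp add: gegen_op_def)
qed (simp add: assms)

text \<open>
  The \<open>k\<close>-th iterate is shifted by \<open>k\<close>, so that only forward differences occur. Each step contributes
  a second difference, or a first difference times \<open>1 / n\<close>: a factor \<open>N ^ - 2\<close> either way.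
\<close>

lemma smooth_symbol_gegen_op:
  assumes l: "l > 0" and F: "smooth_symbol 0 F"
  shows "smooth_symbol (2 * k) (\<lambda>N n. (gegen_op l ^^ k) (F N) (n + k))"
proof (induction k)
  case 0
  then show ?case using F by simp
next
  case (Suc k)
  define G where "G N n = (gegen_op l ^^ k) (F N) (n + k)" for N n
  define r where "r n = 1 / (real n + (real k + 1 + l))" for n
  \<comment> \<open>With x = n + k + 1 + l the two neighbours have weights x - l and x + l over 2 x:
    the symmetric part is a second difference, the antisymmetric part a first difference divided by
    x.\<close>
  have eq: "(gegen_op l ^^ Suc k) (F N) (n + Suc k) =
      (- 1/2) * fdiff (fdiff (G N)) n + (- l/2) * (r n * (fdiff (G N) n + fdiff (G N) (Suc n)))" for N n
  proof -
    define x where "x = real n + (real k + 1 + l)"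
    have x: "x > 0" using l by (simp add: x_def add_nonneg_pos)
    have "(gegen_op l ^^ Suc k) (F N) (n + Suc k) =
        G N (Suc n) - ((x - l) * G N n + (x + l) * G N (Suc (Suc n))) / (2 * x)"
      by (simp add: gegen_op_def G_def x_def algebra_simps)
    also have "\<dots> = (- 1/2) * fdiff (fdiff (G N)) n + (- l/2) * (1 / x * (fdiff (G N) n + fdiff (G N) (Suc n)))"
      using x by (simp add: fdiff_def field_simps)
    finally show ?thesis by (simp add: r_def x_def)
  qed
  have sG: "smooth_symbol (2 * k) G" using Suc unfolding G_def .
  have "smooth_symbol (1 + Suc (2 * k)) (\<lambda>N n. r n * (fdiff (G N) n + fdiff (G N) (Suc n)))"
    unfolding r_def using l
    by (intro smooth_symbol_mult smooth_symbol_inverse smooth_symbol_add smooth_symbol_fdiff smooth_symbol_shift sG) auto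
  moreover have "smooth_symbol (Suc (Suc (2 * k))) (\<lambda>N. fdiff (fdiff (G N)))"
    by (intro smooth_symbol_fdiff sG)
  ultimately have "smooth_symbol (2 * Suc k) (\<lambda>N n. (- 1/2) * fdiff (fdiff (G N)) n +
      (- l/2) * (r n * (fdiff (G N) n + fdiff (G N) (Suc n))))"
    by (intro smooth_symbol_add smooth_symbol_cmult) simp_all
  then show ?case unfolding eq .
qed

text \<open>Each derivative vanishes beyond 2, where the cutoff is locally 0, and is continuous on
  \<open>{0..2}\<close>; this yields global bounds.\<close>

lemma admissible_cutoffD:
  assumes "admissible_cutoff a"
  shows "\<And>t. 0 \<le> t \<Longrightarrow> t < 1/2 \<Longrightarrow> a t = 0" "\<And>t. t > 2 \<Longrightarrow> a t = 0"
    and "\<exists>D B. (\<forall>t\<ge>0. D 0 t = a t) \<and>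
      (\<forall>n. \<forall>t\<ge>0. (D n has_real_derivative D (Suc n) t) (at t within {0..})) \<and> (\<forall>n. \<forall>t\<ge>0. \<bar>D n t\<bar> \<le> B n)"
proof -
  have supp: "t \<in> {1/2..2}" if "t \<ge> 0" "a t \<noteq> 0" for t
    using assms that closure_subset[of "{t. t \<ge> 0 \<and> a t \<noteq> 0}"] unfolding admissible_cutoff_def by blast
  then show "\<And>t. 0 \<le> t \<Longrightarrow> t < 1/2 \<Longrightarrow> a t = 0" by force
  have "a t = 0" if "t > 2" for t using supp[of t] that by force
  then show van: "\<And>t. t > 2 \<Longrightarrow> a t = 0" .
  obtain D where D: "\<And>t. t \<ge> 0 \<Longrightarrow> D 0 t = a t"
      "\<And>n t. t \<ge> 0 \<Longrightarrow> (D n has_real_derivative D (Suc n) t) (at t within {0..})"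
    using assms unfolding admissible_cutoff_def smooth_on_halfline_def by blast
  have D0: "D n t = 0" if "t > 2" for n t
    using that
  proof (induction n arbitrary: t)
    case 0
    then show ?case using D(1)[of t] van by simp
  next
    case (Suc n)
    have "(D n has_real_derivative D (Suc n) t) (at t)"
      using D(2)[of t n] Suc.prems at_within_interior[of t "{0..}"] by (simp add: interior_real_atLeast)
    moreover have "(D n has_real_derivative 0) (at t)"
    proof (rule has_field_derivative_transform_within_open[where f = "\<lambda>_. 0" and S = "{2<..}"])
      show "((\<lambda>_. 0) has_real_derivative 0) (at t)" by simp
    qed (use Suc in auto)
    ultimately show ?case by (rule DERIV_unique)
  qed
  have "\<exists>b. \<forall>t\<ge>0. \<bar>D n t\<bar> \<le> b" for n
  proof -
    have "continuous_on {0..2} (D n)"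
      unfolding continuous_on_eq_continuous_within
    proof
      fix x :: real assume "x \<in> {0..2}"
      then have "continuous (at x within {0..}) (D n)" using D(2)[of x n] by (auto intro: DERIV_continuous)
      then show "continuous (at x within {0..2}) (D n)" by (rule continuous_within_subset) auto
    qed
    then have "bounded (D n ` {0..2})" by (intro compact_imp_bounded compact_continuous_image) auto
    then obtain b where b: "\<And>t. t \<in> {0..2} \<Longrightarrow> \<bar>D n t\<bar> \<le> b"
      unfolding bounded_iff by (force simp del: atLeastAtMost_iff)
    have "\<bar>D n t\<bar> \<le> max b 0" if "t \<ge> 0" for t
      using b[of t] D0[of t n] that by (cases "t \<le> 2") (auto simp: le_max_iff_disj)
    then show ?thesis by blast
  qed
  then obtain B where "\<And>n t. t \<ge> 0 \<Longrightarrow> \<bar>D n t\<bar> \<le> B n" by metis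
  then show "\<exists>D B. (\<forall>t\<ge>0. D 0 t = a t) \<and>
      (\<forall>n. \<forall>t\<ge>0. (D n has_real_derivative D (Suc n) t) (at t within {0..})) \<and> (\<forall>n. \<forall>t\<ge>0. \<bar>D n t\<bar> \<le> B n)"
    using D by blast
qed

lemma smooth_symbol_cutoff:
  assumes "admissible_cutoff a"
  shows "smooth_symbol 0 (\<lambda>N n. a (real n / real N))"
  unfolding smooth_symbol_def
proof (intro allI)
  fix i
  obtain D B where D: "\<And>t. t \<ge> 0 \<Longrightarrow> D 0 t = a t"
      "\<And>n t. t \<ge> 0 \<Longrightarrow> (D n has_real_derivative D (Suc n) t) (at t within {0..})"
      "\<And>n t. t \<ge> 0 \<Longrightarrow> \<bar>D n t\<bar> \<le> B n"
    using admissible_cutoffD(3)[OF assms] by auto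
  have "\<bar>(fdiff ^^ i) (\<lambda>n. a (real n / real N)) n\<bar> * real N ^ i \<le> B i" if "N \<ge> 1" for N n
  proof -
    have "\<bar>(fdiff ^^ i) (\<lambda>n. D 0 (real n * (1 / real N))) n\<bar> \<le> (1 / real N) ^ i * B (0 + i)"
      using that by (intro fdiff_smooth_bound D) auto
    then show ?thesis using that by (simp add: D(1) power_divide pos_le_divide_eq)
  qed
  then show "\<exists>C. \<forall>N\<ge>1. \<forall>n. N \<le> 4 * n \<longrightarrow> \<bar>(fdiff ^^ i) (\<lambda>n. a (real n / real N)) n\<bar> * real N ^ (0 + i) \<le> C"
    by auto
qed

text \<open>The symbol estimate covers indices with n - k at least N / 4. Below them the iterate is
  exactly 0, since the cutoff vanishes for n below N / 2 and \<open>k\<close> steps look only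
  \<open>k\<close> indices further. Small \<open>N\<close> is handled by the crude bound 2^k
  B.\<close>

lemma gegen_op_cutoff_bound:
  assumes l: "l > 0" and a: "admissible_cutoff a"
  shows "\<exists>C\<ge>0. \<forall>N\<ge>1. \<forall>n. \<bar>(gegen_op l ^^ k) (\<lambda>n. a (real n / real N)) n\<bar> * real N ^ (2 * k) \<le> C"
proof -
  define F where "F N n = a (real n / real N)" for N n :: nat
  obtain B where B: "\<And>t. t \<ge> 0 \<Longrightarrow> \<bar>a t\<bar> \<le> B" using admissible_cutoffD(3)[OF a] by metis
  have B0: "B \<ge> 0" using B[of 0] by simp
  have sym: "smooth_symbol (2 * k) (\<lambda>N n. (gegen_op l ^^ k) (F N) (n + k))"
    by (rule smooth_symbol_gegen_op[OF l]) (use smooth_symbol_cutoff[OF a] in \<open>simp add: F_def[abs_def]\<close>)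
  obtain C where C: "C \<ge> 0" "\<And>N n. N \<ge> 1 \<Longrightarrow> N \<le> 4 * n \<Longrightarrow>
      \<bar>(fdiff ^^ 0) (\<lambda>n. (gegen_op l ^^ k) (F N) (n + k)) n\<bar> * real N ^ (2 * k + 0) \<le> C"
    by (rule smooth_symbolD[OF sym, of 0]) blast
  define C' where "C' = max C (2 ^ k * B * real (8 * k) ^ (2 * k))"
  have "\<bar>(gegen_op l ^^ k) (F N) n\<bar> * real N ^ (2 * k) \<le> C'" if N: "N \<ge> 1" for N n
  proof -
    \<comment> \<open>The threshold ensures that n < k + N / 4 implies n + k < N / 2.\<close>
    consider "N < 8 * k" | "N \<ge> 8 * k" "n \<ge> k" "N \<le> 4 * (n - k)" | "N \<ge> 8 * k" "4 * n < 4 * k + N" by linarith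
    then show ?thesis
    proof cases
      case 1
      have "\<bar>(gegen_op l ^^ k) (F N) n\<bar> * real N ^ (2 * k) \<le> (2 ^ k * B) * real (8 * k) ^ (2 * k)"
        using 1 B0 by (intro mult_mono gegen_op_iter_abs_le[OF l] power_mono) (auto simp: F_def intro!: B)
      then show ?thesis by (simp add: C'_def)
    next
      case 2
      then show ?thesis using C(2)[of N "n - k"] N by (simp add: C'_def)
    next
      case 3
      have "F N m = 0" if "real m < real N / 2" for m
        unfolding F_def using that N by (intro admissible_cutoffD(1)[OF a]) (auto simp: field_simps)
      moreover have "real n + real k < real N / 2" using 3 by linarith
      ultimately have "(gegen_op l ^^ k) (F N) n = 0" by (rule gegen_op_iter_zero_low)
      then show ?thesis using C(1) by (simp add: C'_def)
    qed
  qed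
  moreover have "C' \<ge> 0" using C(1) by (simp add: C'_def)
  ultimately show ?thesis unfolding F_def by blast
qed

text \<open>The number of terms times a common bound \<open>Q\<close>. The extra \<open>k\<close>
  degrees created by iterating \<open>gegen_op\<close> affect only the constant, since 2 N + k \<le>
  (k + 2) N.\<close>

lemma zonal_at_1_sum_le:
  assumes l: "l > 0"
  shows "\<exists>C>0. \<forall>N\<ge>1. (\<Sum>n\<le>2 * N + k. poly (zonal l n) 1) \<le> C * real N powr (2 * l + 1)"
proof -
  obtain A B where AB: "A > 0" "B > 0"
    "\<And>n. n \<ge> 1 \<Longrightarrow> A * real n powr (2 * l) \<le> poly (zonal l n) 1 \<and> poly (zonal l n) 1 \<le> B * real n powr (2 * l)"
    using zonal_at_1_growth[OF l] by blast
  define C where "C = (real k + 3) * (max 1 B * (real k + 2) powr (2 * l))"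
  have "(\<Sum>n\<le>2 * N + k. poly (zonal l n) 1) \<le> C * real N powr (2 * l + 1)" if N: "N \<ge> 1" for N
  proof -
    define Q where "Q = max 1 B * ((real k + 2) * real N) powr (2 * l)"
    have "poly (zonal l n) 1 \<le> Q" if "n \<le> 2 * N + k" for n
    proof (cases "n = 0")
      case True
      have "1 \<le> (real k + 2) * real N" using N by (auto intro: mult_ge1_I)
      then have "1 * 1 \<le> Q" unfolding Q_def using l by (intro mult_mono ge_one_powr_ge_zero) auto
      then show ?thesis using True l by (simp add: zonal_def)
    next
      case False
      have "k \<le> k * N" using N by simp
      then have "n \<le> k * N + 2 * N" using that by linarith
      then have "n \<le> (k + 2) * N" by (simp only: distrib_right)
      then have "real n \<le> real ((k + 2) * N)" by (simp only: of_nat_le_iff)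
      then have "real n powr (2 * l) \<le> ((real k + 2) * real N) powr (2 * l)"
        using l by (intro powr_mono2) (auto simp: distrib_right)
      then have "B * real n powr (2 * l) \<le> Q" unfolding Q_def using AB by (intro mult_mono) auto
      then show ?thesis using AB(3)[of n] False by simp
    qed
    then have "(\<Sum>n\<le>2 * N + k. poly (zonal l n) 1) \<le> (\<Sum>n\<le>2 * N + k. Q)" by (intro sum_mono) auto
    also have "\<dots> = (2 * real N + real k + 1) * Q" by simp
    also have "\<dots> \<le> ((real k + 3) * real N) * Q"
    proof (intro mult_right_mono)
      have "real k * 1 \<le> real k * real N" using N by (intro mult_left_mono) auto
      then show "2 * real N + real k + 1 \<le> (real k + 3) * real N" using N by (simp add: algebra_simps)
    qed (use AB in \<open>auto simp: Q_def\<close>)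
    also have "\<dots> = C * real N powr (2 * l + 1)"
      using N by (simp add: Q_def C_def powr_mult powr_add)
    finally show ?thesis .
  qed
  moreover have "C > 0" by (simp add: C_def add_nonneg_pos)
  ultimately show ?thesis by blast
qed

lemma zonal_sum_abs_le:
  assumes l: "l > 0" and t: "\<bar>t\<bar> \<le> 1" and F: "\<And>n. \<bar>F n\<bar> \<le> B"
  shows "\<bar>poly (zonal_sum l M F) t\<bar> \<le> B * (\<Sum>n\<le>M. poly (zonal l n) 1)"
proof -
  have "\<bar>poly (zonal_sum l M F) t\<bar> \<le> (\<Sum>n\<le>M. \<bar>F n * poly (zonal l n) t\<bar>)"
    unfolding zonal_sum_def poly_sum poly_smult by (rule sum_abs)
  also have "\<dots> \<le> (\<Sum>n\<le>M. B * poly (zonal l n) 1)"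
    unfolding abs_mult by (intro sum_mono mult_mono F zonal_abs_le l t) (use F[of 0] in auto)
  finally show ?thesis by (simp add: sum_distrib_left)
qed

text \<open>Multiplying by \<open>(1 - t) ^ k\<close> costs only small coefficients, which gives the
  bound with \<open>((real N)\<^sup>2 * (1 - t)) ^ k\<close>. Exponents 0 and \<open>k\<close> then
  combine through (1 + y)^k \<le> 2^k (1 + y^k).\<close>

lemma zonal_sum_localized:
  assumes l: "l > 0" and a: "admissible_cutoff a"
  shows "\<exists>C>0. \<forall>N\<ge>1. \<forall>t. \<bar>t\<bar> \<le> 1 \<longrightarrow>
    \<bar>poly (zonal_sum l (2 * N) (\<lambda>n. a (real n / real N))) t\<bar> * (1 + (real N)\<^sup>2 * (1 - t)) ^ k \<le> C * real N powr (2 * l + 1)"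
proof -
  have bound: "\<exists>C\<ge>0. \<forall>N\<ge>1. \<forall>t. \<bar>t\<bar> \<le> 1 \<longrightarrow>
    \<bar>poly (zonal_sum l (2 * N) (\<lambda>n. a (real n / real N))) t\<bar> * ((real N)\<^sup>2 * (1 - t)) ^ k \<le> C * real N powr (2 * l + 1)" for k
  proof -
    obtain C1 where C1: "C1 \<ge> 0" "\<And>N n. N \<ge> 1 \<Longrightarrow> \<bar>(gegen_op l ^^ k) (\<lambda>n. a (real n / real N)) n\<bar> * real N ^ (2 * k) \<le> C1"
      using gegen_op_cutoff_bound[OF l a, of k] by blast
    obtain C2 where C2: "C2 > 0" "\<And>N. N \<ge> 1 \<Longrightarrow> (\<Sum>n\<le>2 * N + k. poly (zonal l n) 1) \<le> C2 * real N powr (2 * l + 1)"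
      using zonal_at_1_sum_le[OF l, of k] by blast
    have "\<bar>poly (zonal_sum l (2 * N) (\<lambda>n. a (real n / real N))) t\<bar> * ((real N)\<^sup>2 * (1 - t)) ^ k \<le>
        (C1 * C2) * real N powr (2 * l + 1)" if N: "N \<ge> 1" and t: "\<bar>t\<bar> \<le> 1" for N t
    proof -
      define F where "F n = a (real n / real N)" for n
      have F0: "F n = 0" if "n > 2 * N" for n
        unfolding F_def using that N by (intro admissible_cutoffD(2)[OF a]) (simp add: field_simps)
      have p: "real N ^ (2 * k) > 0" using N by simp
      have "\<bar>poly (zonal_sum l (2 * N) F) t\<bar> * ((real N)\<^sup>2 * (1 - t)) ^ k =
          real N ^ (2 * k) * \<bar>(1 - t) ^ k * poly (zonal_sum l (2 * N) F) t\<bar>"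
        unfolding power_mult[of _ 2] using t by (simp add: power_mult_distrib abs_mult mult_ac)
      also have "(1 - t) ^ k * poly (zonal_sum l (2 * N) F) t = poly (zonal_sum l (2 * N + k) ((gegen_op l ^^ k) F)) t"
        by (rule zonal_sum_mult_power[OF l F0])
      also have "real N ^ (2 * k) * \<bar>\<dots>\<bar> \<le> real N ^ (2 * k) * (C1 / real N ^ (2 * k) * (\<Sum>n\<le>2 * N + k. poly (zonal l n) 1))"
        using C1(2)[OF N] p unfolding F_def
        by (intro mult_left_mono zonal_sum_abs_le l t) (auto simp: pos_le_divide_eq)
      also have "\<dots> = C1 * (\<Sum>n\<le>2 * N + k. poly (zonal l n) 1)" using p by simp
      also have "\<dots> \<le> C1 * (C2 * real N powr (2 * l + 1))" using C1(1) C2(2)[OF N] by (intro mult_left_mono)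
      finally show ?thesis unfolding F_def by (simp add: mult.assoc)
    qed
    then show ?thesis using C1(1) C2(1) by (intro exI[of _ "C1 * C2"]) auto
  qed
  obtain C0 where C0: "C0 \<ge> 0" "\<And>N t. N \<ge> 1 \<Longrightarrow> \<bar>t\<bar> \<le> 1 \<Longrightarrow>
    \<bar>poly (zonal_sum l (2 * N) (\<lambda>n. a (real n / real N))) t\<bar> * ((real N)\<^sup>2 * (1 - t)) ^ 0 \<le> C0 * real N powr (2 * l + 1)"
    using bound[of 0] by blast
  obtain Ck where Ck: "Ck \<ge> 0" "\<And>N t. N \<ge> 1 \<Longrightarrow> \<bar>t\<bar> \<le> 1 \<Longrightarrow>
    \<bar>poly (zonal_sum l (2 * N) (\<lambda>n. a (real n / real N))) t\<bar> * ((real N)\<^sup>2 * (1 - t)) ^ k \<le> Ck * real N powr (2 * l + 1)"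
    using bound[of k] by blast
  have "\<bar>poly (zonal_sum l (2 * N) (\<lambda>n. a (real n / real N))) t\<bar> * (1 + (real N)\<^sup>2 * (1 - t)) ^ k
      \<le> (2 ^ k * (C0 + Ck) + 1) * real N powr (2 * l + 1)" if N: "N \<ge> 1" and t: "\<bar>t\<bar> \<le> 1" for N t
  proof -
    define p y where "p = \<bar>poly (zonal_sum l (2 * N) (\<lambda>n. a (real n / real N))) t\<bar>" and "y = (real N)\<^sup>2 * (1 - t)"
    have y: "y \<ge> 0" using t by (simp add: y_def)
    have "(1 + y) ^ k \<le> 2 ^ k * (1 + y ^ k)"
    proof (cases "y \<le> 1")
      case True
      then have "(1 + y) ^ k \<le> 2 ^ k" using y by (intro power_mono) auto
      also have "\<dots> \<le> 2 ^ k * (1 + y ^ k)" using y by simp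
      finally show ?thesis .
    next
      case False
      then have "(1 + y) ^ k \<le> (2 * y) ^ k" by (intro power_mono) auto
      also have "\<dots> \<le> 2 ^ k * (1 + y ^ k)" by (simp add: power_mult_distrib)
      finally show ?thesis .
    qed
    then have "p * (1 + y) ^ k \<le> p * (2 ^ k * (1 + y ^ k))" by (intro mult_left_mono) (simp_all add: p_def)
    also have "\<dots> = 2 ^ k * (p * y ^ 0 + p * y ^ k)" by (simp add: algebra_simps)
    also have "\<dots> \<le> 2 ^ k * (C0 * real N powr (2 * l + 1) + Ck * real N powr (2 * l + 1))"
      using C0(2)[OF N t] Ck(2)[OF N t] unfolding p_def y_def by (intro mult_left_mono add_mono) auto
    also have "\<dots> \<le> (2 ^ k * (C0 + Ck) + 1) * real N powr (2 * l + 1)" by (simp add: algebra_simps)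
    finally show ?thesis by (simp add: p_def y_def)
  qed
  moreover have "2 ^ k * (C0 + Ck) + 1 > 0" using C0 Ck by (simp add: add_nonneg_pos)
  ultimately show ?thesis by blast
qed

section \<open>Bounds for the moment functional\<close>

lemma mfun_0_eq: "mfun 0 p = (poly p 1 + poly p (-1)) / 2"
proof -
  have "pochhammer (1/2 :: real) k > 0" for k by (rule pochhammer_pos) simp
  then have mom: "mom 0 m = (1 ^ m + (-1) ^ m) / 2" for m
    by (cases "even m") (auto simp: mom_def less_imp_neq[THEN not_sym])
  have "mfun 0 p = ((\<Sum>i\<le>degree p. coeff p i * 1 ^ i) + (\<Sum>i\<le>degree p. coeff p i * (-1) ^ i)) / 2"
    unfolding mfun_def mom sum.distrib[symmetric] sum_divide_distrib by (simp add: distrib_left)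
  then show ?thesis by (simp only: poly_altdef)
qed

lemma hom_poly_monomial: "hom_poly m (\<lambda>u :: real. u ^ m)"
  using hom_poly_power[OF hom_poly_linear[OF bounded_linear_ident], of m] by simp

text \<open>For positive \<mu> the moment functional is a normalised integral with density
  \<open>(1 - u ^ 2) powr (\<mu> - 1)\<close>, which opens it to pointwise estimates.\<close>

lemma ball_int_poly:
  assumes \<mu>: "\<mu> > 0"
  shows "ball_integrable (\<mu> - 1) (poly p)"
    and "ball_int (\<mu> - 1) (poly p) = ball_int (\<mu> - 1) (\<lambda>_ :: real. 1) * mfun \<mu> p"
proof -
  have s: "\<mu> - 1 > -1" using \<mu> by simp
  have int: "ball_integrable (\<mu> - 1) (\<lambda>u. coeff p i * u ^ i)" for i
    by (intro ball_integrable_cmult hom_ball_integrable[OF hom_poly_monomial s])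
  have poly: "poly p = (\<lambda>u. \<Sum>i\<le>degree p. coeff p i * u ^ i)" by (simp add: poly_altdef fun_eq_iff)
  show "ball_integrable (\<mu> - 1) (poly p)" unfolding poly by (intro ball_integrable_sum int)
  have mono: "ball_int (\<mu> - 1) (\<lambda>u :: real. u ^ m) = ball_int (\<mu> - 1) (\<lambda>_ :: real. 1) * mom \<mu> m" for m
  proof -
    have G: "Gamma \<mu> * gauss_int (\<lambda>u :: real. u ^ m) = Gamma (\<mu> + (real m + 1) / 2) * ball_int (\<mu> - 1) (\<lambda>u :: real. u ^ m)" for m
      using hom_ball_gauss[OF hom_poly_monomial s, of m] by simp
    show ?thesis
    proof (cases "even m")
      case False
      then show ?thesis using ball_int_odd[OF hom_poly_monomial, of m] by simp
    next
      case True
      then obtain k where m: "m = 2 * k" by (elim evenE)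
      have pos: "Gamma (\<mu> + 1/2) > 0" "pochhammer (\<mu> + 1/2) k > 0" using \<mu> by (auto intro!: Gamma_real_pos pochhammer_pos)
      have "\<mu> + 1/2 \<notin> \<int>\<^sub>\<le>\<^sub>0" using \<mu> by (auto elim!: nonpos_Ints_cases)
      then have poch: "Gamma (\<mu> + 1/2 + k) = pochhammer (\<mu> + 1/2) k * Gamma (\<mu> + 1/2)"
        using pos by (simp add: pochhammer_Gamma)
      have e: "\<mu> + (real m + 1) / 2 = \<mu> + 1/2 + k" by (simp add: m add_divide_distrib)
      have 1: "pochhammer (\<mu> + 1/2) k * (Gamma (\<mu> + 1/2) * ball_int (\<mu> - 1) (\<lambda>u :: real. u ^ m)) =
          Gamma \<mu> * sqrt pi * pochhammer (1/2) k"
        using G[of m] unfolding e poch gauss_int_power by (simp add: m mult_ac)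
      have 2: "Gamma (\<mu> + 1/2) * ball_int (\<mu> - 1) (\<lambda>_ :: real. 1) = Gamma \<mu> * sqrt pi"
        using G[of 0] gauss_int_power[of 0] by simp
      have "pochhammer (\<mu> + 1/2) k * Gamma (\<mu> + 1/2) * ball_int (\<mu> - 1) (\<lambda>u :: real. u ^ m) =
          pochhammer (\<mu> + 1/2) k * Gamma (\<mu> + 1/2) * (ball_int (\<mu> - 1) (\<lambda>_ :: real. 1) * mom \<mu> m)"
      proof -
        have 3: "pochhammer (\<mu> + 1/2) k * mom \<mu> m = pochhammer (1/2) k" using pos by (simp add: mom_def m)
        have "pochhammer (\<mu> + 1/2) k * Gamma (\<mu> + 1/2) * (ball_int (\<mu> - 1) (\<lambda>_ :: real. 1) * mom \<mu> m) =
            Gamma (\<mu> + 1/2) * ball_int (\<mu> - 1) (\<lambda>_ :: real. 1) * (pochhammer (\<mu> + 1/2) k * mom \<mu> m)"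
          by (simp only: mult_ac)
        then show ?thesis unfolding 2 3 1[symmetric] by (simp only: mult.assoc)
      qed
      then show ?thesis using pos by simp
    qed
  qed
  show "ball_int (\<mu> - 1) (poly p) = ball_int (\<mu> - 1) (\<lambda>_ :: real. 1) * mfun \<mu> p"
    unfolding poly mfun_def by (subst ball_int_sum) (auto intro: int simp: ball_int_cmult mono sum_distrib_left mult_ac)
qed

text \<open>The exponent -(\<mu> + 1) is the one that makes the integrand elementary: with v = 1 -
  u, it is the derivative in v of
  \<open>v powr \<mu> * (1 + z * v) powr (- \<mu>) / \<mu>\<close>.\<close>

lemma integral_powr_end:
  assumes \<mu>: "\<mu> > 0" and \<delta>: "0 < \<delta>" and z: "z \<ge> 0"
  defines "g \<equiv> (\<lambda>u :: real. (1 - u) powr (\<mu> - 1) * (1 + z * (1 - u)) powr (- (\<mu> + 1)))"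
  shows "integrable lborel (\<lambda>u. indicator {1 - \<delta>..1} u * g u)"
    and "(LINT u|lborel. indicator {1 - \<delta>..1} u * g u) = \<delta> powr \<mu> * (1 + z * \<delta>) powr (- \<mu>) / \<mu>"
proof -
  define F where "F u = - ((1 - u) powr \<mu> * (1 + z * (1 - u)) powr (- \<mu>) / \<mu>)" for u
  have "(g has_integral (F 1 - F (1 - \<delta>))) {1 - \<delta>..1}"
  proof (rule fundamental_theorem_of_calculus_interior)
    have "1 + z * (1 - u) \<noteq> 0" if "u \<in> {1 - \<delta>..1}" for u
    proof -
      have "z * (1 - u) \<ge> 0" using that z by (intro mult_nonneg_nonneg) auto
      then show ?thesis by linarith
    qed
    then show "continuous_on {1 - \<delta>..1} F"
      unfolding F_def using \<mu> z by (intro continuous_intros continuous_on_powr') auto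
    fix u assume u: "u \<in> {1 - \<delta><..<1}"
    define v where "v = 1 - u"
    have v: "v > 0" "1 + z * v > 0" using u z by (auto simp: v_def add_pos_nonneg)
    have "(F has_real_derivative (v powr (\<mu> - 1) * (1 + z * v) powr (- \<mu>) -
        z * (v powr \<mu> * (1 + z * v) powr (- \<mu> - 1)))) (at u)"
      unfolding F_def using v \<mu> by (auto intro!: derivative_eq_intros simp: v_def field_simps)
    also have "v powr (\<mu> - 1) * (1 + z * v) powr (- \<mu>) - z * (v powr \<mu> * (1 + z * v) powr (- \<mu> - 1)) = g u"
    proof -
      have 1: "v powr \<mu> = v * v powr (\<mu> - 1)" using v powr_add[of v 1 "\<mu> - 1"] by simp
      have 2: "(1 + z * v) powr (- \<mu>) = (1 + z * v) * (1 + z * v) powr (- \<mu> - 1)"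
        using v powr_add[of "1 + z * v" 1 "- \<mu> - 1"] by simp
      have 3: "- (\<mu> + 1) = - \<mu> - 1" by simp
      show ?thesis unfolding g_def v_def[symmetric] 1 2 3 by (simp add: algebra_simps)
    qed
    finally show "(F has_vector_derivative g u) (at u)"
      by (simp add: has_real_derivative_iff_has_vector_derivative)
  qed (use \<delta> in simp)
  moreover have "F 1 - F (1 - \<delta>) = \<delta> powr \<mu> * (1 + z * \<delta>) powr (- \<mu>) / \<mu>"
    using \<mu> by (simp add: F_def)
  ultimately have hi: "((\<lambda>u. indicator {1 - \<delta>..1} u * g u) has_integral (\<delta> powr \<mu> * (1 + z * \<delta>) powr (- \<mu>) / \<mu>)) UNIV"
  proof -
    assume "(g has_integral F 1 - F (1 - \<delta>)) {1 - \<delta>..1}" and eq: "F 1 - F (1 - \<delta>) = \<delta> powr \<mu> * (1 + z * \<delta>) powr (- \<mu>) / \<mu>"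
    moreover have "(\<lambda>u. indicator {1 - \<delta>..1} u * g u) = (\<lambda>u. if u \<in> {1 - \<delta>..1} then g u else 0)"
      by (auto simp: indicator_def)
    ultimately show ?thesis by (simp only: has_integral_restrict_UNIV)
  qed
  have [measurable]: "(\<lambda>u. indicator {1 - \<delta>..1} u * g u) \<in> borel_measurable borel"
    unfolding g_def by measurable
  have nonneg: "indicator {1 - \<delta>..1} u * g u \<ge> 0" for u by (simp add: g_def)
  have nn: "(\<integral>\<^sup>+u. ennreal (indicator {1 - \<delta>..1} u * g u) \<partial>lborel) = ennreal (\<delta> powr \<mu> * (1 + z * \<delta>) powr (- \<mu>) / \<mu>)"
    using nonneg hi by (intro nn_integral_has_integral_lborel) auto
  show "integrable lborel (\<lambda>u. indicator {1 - \<delta>..1} u * g u)"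
    using nonneg nn by (intro integrableI_nonneg) auto
  then show "(LINT u|lborel. indicator {1 - \<delta>..1} u * g u) = \<delta> powr \<mu> * (1 + z * \<delta>) powr (- \<mu>) / \<mu>"
    using nonneg nn \<mu> by (subst integral_eq_nn_integral) auto
qed

lemma ball_weight_1d:
  fixes u :: real assumes "\<bar>u\<bar> \<le> 1"
  shows "(1 - (norm u)\<^sup>2) powr s = (1 - u) powr s * (1 + u) powr s"
  using assms by (subst powr_mult[symmetric]) (auto simp: power2_eq_square algebra_simps)

lemma powr_mono_interval:
  fixes u s :: real assumes "0 \<le> u" "u \<le> 1"
  shows "min 1 (2 powr s) \<le> (1 + u) powr s" "(1 + u) powr s \<le> max 1 (2 powr s)"
proof -
  have "1 \<le> (1 + u) powr s \<and> (1 + u) powr s \<le> 2 powr s" if "s \<ge> 0"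
    using assms that powr_mono2[of s "1 + u" 2] by (auto intro: ge_one_powr_ge_zero)
  moreover have "2 powr s \<le> (1 + u) powr s \<and> (1 + u) powr s \<le> 1" if "s \<le> 0"
    using assms that powr_mono2'[of s "1 + u" 2] powr_mono2'[of s 1 "1 + u"] by auto
  ultimately show "min 1 (2 powr s) \<le> (1 + u) powr s" "(1 + u) powr s \<le> max 1 (2 powr s)"
    by (cases "s \<ge> 0"; force simp: min_def max_def)+
qed

text \<open>Close to u = 1 the density contributes the integral of \<open>integral_powr_end\<close>,
  of order \<open>(1 + z) powr (- \<mu>)\<close>; for negative \<open>u\<close> the assumed bound on
  \<open>p\<close> is already that small. With z = N^2 height x height y this average is where the
  local weights come from.\<close>

lemma mfun_decay:
  assumes "\<mu> \<ge> 0"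
  shows "\<exists>C>0. \<forall>p z A. z \<ge> 0 \<longrightarrow> A \<ge> 0 \<longrightarrow>
    (\<forall>u\<in>{-1..1}. \<bar>poly p u\<bar> \<le> A * (1 + z * (1 - u)) powr (- (\<mu> + 1))) \<longrightarrow>
    \<bar>mfun \<mu> p\<bar> \<le> C * A * (1 + z) powr (- \<mu>)"
proof (cases "\<mu> = 0")
  case True
  have "\<bar>mfun 0 p\<bar> \<le> A" if "z \<ge> 0" "A \<ge> 0"
    "\<forall>u\<in>{-1..1}. \<bar>poly p u\<bar> \<le> A * (1 + z * (1 - u)) powr (- (0 + 1))" for p z A
  proof -
    have "(1 + z * 2) powr - 1 \<le> 1" using that(1) by (simp add: powr_minus_divide)
    then have "A * (1 + z * 2) powr - 1 \<le> A" using that(2) mult_left_mono[of _ 1 A] by (simp only: mult_1_right)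
    then show ?thesis using that(3)[rule_format, of 1] that(3)[rule_format, of "-1"] by (auto simp: mfun_0_eq)
  qed
  then show ?thesis unfolding True by (intro exI[of _ 1]) auto
next
  case False
  then have \<mu>: "\<mu> > 0" using assms by simp
  define \<omega> where "\<omega> = ball_int (\<mu> - 1) (\<lambda>_ :: real. 1)"
  have \<omega>: "\<omega> > 0" unfolding \<omega>_def by (rule ball_int_one_pos) (use \<mu> in auto)
  define K where "K = max 1 (2 powr (\<mu> - 1))"
  have "\<bar>mfun \<mu> p\<bar> \<le> (1 + K / (\<mu> * \<omega>)) * A * (1 + z) powr (- \<mu>)"
    if z: "z \<ge> 0" and A: "A \<ge> 0" and p: "\<forall>u\<in>{-1..1}. \<bar>poly p u\<bar> \<le> A * (1 + z * (1 - u)) powr (- (\<mu> + 1))" for p z A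
  proof -
    \<comment> \<open>\<open>g\<close> majorises the part with u \<ge> 0 and \<open>w\<close> the
      part with u < 0. The interval is written \<open>{1 - 1..1}\<close> to match
      \<open>integral_powr_end\<close> at \<delta> = 1.\<close>
    define g where "g u = indicator {1 - 1..1} u * ((1 - u) powr (\<mu> - 1) * (1 + z * (1 - u)) powr (- (\<mu> + 1)))" for u :: real
    define w where "w u = indicator (cball 0 1) u * (1 * (1 - (norm u)\<^sup>2) powr (\<mu> - 1))" for u :: real
    have g: "integrable lborel g" "integral\<^sup>L lborel g = (1 + z) powr (- \<mu>) / \<mu>"
      using integral_powr_end[OF \<mu> zero_less_one z] unfolding g_def by simp_all
    have "ball_integrable (\<mu> - 1) (\<lambda>_ :: real. 1)"
      by (rule hom_ball_integrable[OF hom_poly_const]) (use \<mu> in auto)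
    then have w: "integrable lborel w" "integral\<^sup>L lborel w = \<omega>"
      unfolding w_def \<omega>_def ball_integrable_def ball_int_def by simp_all
    have int: "integrable lborel (\<lambda>u. indicator (cball 0 1) u * (poly p u * (1 - (norm u)\<^sup>2) powr (\<mu> - 1)))"
      using ball_int_poly(1)[OF \<mu>, of p] unfolding ball_integrable_def .
    have bound: "\<bar>indicator (cball 0 1) u * (poly p u * (1 - (norm u)\<^sup>2) powr (\<mu> - 1))\<bar> \<le>
        A * ((1 + z) powr (- \<mu>) * w u + K * g u)" for u :: real
    proof (cases "\<bar>u\<bar> \<le> 1")
      case False
      then have "u \<notin> {1 - 1..1}" by auto
      then show ?thesis using A False by (simp add: w_def g_def)
    next
      case True
      have pu: "\<bar>poly p u\<bar> \<le> A * (1 + z * (1 - u)) powr (- (\<mu> + 1))" using p True by (simp add: abs_le_iff)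
      show ?thesis
      proof (cases "u \<ge> 0")
        case False
        have "(1 + z * (1 - u)) powr (- (\<mu> + 1)) \<le> (1 + z) powr (- (\<mu> + 1))"
          using False z \<mu> mult_nonpos_nonneg[of u z] by (intro powr_mono2') (auto simp: algebra_simps)
        also have "\<dots> \<le> (1 + z) powr (- \<mu>)" using z by (intro powr_mono) auto
        finally have "\<bar>poly p u\<bar> \<le> A * (1 + z) powr (- \<mu>)"
          using pu A mult_left_mono by (meson order.trans)
        then have "\<bar>poly p u\<bar> * (1 - (norm u)\<^sup>2) powr (\<mu> - 1) \<le> A * (1 + z) powr (- \<mu>) * (1 - (norm u)\<^sup>2) powr (\<mu> - 1)"
          by (intro mult_right_mono) auto
        then show ?thesis using True False by (simp add: abs_mult w_def g_def)
      next
        case pos: True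
        have "(1 - (norm u)\<^sup>2) powr (\<mu> - 1) \<le> (1 - u) powr (\<mu> - 1) * K"
          unfolding ball_weight_1d[OF True] K_def using pos True
          by (intro mult_left_mono powr_mono_interval) auto
        then have "\<bar>poly p u\<bar> * (1 - (norm u)\<^sup>2) powr (\<mu> - 1) \<le>
            (A * (1 + z * (1 - u)) powr (- (\<mu> + 1))) * ((1 - u) powr (\<mu> - 1) * K)"
          using pu A by (intro mult_mono) auto
        also have "\<dots> = A * (K * g u)" using pos True by (simp add: g_def mult_ac)
        also have "\<dots> \<le> A * ((1 + z) powr (- \<mu>) * w u + K * g u)"
          using A by (intro mult_left_mono) (auto simp: w_def)
        finally show ?thesis using True by (simp add: abs_mult)
      qed
    qed
    have "\<bar>ball_int (\<mu> - 1) (poly p)\<bar> \<le> (LINT u|lborel. A * ((1 + z) powr (- \<mu>) * w u + K * g u))"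
      unfolding ball_int_def
      by (rule order.trans[OF integral_abs_bound integral_mono]) (use int w g bound in auto)
    also have "\<dots> = A * ((1 + z) powr (- \<mu>) * \<omega> + K * ((1 + z) powr (- \<mu>) / \<mu>))"
      using w g by simp
    finally have "\<omega> * \<bar>mfun \<mu> p\<bar> \<le> A * ((1 + z) powr (- \<mu>) * \<omega> + K * ((1 + z) powr (- \<mu>) / \<mu>))"
      unfolding ball_int_poly(2)[OF \<mu>] \<omega>_def[symmetric] using \<omega> by (simp add: abs_mult)
    also have "\<dots> = \<omega> * ((1 + K / (\<mu> * \<omega>)) * A * (1 + z) powr (- \<mu>))"
      using \<omega> \<mu> by (simp add: field_simps)
    finally show ?thesis using \<omega> by simp
  qed
  moreover have "1 + K / (\<mu> * \<omega>) > 0" using \<omega> \<mu> by (auto simp: K_def intro!: add_pos_nonneg)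
  ultimately show ?thesis by blast
qed

text \<open>The interval \<open>{1 - \<delta>..1}\<close> has mass of order
  \<open>\<delta> powr \<mu>\<close>. For \<mu> = 0 this is the point mass 1/2 at 1.\<close>

lemma mfun_lower:
  assumes "\<mu> \<ge> 0"
  shows "\<exists>c>0. \<forall>p \<delta> A. 0 < \<delta> \<longrightarrow> \<delta> \<le> 1 \<longrightarrow> A \<ge> 0 \<longrightarrow> (\<forall>u\<in>{-1..1}. poly p u \<ge> 0) \<longrightarrow>
    (\<forall>u\<in>{1 - \<delta>..1}. poly p u \<ge> A) \<longrightarrow> mfun \<mu> p \<ge> c * A * \<delta> powr \<mu>"
proof (cases "\<mu> = 0")
  case True
  have "mfun 0 p \<ge> 1/2 * A * \<delta> powr 0" if "0 < \<delta>" "A \<ge> 0" "\<forall>u\<in>{-1..1}. poly p u \<ge> 0" "\<forall>u\<in>{1 - \<delta>..1}. poly p u \<ge> A" for p \<delta> A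
    using that(1) that(3)[rule_format, of "-1"] that(4)[rule_format, of 1] by (simp add: mfun_0_eq)
  then show ?thesis unfolding True by (intro exI[of _ "1/2"]) auto
next
  case False
  then have \<mu>: "\<mu> > 0" using assms by simp
  define \<omega> where "\<omega> = ball_int (\<mu> - 1) (\<lambda>_ :: real. 1)"
  have \<omega>: "\<omega> > 0" unfolding \<omega>_def by (rule ball_int_one_pos) (use \<mu> in auto)
  define K where "K = min 1 (2 powr (\<mu> - 1))"
  have K: "K > 0" by (simp add: K_def)
  have "K / (\<mu> * \<omega>) * A * \<delta> powr \<mu> \<le> mfun \<mu> p"
    if \<delta>: "0 < \<delta>" "\<delta> \<le> 1" and A: "A \<ge> 0" and p0: "\<forall>u\<in>{-1..1}. poly p u \<ge> 0" and pA: "\<forall>u\<in>{1 - \<delta>..1}. poly p u \<ge> A" for p \<delta> A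
  proof -
    \<comment> \<open>This is \<open>integral_powr_end\<close> at z = 0, where the second factor is
      1.\<close>
    define g where "g u = indicator {1 - \<delta>..1} u * ((1 - u) powr (\<mu> - 1) * (1 + 0 * (1 - u)) powr (- (\<mu> + 1)))" for u :: real
    have g: "integrable lborel g" "integral\<^sup>L lborel g = \<delta> powr \<mu> / \<mu>"
      using integral_powr_end[OF \<mu> \<delta>(1), of 0] unfolding g_def by simp_all
    have int: "integrable lborel (\<lambda>u. indicator (cball 0 1) u * (poly p u * (1 - (norm u)\<^sup>2) powr (\<mu> - 1)))"
      using ball_int_poly(1)[OF \<mu>, of p] unfolding ball_integrable_def .
    have bound: "A * K * g u \<le> indicator (cball 0 1) u * (poly p u * (1 - (norm u)\<^sup>2) powr (\<mu> - 1))" for u :: real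
    proof (cases "u \<in> {1 - \<delta>..1}")
      case True
      then have u: "0 \<le> u" "u \<le> 1" "\<bar>u\<bar> \<le> 1" using \<delta> by auto
      have "A * ((1 - u) powr (\<mu> - 1) * K) \<le> poly p u * (1 - (norm u)\<^sup>2) powr (\<mu> - 1)"
        unfolding ball_weight_1d[OF u(3)] using pA True A K u p0 unfolding K_def
        by (intro mult_mono powr_mono_interval) auto
      then show ?thesis using True u by (simp add: g_def mult_ac)
    next
      case False
      then show ?thesis using p0 by (auto simp: g_def indicator_def abs_le_iff)
    qed
    have "A * K * (\<delta> powr \<mu> / \<mu>) = (LINT u|lborel. A * K * g u)" using g by simp
    also have "\<dots> \<le> ball_int (\<mu> - 1) (poly p)"
      unfolding ball_int_def by (rule integral_mono) (use int g bound in auto)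
    finally show ?thesis
      unfolding ball_int_poly(2)[OF \<mu>] \<omega>_def[symmetric] using \<omega> \<mu> by (simp add: field_simps)
  qed
  moreover have "K / (\<mu> * \<omega>) > 0" using \<omega> \<mu> K by simp
  ultimately show ?thesis by blast
qed

section \<open>Polynomials in several variables\<close>

lemma finite_multi_indices: "finite {\<alpha> :: 'd::finite \<Rightarrow> nat. sum \<alpha> UNIV \<le> n}"
proof (rule finite_subset)
  show "{\<alpha> :: 'd \<Rightarrow> nat. sum \<alpha> UNIV \<le> n} \<subseteq> PiE UNIV (\<lambda>_. {..n})"
  proof safe
    fix \<alpha> :: "'d \<Rightarrow> nat" and i
    assume "sum \<alpha> UNIV \<le> n"
    then show "\<alpha> i \<le> n" using member_le_sum[of i UNIV \<alpha>] by simp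
  qed auto
qed (intro finite_PiE, auto)

lemma poly_deg_le_zero: "poly_deg_le n (\<lambda>_. 0)"
  unfolding poly_deg_le_def by (intro exI[of _ "\<lambda>_. 0"]) simp

lemma poly_deg_le_add: "poly_deg_le n f \<Longrightarrow> poly_deg_le n g \<Longrightarrow> poly_deg_le n (\<lambda>x. f x + g x)"
  unfolding poly_deg_le_def
proof (elim exE)
  fix c c'
  assume "\<forall>x. f x = (\<Sum>\<alpha> | sum \<alpha> UNIV \<le> n. c \<alpha> * monomial \<alpha> x)"
    "\<forall>x. g x = (\<Sum>\<alpha> | sum \<alpha> UNIV \<le> n. c' \<alpha> * monomial \<alpha> x)"
  then show "\<exists>c. \<forall>x. f x + g x = (\<Sum>\<alpha> | sum \<alpha> UNIV \<le> n. c \<alpha> * monomial \<alpha> x)"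
    by (intro exI[of _ "\<lambda>\<alpha>. c \<alpha> + c' \<alpha>"]) (simp add: distrib_right sum.distrib)
qed

lemma poly_deg_le_cmult: "poly_deg_le n f \<Longrightarrow> poly_deg_le n (\<lambda>x. a * f x)"
  unfolding poly_deg_le_def
proof (elim exE)
  fix c
  assume "\<forall>x. f x = (\<Sum>\<alpha> | sum \<alpha> UNIV \<le> n. c \<alpha> * monomial \<alpha> x)"
  then show "\<exists>c. \<forall>x. a * f x = (\<Sum>\<alpha> | sum \<alpha> UNIV \<le> n. c \<alpha> * monomial \<alpha> x)"
    by (intro exI[of _ "\<lambda>\<alpha>. a * c \<alpha>"]) (simp add: sum_distrib_left mult.assoc)
qed

lemma poly_deg_le_sum:
  "(\<And>i. i \<in> A \<Longrightarrow> poly_deg_le n (f i)) \<Longrightarrow> poly_deg_le n (\<lambda>x. \<Sum>i\<in>A. f i x)"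
  by (induction A rule: infinite_finite_induct) (auto intro: poly_deg_le_zero poly_deg_le_add)

lemma poly_deg_le_monomial:
  assumes "sum \<alpha> UNIV \<le> n" shows "poly_deg_le n (monomial \<alpha>)"
  unfolding poly_deg_le_def
proof (intro exI[of _ "\<lambda>\<beta>. if \<beta> = \<alpha> then 1 else 0"] allI)
  fix x
  have "(\<Sum>\<beta> | sum \<beta> UNIV \<le> n. (if \<beta> = \<alpha> then 1 else 0) * monomial \<beta> x) =
      (\<Sum>\<beta> | sum \<beta> UNIV \<le> n. if \<alpha> = \<beta> then monomial \<beta> x else 0)"
    by (intro sum.cong) auto
  also have "\<dots> = monomial \<alpha> x" using assms by (subst sum.delta'[OF finite_multi_indices]) simp
  finally show "monomial \<alpha> x = (\<Sum>\<beta> | sum \<beta> UNIV \<le> n. (if \<beta> = \<alpha> then 1 else 0) * monomial \<beta> x)" ..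
qed

lemma poly_deg_le_mono:
  assumes "poly_deg_le m f" "m \<le> n" shows "poly_deg_le n f"
proof -
  obtain c where c: "f = (\<lambda>x. \<Sum>\<alpha> | sum \<alpha> UNIV \<le> m. c \<alpha> * monomial \<alpha> x)"
    using assms(1) unfolding poly_deg_le_def by auto
  show ?thesis
    unfolding c using assms(2) by (intro poly_deg_le_sum poly_deg_le_cmult poly_deg_le_monomial) auto
qed

lemma monomial_mult: "monomial \<alpha> x * monomial \<beta> x = monomial (\<lambda>i. \<alpha> i + \<beta> i) x"
  by (simp add: monomial_def power_add prod.distrib)

lemma poly_deg_le_mult:
  assumes "poly_deg_le m f" "poly_deg_le n g" shows "poly_deg_le (m + n) (\<lambda>x. f x * g x)"
proof -
  obtain c where c: "f = (\<lambda>x. \<Sum>\<alpha> | sum \<alpha> UNIV \<le> m. c \<alpha> * monomial \<alpha> x)"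
    using assms(1) unfolding poly_deg_le_def by auto
  obtain c' where c': "g = (\<lambda>x. \<Sum>\<alpha> | sum \<alpha> UNIV \<le> n. c' \<alpha> * monomial \<alpha> x)"
    using assms(2) unfolding poly_deg_le_def by auto
  have "(\<lambda>x. f x * g x) = (\<lambda>x. \<Sum>\<alpha> | sum \<alpha> UNIV \<le> m. \<Sum>\<beta> | sum \<beta> UNIV \<le> n. (c \<alpha> * c' \<beta>) * monomial (\<lambda>i. \<alpha> i + \<beta> i) x)"
    unfolding c c' sum_product monomial_mult[symmetric] by (simp add: mult_ac)
  then show ?thesis
    by (simp only:) (intro poly_deg_le_sum poly_deg_le_cmult poly_deg_le_monomial, auto simp: sum.distrib)
qed

lemma poly_deg_le_const: "poly_deg_le n (\<lambda>_ :: real ^ 'd. c)"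
proof -
  have "monomial (\<lambda>_. 0) = (\<lambda>x :: real ^ 'd. 1)" by (simp add: monomial_def fun_eq_iff)
  then have "poly_deg_le n (\<lambda>x :: real ^ 'd. 1)"
    using poly_deg_le_monomial[of "\<lambda>_ :: 'd. 0" n] by simp
  from poly_deg_le_cmult[OF this, of c] show ?thesis by simp
qed

lemma poly_deg_le_nth: "poly_deg_le 1 (\<lambda>x. x $ i)"
proof -
  have "monomial (\<lambda>j. if j = i then 1 else 0) x = x $ i" for x
  proof -
    have "monomial (\<lambda>j. if j = i then 1 else 0) x = (\<Prod>j\<in>UNIV. if j = i then x $ j else 1)"
      unfolding monomial_def by (intro prod.cong) auto
    then show ?thesis by simp
  qed
  then have "monomial (\<lambda>j. if j = i then 1 else 0) = (\<lambda>x. x $ i)" by (simp add: fun_eq_iff)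
  then show ?thesis using poly_deg_le_monomial[of "\<lambda>j. if j = i then 1 else 0" 1] by simp
qed

lemma poly_deg_le_power: "poly_deg_le n f \<Longrightarrow> poly_deg_le (k * n) (\<lambda>x. f x ^ k)"
  by (induction k) (auto intro: poly_deg_le_const poly_deg_le_mult)

lemma poly_deg_le_norm: "poly_deg_le 2 (\<lambda>x :: real ^ 'd. 1 - (norm x)\<^sup>2)"
proof -
  have "poly_deg_le (1 + 1) (\<lambda>x :: real ^ 'd. 1 + (-1) * (\<Sum>i\<in>UNIV. x $ i * x $ i))"
    by (intro poly_deg_le_add poly_deg_le_const poly_deg_le_cmult poly_deg_le_sum poly_deg_le_mult poly_deg_le_nth)
  moreover have "(\<lambda>x :: real ^ 'd. 1 + (-1) * (\<Sum>i\<in>UNIV. x $ i * x $ i)) = (\<lambda>x. 1 - (norm x)\<^sup>2)"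
    by (simp add: fun_eq_iff power2_norm_eq_inner inner_vec_def)
  ultimately show ?thesis by (simp only: one_add_one)
qed

lemma hom_poly_prod:
  "finite A \<Longrightarrow> (\<And>i. i \<in> A \<Longrightarrow> hom_poly (k i) (f i)) \<Longrightarrow> hom_poly (sum k A) (\<lambda>x. \<Prod>i\<in>A. f i x)"
  by (induction A rule: finite_induct) (auto intro: hom_poly_const hom_poly_mult)

lemma hom_poly_monomial_vec: "hom_poly (sum \<alpha> UNIV) (monomial \<alpha>)"
  unfolding monomial_def
proof (rule hom_poly_prod)
  fix i
  show "hom_poly (\<alpha> i) (\<lambda>x. x $ i ^ \<alpha> i)"
    using hom_poly_power[OF hom_poly_linear[OF bounded_linear_vec_nth], of "\<alpha> i"] by simp
qed simp

lemma poly_deg_le_hom_decompose: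
  assumes "poly_deg_le n q"
  shows "\<exists>h. (\<forall>k. hom_poly k (h k)) \<and> (\<forall>x. q x = (\<Sum>k\<le>n. h k x))"
proof -
  obtain c where c: "q = (\<lambda>x. \<Sum>\<alpha> | sum \<alpha> UNIV \<le> n. c \<alpha> * monomial \<alpha> x)"
    using assms unfolding poly_deg_le_def by auto
  define h where "h k x = (\<Sum>\<alpha> \<in> {\<alpha> \<in> {\<alpha>. sum \<alpha> UNIV \<le> n}. sum \<alpha> UNIV = k}. c \<alpha> * monomial \<alpha> x)" for k x
  have "hom_poly k (h k)" for k
    unfolding h_def
  proof (intro hom_poly_sum hom_poly_cmult)
    fix \<alpha> :: "'a \<Rightarrow> nat" assume "\<alpha> \<in> {\<alpha> \<in> {\<alpha>. sum \<alpha> UNIV \<le> n}. sum \<alpha> UNIV = k}"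
    then show "hom_poly k (monomial \<alpha>)" using hom_poly_monomial_vec[of \<alpha>] by auto
  qed
  moreover have "q x = (\<Sum>k\<le>n. h k x)" for x
    unfolding c h_def by (rule sum.group[symmetric]) (auto simp: finite_multi_indices)
  ultimately show ?thesis by blast
qed

lemma poly_deg_le_continuous: "poly_deg_le n q \<Longrightarrow> continuous_on UNIV q"
  using poly_deg_le_hom_decompose[of n q] hom_poly_continuous
  by (auto intro!: continuous_on_sum simp: fun_eq_iff[symmetric] cong: continuous_on_cong)

lemma poly_deg_le_measurable: "poly_deg_le n q \<Longrightarrow> q \<in> borel_measurable borel"
  by (intro borel_measurable_continuous_onI poly_deg_le_continuous)

lemma poly_deg_le_ball_integrable:
  assumes "poly_deg_le n q" "s > -1" shows "ball_integrable s q"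
proof -
  obtain h where h: "\<And>k. hom_poly k (h k)" "q = (\<lambda>x. \<Sum>k\<le>n. h k x)"
    using poly_deg_le_hom_decompose[OF assms(1)] by auto
  show ?thesis unfolding h(2) by (intro ball_integrable_sum hom_ball_integrable[OF h(1) assms(2)])
qed

lemma poly_deg_le_real_polynomial:
  assumes "poly_deg_le n q" shows "real_polynomial_function q"
proof -
  obtain c where c: "q = (\<lambda>x. \<Sum>\<alpha> | sum \<alpha> UNIV \<le> n. c \<alpha> * monomial \<alpha> x)"
    using assms unfolding poly_deg_le_def by auto
  show ?thesis
    unfolding c monomial_def
    by (intro real_polynomial_function_sum finite_multi_indices real_polynomial_function.intros(4)
      real_polynomial_function.intros(2) real_polynomial_function_prod real_polynomial_function_power
      real_polynomial_function.intros(1) bounded_linear_vec_nth) auto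
qed

text \<open>Finite sums of products, with \<open>n\<close> bounding the degree in each variable
  separately. In this form two iterated integrals can be exchanged by linearity, without a product
  measure.\<close>

inductive sep_poly :: "nat \<Rightarrow> (real ^ 'd \<Rightarrow> real ^ 'd \<Rightarrow> real) \<Rightarrow> bool" for n where
  sep_poly_prod: "poly_deg_le n p \<Longrightarrow> poly_deg_le n q \<Longrightarrow> sep_poly n (\<lambda>x y. p x * q y)"
| sep_poly_add: "sep_poly n K \<Longrightarrow> sep_poly n L \<Longrightarrow> sep_poly n (\<lambda>x y. K x y + L x y)"

lemma sep_poly_const: "sep_poly n (\<lambda>_ _. c)"
  using sep_poly_prod[OF poly_deg_le_const[of n c] poly_deg_le_const[of n 1]] by simp

lemma sep_poly_sum:
  "(\<And>i. i \<in> A \<Longrightarrow> sep_poly n (K i)) \<Longrightarrow> sep_poly n (\<lambda>x y. \<Sum>i\<in>A. K i x y)"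
  by (induction A rule: infinite_finite_induct) (auto intro: sep_poly_const sep_poly_add)

lemma sep_poly_mono: "sep_poly m K \<Longrightarrow> m \<le> n \<Longrightarrow> sep_poly n K"
  by (induction rule: sep_poly.induct) (auto intro: sep_poly.intros poly_deg_le_mono)

lemma sep_poly_mult:
  assumes "sep_poly m K" "sep_poly n L" shows "sep_poly (m + n) (\<lambda>x y. K x y * L x y)"
  using assms(1)
proof (induction rule: sep_poly.induct)
  case (sep_poly_prod p q)
  show ?case
    using assms(2)
  proof (induction rule: sep_poly.induct)
    case (sep_poly_prod p' q')
    have "sep_poly (m + n) (\<lambda>x y. (p x * p' x) * (q y * q' y))"
      using \<open>poly_deg_le m p\<close> \<open>poly_deg_le m q\<close> sep_poly_prod
      by (intro sep_poly.sep_poly_prod poly_deg_le_mult)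
    then show ?case by (simp add: mult_ac)
  next
    case (sep_poly_add K L)
    from sep_poly.sep_poly_add[OF sep_poly_add.IH] show ?case by (simp add: distrib_left)
  qed
next
  case (sep_poly_add K' L')
  from sep_poly.sep_poly_add[OF sep_poly_add.IH] show ?case by (simp add: distrib_right)
qed

lemma sep_poly_cmult: "sep_poly n K \<Longrightarrow> sep_poly n (\<lambda>x y. c * K x y)"
  using sep_poly_mult[OF sep_poly_const[of 0 c]] by fastforce

lemma sep_poly_power: "sep_poly n K \<Longrightarrow> sep_poly (k * n) (\<lambda>x y. K x y ^ k)"
  by (induction k) (auto intro: sep_poly_const sep_poly_mult)

lemma sep_poly_right: "sep_poly n K \<Longrightarrow> poly_deg_le n (K x)"
  by (induction rule: sep_poly.induct) (auto intro: poly_deg_le_add poly_deg_le_cmult)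

lemma sep_poly_real_polynomial:
  fixes K :: "real ^ 'd \<Rightarrow> real ^ 'd \<Rightarrow> real"
  shows "sep_poly n K \<Longrightarrow> real_polynomial_function (\<lambda>(x, y). K x y)"
proof (induction rule: sep_poly.induct)
  case (sep_poly_prod p q)
  have "polynomial_function (fst :: (real ^ 'd) \<times> (real ^ 'd) \<Rightarrow> _)" "polynomial_function (snd :: (real ^ 'd) \<times> (real ^ 'd) \<Rightarrow> _)"
    by (auto intro!: polynomial_function_bounded_linear bounded_linear_fst bounded_linear_snd)
  then have "real_polynomial_function (p \<circ> fst :: (real ^ 'd) \<times> (real ^ 'd) \<Rightarrow> _)"
    "real_polynomial_function (q \<circ> snd :: (real ^ 'd) \<times> (real ^ 'd) \<Rightarrow> _)"
    using sep_poly_prod by (auto intro: real_polynomial_function_compose poly_deg_le_real_polynomial)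
  then show ?case by (auto simp: case_prod_beta' o_def intro: real_polynomial_function.intros)
next
  case (sep_poly_add K L)
  then show ?case by (auto simp: case_prod_beta' intro: real_polynomial_function.intros)
qed

lemma sep_poly_trans_mono: "sep_poly j (trans_mono \<mu> j :: real ^ 'd \<Rightarrow> real ^ 'd \<Rightarrow> real)"
proof -
  have inner: "sep_poly 1 (\<lambda>x y :: real ^ 'd. x \<bullet> y)"
    unfolding inner_vec_def inner_real_def by (intro sep_poly_sum sep_poly_prod poly_deg_le_nth)
  have norms: "sep_poly 2 (\<lambda>x y :: real ^ 'd. (1 - (norm x)\<^sup>2) * (1 - (norm y)\<^sup>2))"
    by (intro sep_poly_prod poly_deg_le_norm)
  have "sep_poly j (\<lambda>x y :: real ^ 'd. real (j choose m) * (x \<bullet> y) ^ (j - m) *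
      (mom \<mu> m * ((1 - (norm x)\<^sup>2) * (1 - (norm y)\<^sup>2)) ^ (m div 2)))" if "m \<le> j" for m
  proof -
    have "sep_poly ((j - m) * 1 + (m div 2) * 2) (\<lambda>x y :: real ^ 'd. (real (j choose m) * (x \<bullet> y) ^ (j - m)) *
        (mom \<mu> m * ((1 - (norm x)\<^sup>2) * (1 - (norm y)\<^sup>2)) ^ (m div 2)))"
      by (intro sep_poly_mult sep_poly_cmult sep_poly_power inner norms)
    moreover have "(j - m) * 1 + (m div 2) * 2 \<le> j" using that by simp
    ultimately show ?thesis by (rule sep_poly_mono)
  qed
  then show ?thesis unfolding trans_mono_def[abs_def] by (intro sep_poly_sum) auto
qed

text \<open>The operator \<open>T\<close> of the overview as a kernel on the whole space: a
  projection kernel must be polynomial in both variables, whereas the averaging formula makes sense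
  only on the ball.\<close>

definition trans_poly :: "real \<Rightarrow> real poly \<Rightarrow> real ^ 'd \<Rightarrow> real ^ 'd \<Rightarrow> real" where
  "trans_poly \<mu> g x y = (\<Sum>j\<le>degree g. coeff g j * trans_mono \<mu> j x y)"

lemma trans_poly_alt: "degree g \<le> n \<Longrightarrow> trans_poly \<mu> g x y = (\<Sum>j\<le>n. coeff g j * trans_mono \<mu> j x y)"
  unfolding trans_poly_def by (intro sum.mono_neutral_left) (auto simp: coeff_eq_0)

lemma trans_poly_add: "trans_poly \<mu> (f + g) x y = trans_poly \<mu> f x y + trans_poly \<mu> g x y"
  using trans_poly_alt[of f "max (degree f) (degree g)" \<mu> x y] trans_poly_alt[of g "max (degree f) (degree g)" \<mu> x y]
    trans_poly_alt[of "f + g" "max (degree f) (degree g)" \<mu> x y]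
  by (simp add: degree_add_le_max sum.distrib algebra_simps)

lemma trans_poly_smult: "trans_poly \<mu> (smult c g) x y = c * trans_poly \<mu> g x y"
  by (subst trans_poly_alt[of _ "degree g"]) (simp_all add: trans_poly_def sum_distrib_left mult.assoc)

lemma trans_poly_0: "trans_poly \<mu> 0 x y = 0"
  by (simp add: trans_poly_def)

lemma trans_poly_sum: "trans_poly \<mu> (\<Sum>i\<in>A. g i) x y = (\<Sum>i\<in>A. trans_poly \<mu> (g i) x y)"
  by (induction A rule: infinite_finite_induct) (simp_all add: trans_poly_add trans_poly_0)

lemma trans_poly_commute: "trans_poly \<mu> g x y = trans_poly \<mu> g y x"
  by (simp add: trans_poly_def trans_mono_def inner_commute mult.commute)

lemma sep_poly_trans_poly: "degree g \<le> n \<Longrightarrow> sep_poly n (trans_poly \<mu> g)"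
  unfolding trans_poly_def[abs_def]
  by (intro sep_poly_sum sep_poly_cmult sep_poly_mono[OF sep_poly_trans_mono]) auto

text \<open>Expanding the powers of the linear polynomial, odd powers of the square roots meet
  vanishing moments, and even ones are the powers occurring in \<open>trans_mono\<close>.\<close>

lemma trans_poly_eq_mfun:
  assumes "norm x \<le> 1" "norm y \<le> 1"
  shows "trans_poly \<mu> g x y = mfun \<mu> (pcompose g [:x \<bullet> y, sqrt (1 - (norm x)\<^sup>2) * sqrt (1 - (norm y)\<^sup>2):])"
proof -
  define c s where "c = x \<bullet> y" and "s = sqrt (1 - (norm x)\<^sup>2) * sqrt (1 - (norm y)\<^sup>2)"
  have s2: "s ^ (2 * k) = ((1 - (norm x)\<^sup>2) * (1 - (norm y)\<^sup>2)) ^ k" for k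
    using assms by (simp add: s_def power_mult power_mult_distrib abs_square_le_1)
  have mono: "mfun \<mu> ([:c, s:] ^ j) = trans_mono \<mu> j x y" for j
  proof -
    have "[:c, s:] = monom s 1 + [:c:]" by (simp add: monom_altdef)
    then have "[:c, s:] ^ j = (\<Sum>m\<le>j. of_nat (j choose m) * monom s 1 ^ m * [:c:] ^ (j - m))"
      by (simp only: binomial_ring)
    also have "\<dots> = (\<Sum>m\<le>j. monom (real (j choose m) * c ^ (j - m) * s ^ m) m)"
    proof (rule sum.cong, rule refl)
      fix m
      have "of_nat (j choose m) = [:real (j choose m):]" "monom s 1 ^ m = monom (s ^ m) m"
          "[:c:] ^ (j - m) = [:c ^ (j - m):]"
        by (simp_all add: of_nat_poly monom_power poly_const_pow)
      then show "of_nat (j choose m) * monom s 1 ^ m * [:c:] ^ (j - m) =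
          monom (real (j choose m) * c ^ (j - m) * s ^ m) m"
        by (simp only:) (simp add: smult_monom mult_ac)
    qed
    finally have "mfun \<mu> ([:c, s:] ^ j) = (\<Sum>m\<le>j. real (j choose m) * c ^ (j - m) * s ^ m * mom \<mu> m)"
      by (simp only: mfun_sum mfun_monom)
    also have "\<dots> = trans_mono \<mu> j x y"
      unfolding trans_mono_def
    proof (rule sum.cong, rule refl)
      fix m
      show "real (j choose m) * c ^ (j - m) * s ^ m * mom \<mu> m = real (j choose m) * (x \<bullet> y) ^ (j - m) *
        (mom \<mu> m * ((1 - (norm x)\<^sup>2) * (1 - (norm y)\<^sup>2)) ^ (m div 2))"
      proof (cases "even m")
        case True
        then obtain k where m: "m = 2 * k" by (elim evenE)
        show ?thesis unfolding m s2 by (simp add: c_def)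
      qed simp
    qed
    finally show ?thesis .
  qed
  have "pcompose g [:c, s:] = (\<Sum>j\<le>degree g. smult (coeff g j) ([:c, s:] ^ j))"
    unfolding pcompose_altdef poly_altdef
    by (simp add: degree_map_poly coeff_map_poly)
  then show ?thesis
    unfolding c_def[symmetric] s_def[symmetric] trans_poly_def by (simp add: mfun_sum mfun_smult mono)
qed

section \<open>The projection kernels\<close>

lemma weighted_integral_ball: "weighted_integral \<mu> (cball 0 1) f = ball_int (\<mu> - 1/2) f"
  by (simp add: weighted_integral_def set_lebesgue_integral_def ball_weight_def ball_int_def)

lemma ball_const_eq: "ball_const TYPE('d::finite) \<mu> = inverse (ball_int (\<mu> - 1/2) (\<lambda>_ :: real ^ 'd. 1))"
  by (simp add: ball_const_def weighted_integral_ball)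

text \<open>A Funk-Hecke formula, obtained by applying \<open>trans_mono_integral\<close> to each
  homogeneous component of \<open>q\<close>. The same \<open>p\<close> serves all \<open>g\<close>,
  so orthogonality of \<open>q\<close> can be tested through \<open>p\<close>.\<close>

lemma trans_poly_reproducing:
  fixes x :: "real ^ 'd"
  assumes \<mu>: "\<mu> \<ge> 0" and x: "norm x \<le> 1" and q: "poly_deg_le r q"
  shows "\<exists>p. degree p \<le> r \<and> poly p 1 = q x \<and>
    (\<forall>g. ball_int (\<mu> - 1/2) (\<lambda>y. trans_poly \<mu> g x y * q y) =
      ball_int (\<mu> - 1/2) (\<lambda>_ :: real ^ 'd. 1) * mfun (\<mu> + CARD('d) / 2) (g * p))"
proof -
  define \<omega> \<nu> where "\<omega> = ball_int (\<mu> - 1/2) (\<lambda>_ :: real ^ 'd. 1)" and "\<nu> = \<mu> + CARD('d) / 2"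
  have s: "\<mu> - 1/2 > -1" using \<mu> by simp
  obtain h where h: "\<And>k. hom_poly k (h k)" "\<And>x. q x = (\<Sum>k\<le>r. h k x)"
    using poly_deg_le_hom_decompose[OF q] by blast
  have "\<exists>p. degree p \<le> k \<and> poly p 1 = h k x \<and>
    (\<forall>j. ball_int (\<mu> - 1/2) (\<lambda>y. trans_mono \<mu> j x y * h k y) = \<omega> * mfun \<nu> (monom 1 j * p))" for k
    unfolding \<omega>_def \<nu>_def by (rule trans_mono_integral[OF \<mu> x h(1)])
  then obtain P where P: "\<And>k. degree (P k) \<le> k" "\<And>k. poly (P k) 1 = h k x"
    "\<And>k j. ball_int (\<mu> - 1/2) (\<lambda>y. trans_mono \<mu> j x y * h k y) = \<omega> * mfun \<nu> (monom 1 j * P k)"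
    by metis
  define p where "p = (\<Sum>k\<le>r. P k)"
  have "degree p \<le> r" unfolding p_def using P(1) by (intro degree_sum_le) (auto intro: order.trans)
  moreover have "poly p 1 = q x" by (simp add: p_def poly_sum P(2) h(2))
  moreover have "ball_int (\<mu> - 1/2) (\<lambda>y. trans_poly \<mu> g x y * q y) = \<omega> * mfun \<nu> (g * p)" for g
  proof -
    have int: "ball_integrable (\<mu> - 1/2) (\<lambda>y. trans_mono \<mu> j x y * h k y)" for j k
    proof -
      obtain h' where h': "\<And>i. hom_poly i (h' i)" "\<And>y. trans_mono \<mu> j x y = (\<Sum>i\<le>j. h' i y)"
        using poly_deg_le_hom_decompose[OF sep_poly_right[OF sep_poly_trans_mono]] by blast
      show ?thesis unfolding h'(2) sum_distrib_right
        by (intro ball_integrable_sum hom_ball_integrable[OF hom_poly_mult[OF h'(1) h(1)] s])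
    qed
    have "ball_int (\<mu> - 1/2) (\<lambda>y. trans_poly \<mu> g x y * q y) =
        ball_int (\<mu> - 1/2) (\<lambda>y. \<Sum>j\<le>degree g. \<Sum>k\<le>r. coeff g j * (trans_mono \<mu> j x y * h k y))"
      unfolding trans_poly_def h(2) sum_product by (simp add: mult.assoc)
    also have "\<dots> = (\<Sum>j\<le>degree g. \<Sum>k\<le>r. coeff g j * ball_int (\<mu> - 1/2) (\<lambda>y. trans_mono \<mu> j x y * h k y))"
      by (subst ball_int_sum, intro ball_integrable_sum ball_integrable_cmult int,
          subst ball_int_sum, intro ball_integrable_cmult int, simp only: ball_int_cmult)
    also have "\<dots> = (\<Sum>j\<le>degree g. coeff g j * (\<omega> * mfun \<nu> (monom 1 j * p)))"
      unfolding P(3) p_def by (simp add: sum_distrib_left mfun_sum)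
    also have "\<dots> = \<omega> * mfun \<nu> ((\<Sum>j\<le>degree g. smult (coeff g j) (monom 1 j)) * p)"
      by (simp add: sum_distrib_right sum_distrib_left mfun_sum mfun_smult mult_ac)
    also have "(\<Sum>j\<le>degree g. smult (coeff g j) (monom 1 j)) = g"
      by (simp add: smult_monom poly_as_sum_of_monoms)
    finally show ?thesis .
  qed
  ultimately show ?thesis unfolding \<omega>_def \<nu>_def by blast
qed

lemma orth_polys_add_cmult:
  fixes p q :: "real ^ 'd \<Rightarrow> real"
  assumes \<mu>: "\<mu> \<ge> 0" and "p \<in> orth_polys \<mu> n" "q \<in> orth_polys \<mu> n"
  shows "(\<lambda>x. p x + c * q x) \<in> orth_polys \<mu> n"
proof -
  have s: "\<mu> - 1/2 > -1" using \<mu> by simp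
  have deg: "poly_deg_le n p" "poly_deg_le n q" using assms by (auto simp: orth_polys_def)
  have "ball_int (\<mu> - 1/2) (\<lambda>x. (p x + c * q x) * h x) = 0" if h: "m < n" "poly_deg_le m h" for m h
  proof -
    have "ball_int (\<mu> - 1/2) (\<lambda>x. (p x + c * q x) * h x) = ball_int (\<mu> - 1/2) (\<lambda>x. p x * h x + c * (q x * h x))"
      by (simp add: algebra_simps)
    also have "\<dots> = ball_int (\<mu> - 1/2) (\<lambda>x. p x * h x) + c * ball_int (\<mu> - 1/2) (\<lambda>x. q x * h x)"
      by (subst ball_int_add) (auto simp: ball_int_cmult intro!: ball_integrable_cmult
          poly_deg_le_ball_integrable[OF poly_deg_le_mult s] deg h(2))
    also have "\<dots> = 0" using assms(2,3) h by (auto simp: orth_polys_def weighted_integral_ball)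
    finally show ?thesis .
  qed
  then show ?thesis
    using deg by (auto simp: orth_polys_def weighted_integral_ball intro: poly_deg_le_add poly_deg_le_cmult)
qed

lemma ball_integrable_mult_L2:
  fixes f g :: "'a::euclidean_space \<Rightarrow> real"
  assumes [measurable]: "f \<in> borel_measurable borel" "g \<in> borel_measurable borel"
    and "ball_integrable s (\<lambda>x. (f x)\<^sup>2)" "ball_integrable s (\<lambda>x. (g x)\<^sup>2)"
  shows "ball_integrable s (\<lambda>x. f x * g x)"
proof -
  have "ball_integrable s (\<lambda>x. (f x)\<^sup>2 + (g x)\<^sup>2)" using assms by (intro ball_integrable_add)
  then have int: "integrable lborel (\<lambda>x. indicator (cball 0 1) x * (((f x)\<^sup>2 + (g x)\<^sup>2) * (1 - (norm x)\<^sup>2) powr s))"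
    unfolding ball_integrable_def .
  have [measurable]: "cball (0 :: 'a) 1 \<in> sets borel" by simp
  show ?thesis unfolding ball_integrable_def
  proof (rule Bochner_Integration.integrable_bound[OF int])
    show "(\<lambda>x. indicator (cball 0 1) x * (f x * g x * (1 - (norm x)\<^sup>2) powr s)) \<in> borel_measurable lborel"
      by measurable
    have "\<bar>f x * g x\<bar> \<le> (f x)\<^sup>2 + (g x)\<^sup>2" for x
    proof -
      have "0 \<le> (\<bar>f x\<bar> - \<bar>g x\<bar>)\<^sup>2" by simp
      then have "2 * \<bar>f x * g x\<bar> \<le> (f x)\<^sup>2 + (g x)\<^sup>2" by (simp add: power2_diff abs_mult)
      then show ?thesis using zero_le_power2[of "f x"] zero_le_power2[of "g x"] by linarith
    qed
    then show "AE x in lborel. norm (indicator (cball 0 1) x * (f x * g x * (1 - (norm x)\<^sup>2) powr s)) \<le>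
        norm (indicator (cball 0 1) x * (((f x)\<^sup>2 + (g x)\<^sup>2) * (1 - (norm x)\<^sup>2) powr s))"
      by (intro always_eventually allI) (auto simp: abs_mult indicator_def intro!: mult_right_mono)
  qed
qed

lemma weighted_L2_iff:
  "f \<in> weighted_L2 \<mu> \<longleftrightarrow> f \<in> borel_measurable borel \<and> ball_integrable (\<mu> - 1/2) (\<lambda>x. (f x)\<^sup>2)"
  by (simp add: weighted_L2_def set_integrable_def ball_integrable_def ball_weight_def)

lemma ball_integrable_L2_poly:
  fixes f :: "real ^ 'd \<Rightarrow> real"
  assumes \<mu>: "\<mu> \<ge> 0" and f: "f \<in> weighted_L2 \<mu>" and q: "poly_deg_le n q"
  shows "ball_integrable (\<mu> - 1/2) (\<lambda>x. f x * q x)"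
  using f poly_deg_le_ball_integrable[OF poly_deg_le_power[OF q, of 2], of "\<mu> - 1/2"] \<mu> poly_deg_le_measurable[OF q]
  by (intro ball_integrable_mult_L2) (auto simp: weighted_L2_iff)

text \<open>By induction over the kernel: for a product both sides factor into the same two
  integrals, and sums follow from linearity once all integrands are known to be integrable.\<close>

lemma sep_poly_integral:
  fixes f :: "real ^ 'd \<Rightarrow> real"
  assumes \<mu>: "\<mu> \<ge> 0" and f: "f \<in> weighted_L2 \<mu>" and h: "poly_deg_le m h" and K: "sep_poly n K"
  defines "I \<equiv> ball_int (\<mu> - 1/2)"
  shows "poly_deg_le n (\<lambda>x. I (\<lambda>y. f y * K x y))"
    and "poly_deg_le (n + m) (\<lambda>y. I (\<lambda>x. K x y * h x))"
    and "I (\<lambda>x. I (\<lambda>y. f y * K x y) * h x) = I (\<lambda>y. f y * I (\<lambda>x. K x y * h x))"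
proof -
  have s: "\<mu> - 1/2 > -1" using \<mu> by simp
  have Kx: "poly_deg_le n (\<lambda>x. K x y)" if "sep_poly n K" for K :: "real ^ 'd \<Rightarrow> real ^ 'd \<Rightarrow> real" and y
    using that
  proof (induction rule: sep_poly.induct)
    case (sep_poly_prod p q)
    then show ?case using poly_deg_le_cmult[of n p "q y"] by (simp add: mult.commute)
  qed (rule poly_deg_le_add)
  have intK: "ball_integrable (\<mu> - 1/2) (\<lambda>y. f y * K x y)"
    "ball_integrable (\<mu> - 1/2) (\<lambda>x. K x y * h x)" if "sep_poly n K" for K x y
    using that by (auto intro: ball_integrable_L2_poly[OF \<mu> f] sep_poly_right
        poly_deg_le_ball_integrable[OF poly_deg_le_mult[OF Kx h] s])
  have "poly_deg_le n (\<lambda>x. I (\<lambda>y. f y * K x y)) \<and> poly_deg_le (n + m) (\<lambda>y. I (\<lambda>x. K x y * h x)) \<and>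
    I (\<lambda>x. I (\<lambda>y. f y * K x y) * h x) = I (\<lambda>y. f y * I (\<lambda>x. K x y * h x))"
    using K
  proof (induction rule: sep_poly.induct)
    case (sep_poly_prod p q)
    have 1: "I (\<lambda>y. f y * (p x * q y)) = I (\<lambda>y. f y * q y) * p x" for x
      unfolding I_def by (subst (2) mult.commute, subst ball_int_cmult[symmetric]) (simp add: mult_ac)
    have 2: "I (\<lambda>x. p x * q y * h x) = I (\<lambda>x. p x * h x) * q y" for y
      unfolding I_def by (subst (4) mult.commute, subst ball_int_cmult[symmetric]) (simp add: mult_ac)
    have "I (\<lambda>x. I (\<lambda>y. f y * q y) * p x * h x) = I (\<lambda>y. f y * q y) * I (\<lambda>x. p x * h x)"
      unfolding I_def by (subst ball_int_cmult[symmetric]) (simp add: mult_ac)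
    moreover have "I (\<lambda>y. f y * (I (\<lambda>x. p x * h x) * q y)) = I (\<lambda>x. p x * h x) * I (\<lambda>y. f y * q y)"
      unfolding I_def by (subst ball_int_cmult[symmetric]) (simp add: mult_ac)
    moreover have "poly_deg_le (n + m) q" using sep_poly_prod by (rule_tac poly_deg_le_mono) auto
    ultimately show ?case
      unfolding 1 2 using sep_poly_prod by (auto intro: poly_deg_le_cmult)
  next
    case (sep_poly_add K L)
    have 1: "I (\<lambda>y. f y * (K x y + L x y)) = I (\<lambda>y. f y * K x y) + I (\<lambda>y. f y * L x y)" for x
      unfolding I_def distrib_left using sep_poly_add.hyps by (intro ball_int_add intK)
    have 2: "I (\<lambda>x. (K x y + L x y) * h x) = I (\<lambda>x. K x y * h x) + I (\<lambda>x. L x y * h x)" for y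
      unfolding I_def distrib_right using sep_poly_add.hyps by (intro ball_int_add intK)
    have "I (\<lambda>x. I (\<lambda>y. f y * K x y) * h x + I (\<lambda>y. f y * L x y) * h x) =
        I (\<lambda>x. I (\<lambda>y. f y * K x y) * h x) + I (\<lambda>x. I (\<lambda>y. f y * L x y) * h x)"
      unfolding I_def using sep_poly_add.IH[unfolded I_def]
      by (intro ball_int_add poly_deg_le_ball_integrable[OF poly_deg_le_mult[OF _ h] s]) auto
    moreover have "I (\<lambda>y. f y * I (\<lambda>x. K x y * h x) + f y * I (\<lambda>x. L x y * h x)) =
        I (\<lambda>y. f y * I (\<lambda>x. K x y * h x)) + I (\<lambda>y. f y * I (\<lambda>x. L x y * h x))"
      unfolding I_def using sep_poly_add.IH[unfolded I_def]
      by (intro ball_int_add ball_integrable_L2_poly[OF \<mu> f]) auto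
    ultimately show ?case
      unfolding 1 2 using sep_poly_add.IH by (auto intro: poly_deg_le_add simp: distrib_left distrib_right)
  qed
  then show "poly_deg_le n (\<lambda>x. I (\<lambda>y. f y * K x y))" "poly_deg_le (n + m) (\<lambda>y. I (\<lambda>x. K x y * h x))"
    "I (\<lambda>x. I (\<lambda>y. f y * K x y) * h x) = I (\<lambda>y. f y * I (\<lambda>x. K x y * h x))"
    by auto
qed

text \<open>The one-variable orthogonality and reproducing property of \<open>zonal l n\<close>
  transferred to the ball. The parameter \<open>l\<close> is chosen so that l + 1/2 = \<mu> + d / 2,
  and at least two dimensions make it positive even for \<mu> = 0.\<close>

lemma trans_poly_zonal_integrals:
  fixes x :: "real ^ 'd"
  assumes \<mu>: "\<mu> \<ge> 0" and d: "CARD('d) > 1" and x: "norm x \<le> 1"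
  defines "l \<equiv> \<mu> + (CARD('d) - 1) / 2" and "\<omega> \<equiv> ball_int (\<mu> - 1/2) (\<lambda>_ :: real ^ 'd. 1)"
  shows "m < n \<Longrightarrow> poly_deg_le m h \<Longrightarrow> ball_int (\<mu> - 1/2) (\<lambda>y. trans_poly \<mu> (zonal l n) x y * h y) = 0"
    and "q \<in> orth_polys \<mu> n \<Longrightarrow> ball_int (\<mu> - 1/2) (\<lambda>y. trans_poly \<mu> (zonal l n) x y * q y) = \<omega> * q x"
proof -
  have l: "l > 0" using \<mu> d by (auto simp: l_def intro: add_nonneg_pos)
  have \<nu>: "\<mu> + CARD('d) / 2 = l + 1/2" using d by (simp add: l_def of_nat_diff diff_divide_distrib)
  have \<omega>: "\<omega> > 0" unfolding \<omega>_def by (rule ball_int_one_pos) (use \<mu> in auto)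
  show "ball_int (\<mu> - 1/2) (\<lambda>y. trans_poly \<mu> (zonal l n) x y * h y) = 0" if m: "m < n" and h: "poly_deg_le m h"
  proof -
    obtain p where p: "degree p \<le> m" "\<And>g. ball_int (\<mu> - 1/2) (\<lambda>y. trans_poly \<mu> g x y * h y) = \<omega> * mfun (l + 1/2) (g * p)"
      using trans_poly_reproducing[OF \<mu> x h] unfolding \<nu> \<omega>_def by blast
    show ?thesis unfolding p(2) using mfun_zonal_lower[OF l, of p n] p(1) m by simp
  qed
  show "ball_int (\<mu> - 1/2) (\<lambda>y. trans_poly \<mu> (zonal l n) x y * q y) = \<omega> * q x" if q: "q \<in> orth_polys \<mu> n"
  proof -
    have deg: "poly_deg_le n q" using q by (simp add: orth_polys_def)
    obtain p where p: "degree p \<le> n" "poly p 1 = q x"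
      "\<And>g. ball_int (\<mu> - 1/2) (\<lambda>y. trans_poly \<mu> g x y * q y) = \<omega> * mfun (l + 1/2) (g * p)"
      using trans_poly_reproducing[OF \<mu> x deg] unfolding \<nu> \<omega>_def by blast
    \<comment> \<open>The kernel \<open>trans_poly \<mu> g x\<close> is itself a polynomial of
      degree below \<open>n\<close> in its second argument, hence orthogonal to \<open>q\<close>;
      this says that \<open>p\<close> is orthogonal to \<open>g\<close>.\<close>
    have "mfun (l + 1/2) (g * p) = 0" if "degree g < n" for g
    proof -
      have "poly_deg_le (degree g) (trans_poly \<mu> g x)" by (rule sep_poly_right[OF sep_poly_trans_poly]) simp
      then have "ball_int (\<mu> - 1/2) (\<lambda>y. q y * trans_poly \<mu> g x y) = 0"
        using q that by (auto simp: orth_polys_def weighted_integral_ball)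
      then show ?thesis using p(3)[of g] \<omega> by (simp add: mult.commute)
    qed
    then show ?thesis unfolding p(3) using mfun_zonal_reproducing[OF l p(1)] p(2) by simp
  qed
qed

lemma ball_int_cong_ball:
  "(\<And>y. norm y \<le> 1 \<Longrightarrow> f y = g y) \<Longrightarrow> ball_int s f = ball_int s g"
  by (rule ball_int_cong) simp

text \<open>After exchanging the integrals the kernel acts on the test polynomial: it annihilates
  lower degrees, so the image lies in \<open>orth_polys \<mu> n\<close>, and it reproduces
  \<open>orth_polys \<mu> n\<close>, so the remainder is orthogonal to that space.\<close>

lemma is_projection_kernel_zonal:
  fixes \<mu> :: real
  assumes \<mu>: "\<mu> \<ge> 0" and d: "CARD('d::finite) > 1"
  defines "l \<equiv> \<mu> + (CARD('d) - 1) / 2"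
  shows "is_projection_kernel \<mu> n (trans_poly \<mu> (zonal l n) :: real ^ 'd \<Rightarrow> real ^ 'd \<Rightarrow> real)"
proof -
  define K :: "real ^ 'd \<Rightarrow> real ^ 'd \<Rightarrow> real" where "K = trans_poly \<mu> (zonal l n)"
  define I :: "(real ^ 'd \<Rightarrow> real) \<Rightarrow> real" where "I = ball_int (\<mu> - 1/2)"
  define \<omega> where "\<omega> = I (\<lambda>_ :: real ^ 'd. 1)"
  have s: "\<mu> - 1/2 > -1" using \<mu> by simp
  have \<omega>: "\<omega> > 0" unfolding \<omega>_def I_def by (rule ball_int_one_pos) (use \<mu> in auto)
  have sepK: "sep_poly n K" unfolding K_def by (intro sep_poly_trans_poly zonal_degree_le)
  have Kcomm: "K x y = K y x" for x y unfolding K_def by (rule trans_poly_commute)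
  have "is_orth_projection \<mu> n f (\<lambda>x. ball_const TYPE('d) \<mu> * weighted_integral \<mu> (cball 0 1) (\<lambda>y. f y * K x y))"
    if f: "f \<in> weighted_L2 \<mu>" for f
  proof -
    define g where "g x = I (\<lambda>y. f y * K x y) / \<omega>" for x
    have degg: "poly_deg_le n g"
      using poly_deg_le_cmult[OF sep_poly_integral(1)[OF \<mu> f poly_deg_le_const[of 0 0] sepK], where a = "1 / \<omega>"]
      by (simp add: g_def[abs_def] I_def)
    have gint: "I (\<lambda>x. g x * h x) = I (\<lambda>y. f y * I (\<lambda>x. K y x * h x)) / \<omega>" if "poly_deg_le m h" for m h
    proof -
      have "I (\<lambda>x. g x * h x) = I (\<lambda>x. (1 / \<omega>) * (I (\<lambda>y. f y * K x y) * h x))" by (simp add: g_def)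
      also have "\<dots> = (1 / \<omega>) * I (\<lambda>x. I (\<lambda>y. f y * K x y) * h x)" unfolding I_def by (rule ball_int_cmult)
      also have "I (\<lambda>x. I (\<lambda>y. f y * K x y) * h x) = I (\<lambda>y. f y * I (\<lambda>x. K x y * h x))"
        unfolding I_def by (rule sep_poly_integral(3)[OF \<mu> f that sepK])
      finally show ?thesis by (simp add: Kcomm)
    qed
    have "I (\<lambda>x. g x * h x) = 0" if "m < n" "poly_deg_le m h" for m h
    proof -
      have "I (\<lambda>y. f y * I (\<lambda>x. K y x * h x)) = I (\<lambda>y. 0)"
        unfolding I_def
      proof (rule ball_int_cong_ball)
        fix y :: "real ^ 'd" assume "norm y \<le> 1"
        then show "f y * ball_int (\<mu> - 1/2) (\<lambda>x. K y x * h x) = 0"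
          using trans_poly_zonal_integrals(1)[OF \<mu> d _ that, of y] by (simp add: K_def l_def)
      qed
      then show ?thesis unfolding gint[OF that(2)] by (simp add: I_def)
    qed
    then have "g \<in> orth_polys \<mu> n" using degg by (auto simp: orth_polys_def weighted_integral_ball I_def)
    moreover have "I (\<lambda>x. (f x - g x) * q x) = 0" if q: "q \<in> orth_polys \<mu> n" for q
    proof -
      have degq: "poly_deg_le n q" using q by (simp add: orth_polys_def)
      have "I (\<lambda>y. f y * I (\<lambda>x. K y x * q x)) = I (\<lambda>y. \<omega> * (f y * q y))"
        unfolding I_def
      proof (rule ball_int_cong_ball)
        fix y :: "real ^ 'd" assume "norm y \<le> 1"
        then show "f y * ball_int (\<mu> - 1/2) (\<lambda>x. K y x * q x) = \<omega> * (f y * q y)"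
          using trans_poly_zonal_integrals(2)[OF \<mu> d _ q, of y] by (simp add: K_def l_def \<omega>_def I_def)
      qed
      then have "I (\<lambda>x. g x * q x) = I (\<lambda>x. f x * q x)"
        unfolding gint[OF degq] using \<omega> by (simp add: I_def ball_int_cmult)
      moreover have "I (\<lambda>x. (f x - g x) * q x) = I (\<lambda>x. f x * q x + (-1) * (g x * q x))"
        by (simp add: left_diff_distrib)
      moreover have "\<dots> = I (\<lambda>x. f x * q x) + (-1) * I (\<lambda>x. g x * q x)"
        unfolding I_def
        by (subst ball_int_add, rule ball_integrable_L2_poly[OF \<mu> f degq],
            intro ball_integrable_cmult poly_deg_le_ball_integrable[OF poly_deg_le_mult[OF degg degq] s],
            simp only: ball_int_cmult)
      ultimately show ?thesis by simp
    qed
    ultimately have "is_orth_projection \<mu> n f g" by (simp add: is_orth_projection_def weighted_integral_ball I_def)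
    moreover have "g = (\<lambda>x. ball_const TYPE('d) \<mu> * weighted_integral \<mu> (cball 0 1) (\<lambda>y. f y * K x y))"
      by (auto simp: g_def ball_const_eq weighted_integral_ball \<omega>_def I_def field_simps)
    ultimately show ?thesis by simp
  qed
  then show ?thesis
    unfolding is_projection_kernel_def K_def[symmetric] using sep_poly_real_polynomial[OF sepK] by blast
qed

section \<open>Uniqueness of the projection kernel\<close>

lemma ball_int_square_zero:
  fixes f :: "'a::euclidean_space \<Rightarrow> real"
  assumes cont: "continuous_on UNIV f" and int: "ball_integrable s (\<lambda>x. (f x)\<^sup>2)"
    and zero: "ball_int s (\<lambda>x. (f x)\<^sup>2) = 0" and x: "norm x < 1"
  shows "f x = 0"
proof (rule ccontr)
  assume "f x \<noteq> 0"
  have [measurable]: "f \<in> borel_measurable borel" using cont by (rule borel_measurable_continuous_onI)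
  have "AE y in lborel. indicator (cball 0 1) y * ((f y)\<^sup>2 * (1 - (norm y)\<^sup>2) powr s) = 0"
    using zero int unfolding ball_int_def ball_integrable_def
    by (subst (asm) integral_nonneg_eq_0_iff_AE) auto
  then have "AE y in lborel. y \<notin> {y. f y \<noteq> 0} \<inter> ball 0 1"
  proof eventually_elim
    case (elim y)
    have "(norm y)\<^sup>2 \<noteq> 1" if "norm y < 1" using that abs_square_less_1[of "norm y"] by auto
    then show ?case using elim by auto
  qed
  moreover have "open ({y. f y \<noteq> 0} \<inter> ball 0 1)"
    using cont by (intro open_Int open_Collect_neq) auto
  moreover have "x \<in> {y. f y \<noteq> 0} \<inter> ball 0 1" using \<open>f x \<noteq> 0\<close> x by simp
  moreover have "{y. f y \<noteq> 0} \<inter> ball 0 1 \<in> sets lborel" by measurable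
  ultimately have "{y. f y \<noteq> 0} \<inter> ball 0 1 \<in> null_sets lborel" "open ({y. f y \<noteq> 0} \<inter> ball 0 1)"
      "{y. f y \<noteq> 0} \<inter> ball 0 1 \<noteq> {}"
    using AE_iff_null_sets by blast+
  then show False
    using open_not_negligible[of "{y. f y \<noteq> 0} \<inter> ball 0 1"] null_sets_completionI[of _ lborel]
    by (auto simp: negligible_iff_null_sets)
qed

text \<open>On each line through 0 the polynomial has infinitely many small roots. Integrals see
  kernels only inside the ball, while the definite description in \<open>proj_kernel\<close>
  compares functions on the whole space.\<close>

lemma real_polynomial_zero_near_0:
  fixes p :: "'a::euclidean_space \<Rightarrow> real"
  assumes p: "real_polynomial_function p" and "e > 0" and zero: "\<And>z. norm z < e \<Longrightarrow> p z = 0"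
  shows "p z = 0"
proof -
  have "real_polynomial_function (p \<circ> (\<lambda>r :: real. r *\<^sub>R z))"
    by (intro real_polynomial_function_compose p polynomial_function_bounded_linear bounded_linear_scaleR_left)
  then obtain a n where an: "(p \<circ> (\<lambda>r. r *\<^sub>R z)) = (\<lambda>r. \<Sum>i\<le>n. a i * r ^ i)"
    unfolding real_polynomial_function_iff_sum by blast
  have "infinite {r. (\<Sum>i\<le>n. a i * r ^ i) = 0}"
  proof
    assume fin: "finite {r. (\<Sum>i\<le>n. a i * r ^ i) = 0}"
    define \<delta> where "\<delta> = e / (norm z + 1)"
    have \<delta>: "\<delta> > 0" using \<open>e > 0\<close> by (simp add: \<delta>_def add_nonneg_pos)
    have "{0<..<\<delta>} \<subseteq> {r. (\<Sum>i\<le>n. a i * r ^ i) = 0}"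
    proof
      fix r assume r: "r \<in> {0<..<\<delta>}"
      have "norm (r *\<^sub>R z) \<le> r * (norm z + 1)" using r by (simp add: algebra_simps)
      also have "\<dots> < e" using r by (simp add: \<delta>_def pos_less_divide_eq add_nonneg_pos)
      finally have "(p \<circ> (\<lambda>r. r *\<^sub>R z)) r = 0" using zero by simp
      then show "r \<in> {r. (\<Sum>i\<le>n. a i * r ^ i) = 0}" unfolding an by simp
    qed
    then show False using fin infinite_Ioo[OF \<delta>] finite_subset by blast
  qed
  then have "(\<Sum>i\<le>n. a i * 1 ^ i) = 0"
    using polyfun_finite_roots[of a n] polyfun_eq_0[of a n] by auto
  then show ?thesis using fun_cong[OF an, of 1] by simp
qed

text \<open>The difference of two projections of \<open>f\<close> lies in
  \<open>orth_polys \<mu> n\<close> and is orthogonal to that space, hence to itself.\<close>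

lemma is_orth_projection_unique:
  fixes g g' :: "real ^ 'd \<Rightarrow> real"
  assumes \<mu>: "\<mu> \<ge> 0" and f: "f \<in> weighted_L2 \<mu>"
    and g: "is_orth_projection \<mu> n f g" "is_orth_projection \<mu> n f g'" and x: "norm x < 1"
  shows "g x = g' x"
proof -
  have s: "\<mu> - 1/2 > -1" using \<mu> by simp
  have deg: "poly_deg_le n g" "poly_deg_le n g'" using g by (auto simp: is_orth_projection_def orth_polys_def)
  define h where "h x = g x + (-1) * g' x" for x
  have h: "h \<in> orth_polys \<mu> n"
    unfolding h_def using orth_polys_add_cmult[OF \<mu>, of g n g' "-1"] g by (auto simp: is_orth_projection_def)
  then have degh: "poly_deg_le n h" by (simp add: orth_polys_def)
  have int: "ball_integrable (\<mu> - 1/2) (\<lambda>x. (f x - G x) * h x)" if "poly_deg_le n G" for G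
  proof -
    have "ball_integrable (\<mu> - 1/2) (\<lambda>x. f x * h x + (-1) * (G x * h x))"
      by (intro ball_integrable_add ball_integrable_cmult ball_integrable_L2_poly[OF \<mu> f degh]
          poly_deg_le_ball_integrable[OF poly_deg_le_mult[OF that degh] s])
    then show ?thesis by (simp add: left_diff_distrib)
  qed
  have "ball_int (\<mu> - 1/2) (\<lambda>x. (h x)\<^sup>2) =
      ball_int (\<mu> - 1/2) (\<lambda>x. (f x - g' x) * h x + (-1) * ((f x - g x) * h x))"
    by (simp add: h_def power2_eq_square algebra_simps)
  also have "\<dots> = ball_int (\<mu> - 1/2) (\<lambda>x. (f x - g' x) * h x) + (-1) * ball_int (\<mu> - 1/2) (\<lambda>x. (f x - g x) * h x)"
    by (subst ball_int_add, intro int deg, intro ball_integrable_cmult int deg, simp only: ball_int_cmult)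
  also have "\<dots> = 0" using g h by (auto simp: is_orth_projection_def weighted_integral_ball)
  finally have zero: "ball_int (\<mu> - 1/2) (\<lambda>x. (h x)\<^sup>2) = 0" .
  have "ball_integrable (\<mu> - 1/2) (\<lambda>x. (h x)\<^sup>2)"
    by (rule poly_deg_le_ball_integrable[OF poly_deg_le_power[OF degh] s])
  from ball_int_square_zero[OF poly_deg_le_continuous[OF degh] this zero x] have "h x = 0" .
  then show ?thesis by (simp add: h_def)
qed

text \<open>Two projection kernels send every \<open>f\<close> to the same function inside the ball.
  Applying both to their own difference, for a fixed first argument, shows that this difference has
  zero norm.\<close>

lemma proj_kernel_eq:
  assumes \<mu>: "\<mu> \<ge> 0" and d: "CARD('d::finite) > 1"
  shows "proj_kernel \<mu> n = (trans_poly \<mu> (zonal (\<mu> + (CARD('d) - 1) / 2) n) :: real ^ 'd \<Rightarrow> real ^ 'd \<Rightarrow> real)"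
  unfolding proj_kernel_def
proof (rule the_equality)
  define K where "K = (trans_poly \<mu> (zonal (\<mu> + (CARD('d) - 1) / 2) n) :: real ^ 'd \<Rightarrow> real ^ 'd \<Rightarrow> real)"
  show kerK: "is_projection_kernel \<mu> n (trans_poly \<mu> (zonal (\<mu> + (CARD('d) - 1) / 2) n) :: real ^ 'd \<Rightarrow> real ^ 'd \<Rightarrow> real)"
    by (rule is_projection_kernel_zonal[OF \<mu> d])
  have s: "\<mu> - 1/2 > -1" using \<mu> by simp
  fix L :: "real ^ 'd \<Rightarrow> real ^ 'd \<Rightarrow> real"
  assume L: "is_projection_kernel \<mu> n L"
  have polyK: "real_polynomial_function (\<lambda>(x, y). K x y)" and polyL: "real_polynomial_function (\<lambda>(x, y). L x y)"
    using kerK L by (auto simp: is_projection_kernel_def K_def)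
  define D where "D = (\<lambda>(x, y). L x y - K x y)"
  have polyD: "real_polynomial_function D"
    using real_polynomial_function_diff[OF polyL polyK] by (simp add: D_def case_prod_beta')
  have contx: "continuous_on UNIV (\<lambda>y. F (x, y))" if "real_polynomial_function F" for F :: "(real ^ 'd) \<times> (real ^ 'd) \<Rightarrow> real" and x
  proof -
    have "continuous_on UNIV F"
      using that by (auto intro!: continuous_at_imp_continuous_on continuous_real_polymonial_function)
    then show ?thesis by (rule continuous_on_compose2) (auto intro!: continuous_intros)
  qed
  have bnd_int: "ball_integrable (\<mu> - 1/2) G" if cont: "continuous_on UNIV G" for G :: "real ^ 'd \<Rightarrow> real"
  proof -
    obtain B where B: "\<And>y. y \<in> cball 0 1 \<Longrightarrow> norm (G y) \<le> B"
      using compact_continuous_image[OF continuous_on_subset[OF cont], of "cball 0 1"]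
      by (fastforce simp: compact_eq_bounded_closed bounded_iff)
    have [measurable]: "G \<in> borel_measurable borel" using cont by (rule borel_measurable_continuous_onI)
    have [measurable]: "cball (0 :: real ^ 'd) 1 \<in> sets borel" by simp
    have "ball_integrable (\<mu> - 1/2) (\<lambda>_ :: real ^ 'd. B)" by (rule poly_deg_le_ball_integrable[OF poly_deg_le_const s])
    then show ?thesis
      unfolding ball_integrable_def
    proof (rule Bochner_Integration.integrable_bound)
      show "AE y in lborel. norm (indicator (cball 0 1) y * (G y * (1 - (norm y)\<^sup>2) powr (\<mu> - 1/2))) \<le>
          norm (indicator (cball 0 1) y * (B * (1 - (norm y)\<^sup>2) powr (\<mu> - 1/2)))"
        using B by (intro always_eventually allI) (fastforce simp: abs_mult indicator_def intro!: mult_right_mono)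
    qed measurable
  qed
  have zero: "D (x, y) = 0" if x: "norm x < 1" and y: "norm y < 1" for x y
  proof -
    \<comment> \<open>The difference of the kernels at the fixed \<open>x\<close> serves as the
      function to be projected, so that the two projections at \<open>x\<close> differ by its own
      squared norm, up to the factor \<open>b\<close>.\<close>
    define f where "f y = D (x, y)" for y
    have contf: "continuous_on UNIV f" unfolding f_def by (rule contx[OF polyD])
    have f2: "ball_integrable (\<mu> - 1/2) (\<lambda>y. (f y)\<^sup>2)" by (intro bnd_int continuous_intros contf)
    have f: "f \<in> weighted_L2 \<mu>"
      unfolding weighted_L2_iff using f2 contf by (auto intro: borel_measurable_continuous_onI)
    define b where "b = ball_const TYPE('d) \<mu>"
    have b: "b > 0" unfolding b_def ball_const_eq using ball_int_one_pos[OF s] by simp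
    have "is_orth_projection \<mu> n f (\<lambda>x. b * ball_int (\<mu> - 1/2) (\<lambda>y. f y * L x y))"
        "is_orth_projection \<mu> n f (\<lambda>x. b * ball_int (\<mu> - 1/2) (\<lambda>y. f y * K x y))"
      using kerK L f by (auto simp: is_projection_kernel_def weighted_integral_ball b_def K_def)
    from is_orth_projection_unique[OF \<mu> f this x]
    have "b * ball_int (\<mu> - 1/2) (\<lambda>y. f y * L x y) = b * ball_int (\<mu> - 1/2) (\<lambda>y. f y * K x y)" .
    then have eq: "ball_int (\<mu> - 1/2) (\<lambda>y. f y * L x y) = ball_int (\<mu> - 1/2) (\<lambda>y. f y * K x y)" using b by simp
    have contL: "continuous_on UNIV (L x)" and contK: "continuous_on UNIV (K x)"
      using contx[OF polyL] contx[OF polyK] by simp_all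
    have "ball_int (\<mu> - 1/2) (\<lambda>y. (f y)\<^sup>2) = ball_int (\<mu> - 1/2) (\<lambda>y. f y * L x y + (-1) * (f y * K x y))"
      by (simp add: f_def D_def power2_eq_square algebra_simps)
    also have "\<dots> = ball_int (\<mu> - 1/2) (\<lambda>y. f y * L x y) + (-1) * ball_int (\<mu> - 1/2) (\<lambda>y. f y * K x y)"
      by (subst ball_int_add, intro bnd_int continuous_intros contf contL,
          intro bnd_int continuous_intros contf contK, simp only: ball_int_cmult)
    also have "\<dots> = 0" using eq by simp
    finally have "f y = 0" by (rule ball_int_square_zero[OF contf f2 _ y])
    then show ?thesis by (simp add: f_def)
  qed
  have "D z = 0" for z
  proof (rule real_polynomial_zero_near_0[OF polyD zero_less_one])
    fix z :: "(real ^ 'd) \<times> (real ^ 'd)" assume "norm z < 1"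
    then have "norm (fst z) < 1" "norm (snd z) < 1"
      using norm_fst_le[of "fst z" "snd z"] norm_snd_le[of "snd z" "fst z"] by auto
    then show "D z = 0" using zero[of "fst z" "snd z"] by simp
  qed
  note D0 = this
  have "L x y = K x y" for x y using D0[of "(x, y)"] by (simp add: D_def)
  then show "L = trans_poly \<mu> (zonal (\<mu> + (CARD('d) - 1) / 2) n)" by (auto simp: K_def)
qed

section \<open>Estimates on the ball\<close>

text \<open>The half-angle formula reduces this to sin x \<ge> x / 2 on \<open>{0..8/5}\<close>, an
  interval containing pi / 2; there the cubic Taylor remainder is at most x / 2.\<close>

lemma one_minus_cos_ge:
  assumes "0 \<le> \<theta>" "\<theta> \<le> pi"
  shows "\<theta>\<^sup>2 / 8 \<le> 1 - cos \<theta>"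
proof -
  define x where "x = \<theta> / 2"
  have x: "0 \<le> x" "x \<le> 8/5" using assms pi_less_4 pi_approx by (auto simp: x_def)
  have "(\<Sum>m<3. sin_coeff m * x ^ m) = x" by (simp add: sin_coeff_def numeral_eq_Suc)
  then have "\<bar>sin x - x\<bar> \<le> x ^ 3 / 6"
    using Maclaurin_sin_bound[of x 3] x by (simp add: fact_numeral field_simps)
  moreover have "x ^ 3 / 6 \<le> x / 2"
  proof -
    have "x * x \<le> 8/5 * (8/5)" using x by (intro mult_mono) auto
    then have "x * (x * x) \<le> x * 3" using x by (intro mult_left_mono) auto
    then show ?thesis by (simp add: power3_eq_cube mult.assoc)
  qed
  ultimately have "x / 2 \<le> sin x" by linarith
  then have "(x / 2)\<^sup>2 \<le> (sin x)\<^sup>2" using x by (intro power_mono) auto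
  moreover have "cos \<theta> = 1 - 2 * (sin x)\<^sup>2" using cos_double_sin[of x] by (simp add: x_def)
  ultimately show ?thesis by (simp add: x_def power2_eq_square)
qed

lemma one_minus_cos_le: "1 - cos \<theta> \<le> \<theta>\<^sup>2 / 2" for \<theta> :: real
proof -
  have "\<bar>sin (\<theta> / 2)\<bar>\<^sup>2 \<le> \<bar>\<theta> / 2\<bar>\<^sup>2" by (intro power_mono abs_sin_x_le_abs_x) auto
  moreover have "cos \<theta> = 1 - 2 * (sin (\<theta> / 2))\<^sup>2" using cos_double_sin[of "\<theta> / 2"] by simp
  ultimately show ?thesis by (simp add: power2_eq_square)
qed

definition height :: "real ^ 'd \<Rightarrow> real" where
  "height x = sqrt (1 - (norm x)\<^sup>2)"

lemma height_nonneg: "norm x \<le> 1 \<Longrightarrow> height x \<ge> 0"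
  and height_square: "norm x \<le> 1 \<Longrightarrow> (height x)\<^sup>2 = 1 - (norm x)\<^sup>2"
  and height_le_1: "norm x \<le> 1 \<Longrightarrow> height x \<le> 1"
  by (auto simp: height_def abs_square_le_1)

lemma inner_height_abs_le:
  fixes x y :: "real ^ 'd"
  assumes "norm x \<le> 1" "norm y \<le> 1" "\<bar>u\<bar> \<le> 1"
  shows "\<bar>x \<bullet> y + u * (height x * height y)\<bar> \<le> 1"
proof -
  have "\<bar>x \<bullet> y + u * (height x * height y)\<bar> \<le> norm x * norm y + 1 * (height x * height y)"
    using assms by (intro order.trans[OF abs_triangle_ineq] add_mono Cauchy_Schwarz_ineq2)
      (auto simp: abs_mult height_nonneg intro!: mult_left_le_one_le mult_nonneg_nonneg)
  also have "\<dots> \<le> ((norm x)\<^sup>2 + (norm y)\<^sup>2) / 2 + ((height x)\<^sup>2 + (height y)\<^sup>2) / 2"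
  proof -
    have "a * b \<le> (a\<^sup>2 + b\<^sup>2) / 2" for a b :: real using sum_squares_bound[of a b] by (simp add: mult.assoc)
    then show ?thesis by (simp only: mult_1_left) (intro add_mono)
  qed
  also have "\<dots> = 1" using assms by (simp add: height_square field_simps)
  finally show ?thesis .
qed

text \<open>\<open>ball_dist\<close> is the angle between the lifted points (x, height x) and (y,
  height y). The difference of heights is at most the chord, and the chord at most the arc.\<close>

lemma ball_dist_props:
  fixes x y :: "real ^ 'd"
  assumes "norm x \<le> 1" "norm y \<le> 1"
  shows "cos (ball_dist x y) = x \<bullet> y + height x * height y" "0 \<le> ball_dist x y" "ball_dist x y \<le> pi"
    and "\<bar>height x - height y\<bar> \<le> ball_dist x y"
proof -
  have b: "\<bar>x \<bullet> y + height x * height y\<bar> \<le> 1" using inner_height_abs_le[OF assms, of 1] by simp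
  then show c: "cos (ball_dist x y) = x \<bullet> y + height x * height y" and D: "0 \<le> ball_dist x y" "ball_dist x y \<le> pi"
    unfolding ball_dist_def height_def[symmetric] by (auto simp: abs_le_iff intro: arccos_lbound arccos_ubound cos_arccos)
  have "(height x - height y)\<^sup>2 \<le> (height x - height y)\<^sup>2 + (norm (x - y))\<^sup>2" by simp
  also have "\<dots> = 2 * (1 - cos (ball_dist x y))"
    using assms by (simp add: c power2_diff height_square power2_norm_eq_inner inner_diff_left inner_diff_right inner_commute algebra_simps)
  also have "\<dots> \<le> (ball_dist x y)\<^sup>2" using one_minus_cos_le[of "ball_dist x y"] by simp
  finally show "\<bar>height x - height y\<bar> \<le> ball_dist x y" using D(1) by (simp flip: abs_le_square_iff)
qed

lemma trans_poly_eq_height: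
  assumes "norm x \<le> 1" "norm y \<le> 1"
  shows "trans_poly \<mu> g x y = mfun \<mu> (pcompose g [:x \<bullet> y, height x * height y:])"
  unfolding height_def by (rule trans_poly_eq_mfun[OF assms])

text \<open>If a \<le> b, replacing b by a + D costs a factor 1 + N D, and (1 + N a)^2 \<le> 2 (1 +
  N^2 a b). This separates the joint factor produced by averaging into one factor for each
  point.\<close>

lemma height_product_le:
  fixes N a b D :: real
  assumes "N \<ge> 0" "a \<ge> 0" "b \<ge> 0" "\<bar>a - b\<bar> \<le> D"
  shows "(1 + N * a) * (1 + N * b) \<le> 2 * (1 + N\<^sup>2 * (a * b)) * (1 + N * D)"
proof -
  have *: "(1 + N * a) * (1 + N * b) \<le> 2 * (1 + N\<^sup>2 * (a * b)) * (1 + N * D)"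
    if "a \<le> b" "a \<ge> 0" "b - a \<le> D" for a b
  proof -
    have "N * b \<le> N * (a + D)" using that assms(1) by (intro mult_left_mono) auto
    then have "(1 + N * a) * (1 + N * b) \<le> (1 + N * a) * (1 + N * a + N * D)"
      using that assms(1) by (intro mult_left_mono) (auto simp: distrib_left)
    also have "\<dots> \<le> (1 + N * a) * ((1 + N * a) * (1 + N * D))"
      using that assms(1) by (intro mult_left_mono) (auto simp: algebra_simps)
    also have "\<dots> = (1 + N * a)\<^sup>2 * (1 + N * D)" by (simp add: power2_eq_square)
    also have "\<dots> \<le> (2 * (1 + N\<^sup>2 * (a * b))) * (1 + N * D)"
    proof (intro mult_right_mono)
      have "(1 + N * a)\<^sup>2 \<le> 2 * (1 + (N * a)\<^sup>2)" using sum_squares_bound[of 1 "N * a"] by (simp add: power2_sum)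
      moreover have "N\<^sup>2 * (a * a) \<le> N\<^sup>2 * (a * b)" using that by (intro mult_left_mono) auto
      ultimately show "(1 + N * a)\<^sup>2 \<le> 2 * (1 + N\<^sup>2 * (a * b))" by (simp add: power_mult_distrib power2_eq_square mult_ac)
    qed (use that assms(1) in auto)
    finally show ?thesis .
  qed
  show ?thesis
  proof (cases "a \<le> b")
    case True
    then show ?thesis using *[of a b] assms by auto
  next
    case False
    then show ?thesis using *[of b a] assms by (simp add: mult.commute)
  qed
qed

lemma local_weight_sqrt:
  fixes x :: "real ^ 'd"
  assumes "N > 0" "norm x \<le> 1"
  shows "sqrt (local_weight \<mu> N x) = (1 + N * height x) powr \<mu> / N powr \<mu>"
proof -
  have h: "height x + 1 / N = (1 + N * height x) / N" using assms by (simp add: field_simps)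
  have p: "(1 + N * height x) / N > 0" using assms height_nonneg[of x] by (intro divide_pos_pos add_pos_nonneg) auto
  have "local_weight \<mu> N x = (((1 + N * height x) / N) powr \<mu>)\<^sup>2"
    unfolding local_weight_def height_def[symmetric] h using p by (simp add: powr_powr mult.commute flip: powr_numeral)
  then show ?thesis using assms height_nonneg[of x] by (simp add: powr_divide)
qed

text \<open>The argument t of the zonal sum satisfies N^2 (1 - t) = P + Q, with \<open>P\<close>
  determined by the distance and \<open>Q\<close> by 1 - u. The decay is shared between them: the
  power of 1 + P is constant in \<open>u\<close> and gives localization, the power of 1 + Q is
  consumed by \<open>mfun_decay\<close>.\<close>

lemma localized_kernel_bound:
  fixes \<mu> :: real
  assumes \<mu>: "\<mu> \<ge> 0" and d: "CARD('d::finite) > 1" and a: "admissible_cutoff a" and k: "k \<ge> 0"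
  defines "l \<equiv> \<mu> + (CARD('d) - 1) / 2"
  shows "\<exists>C>0. \<forall>N\<ge>1. \<forall>x y :: real ^ 'd. norm x \<le> 1 \<longrightarrow> norm y \<le> 1 \<longrightarrow>
    \<bar>trans_poly \<mu> (zonal_sum l (2 * N) (\<lambda>n. a (real n / real N))) x y\<bar> \<le>
      C * (real N powr real CARD('d) / (sqrt (local_weight \<mu> (real N) x) * sqrt (local_weight \<mu> (real N) y) *
        (1 + real N * ball_dist x y) powr k))"
proof -
  have l: "l > 0" using \<mu> d by (auto simp: l_def intro: add_nonneg_pos)
  \<comment> \<open>Since 1 + P is at least of order (1 + N D)^2, this exponent yields decay k +
    \<mu> in the distance; the surplus \<mu> pays for \<open>height_product_le\<close>.\<close>
  define k1 where "k1 = (k + \<mu>) / 2"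
  have k1: "k1 \<ge> 0" using k \<mu> by (simp add: k1_def)
  obtain m :: nat where m: "k1 + (\<mu> + 1) \<le> real m" using real_arch_simple by blast
  obtain C1 where C1: "C1 > 0" "\<And>N t. N \<ge> 1 \<Longrightarrow> \<bar>t\<bar> \<le> 1 \<Longrightarrow>
    \<bar>poly (zonal_sum l (2 * N) (\<lambda>n. a (real n / real N))) t\<bar> * (1 + (real N)\<^sup>2 * (1 - t)) ^ m \<le> C1 * real N powr (2 * l + 1)"
    using zonal_sum_localized[OF l a, of m] by blast
  obtain C2 where C2: "C2 > 0" "\<And>p z A. z \<ge> 0 \<Longrightarrow> A \<ge> 0 \<Longrightarrow>
    (\<forall>u\<in>{-1..1}. \<bar>poly p u\<bar> \<le> A * (1 + z * (1 - u)) powr (- (\<mu> + 1))) \<Longrightarrow>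
    \<bar>mfun \<mu> p\<bar> \<le> C2 * A * (1 + z) powr (- \<mu>)"
    using mfun_decay[OF \<mu>] by blast
  define C where "C = C2 * C1 * 16 powr k1 * 2 powr \<mu>"
  have "\<bar>trans_poly \<mu> (zonal_sum l (2 * N) (\<lambda>n. a (real n / real N))) x y\<bar> \<le>
      C * (real N powr real CARD('d) / (sqrt (local_weight \<mu> (real N) x) * sqrt (local_weight \<mu> (real N) y) *
        (1 + real N * ball_dist x y) powr k))"
    if N: "N \<ge> 1" and x: "norm x \<le> 1" and y: "norm y \<le> 1" for N and x y :: "real ^ 'd"
  proof -
    define D where "D = ball_dist x y"
    have D: "0 \<le> D" "D \<le> pi" "cos D = x \<bullet> y + height x * height y" "\<bar>height x - height y\<bar> \<le> D"
      using ball_dist_props[OF x y] by (simp_all add: D_def)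
    define g where "g = zonal_sum l (2 * N) (\<lambda>n. a (real n / real N))"
    define P where "P = (real N)\<^sup>2 * (1 - cos D)"
    define z where "z = (real N)\<^sup>2 * (height x * height y)"
    have h: "height x \<ge> 0" "height y \<ge> 0" using x y by (auto intro: height_nonneg)
    have P: "P \<ge> 0" by (simp add: P_def)
    have z: "z \<ge> 0" using h by (simp add: z_def)
    define A where "A = C1 * real N powr (2 * l + 1) * (1 + P) powr (- k1)"
    have A: "A \<ge> 0" using C1 by (simp add: A_def)
    have "\<bar>poly (pcompose g [:x \<bullet> y, height x * height y:]) u\<bar> \<le> A * (1 + z * (1 - u)) powr (- (\<mu> + 1))"
      if u: "u \<in> {-1..1}" for u
    proof -
      define t where "t = x \<bullet> y + u * (height x * height y)"
      define Q where "Q = z * (1 - u)"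
      have Q: "Q \<ge> 0" using z u by (simp add: Q_def)
      have t: "\<bar>t\<bar> \<le> 1" unfolding t_def using u by (intro inner_height_abs_le x y) (auto simp: abs_le_iff)
      \<comment> \<open>The argument at u = 1 is cos D, and moving to general \<open>u\<close>
        lowers it by (1 - u) height x height y.\<close>
      have PQ: "(real N)\<^sup>2 * (1 - t) = P + Q"
        by (simp add: P_def Q_def z_def t_def D(3) algebra_simps)
      have "(1 + P) powr k1 * (1 + Q) powr (\<mu> + 1) \<le> (1 + P + Q) powr k1 * (1 + P + Q) powr (\<mu> + 1)"
        using P Q k1 \<mu> by (intro mult_mono powr_mono2) auto
      also have "\<dots> = (1 + P + Q) powr (k1 + (\<mu> + 1))" by (simp add: powr_add)
      also have "\<dots> \<le> (1 + P + Q) powr real m" using P Q m by (intro powr_mono) auto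
      also have "\<dots> = (1 + P + Q) ^ m" using P Q by (subst powr_realpow) auto
      finally have le: "(1 + P) powr k1 * (1 + Q) powr (\<mu> + 1) \<le> (1 + P + Q) ^ m" .
      have "\<bar>poly g t\<bar> * ((1 + P) powr k1 * (1 + Q) powr (\<mu> + 1)) \<le> \<bar>poly g t\<bar> * (1 + P + Q) ^ m"
        using le by (intro mult_left_mono) auto
      also have "\<dots> \<le> C1 * real N powr (2 * l + 1)"
        using C1(2)[OF N t] unfolding PQ g_def by (simp add: add.assoc)
      finally have "\<bar>poly g t\<bar> \<le> C1 * real N powr (2 * l + 1) / ((1 + P) powr k1 * (1 + Q) powr (\<mu> + 1))"
        using P Q by (subst pos_le_divide_eq) auto
      also have "\<dots> = A * (1 + Q) powr (- (\<mu> + 1))"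
        unfolding A_def powr_minus by (simp only: divide_inverse inverse_mult_distrib mult.assoc)
      finally have "\<bar>poly g t\<bar> \<le> A * (1 + Q) powr (- (\<mu> + 1))" .
      then show ?thesis by (simp add: poly_pcompose t_def Q_def mult_ac)
    qed
    then have T: "\<bar>trans_poly \<mu> g x y\<bar> \<le> C2 * A * (1 + z) powr (- \<mu>)"
      unfolding trans_poly_eq_height[OF x y] by (intro C2(2) z A) auto
    have hp: "1 + real N * height x > 0" "1 + real N * height y > 0" and ND: "1 + real N * D > 0"
      using h D N by (auto intro!: add_pos_nonneg)
    have 1: "(1 + z) powr (- \<mu>) \<le> 2 powr \<mu> * (1 + real N * D) powr \<mu> *
        ((1 + real N * height x) powr (- \<mu>) * (1 + real N * height y) powr (- \<mu>))"
    proof -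
      have "(1 + real N * height x) powr \<mu> * (1 + real N * height y) powr \<mu> =
          ((1 + real N * height x) * (1 + real N * height y)) powr \<mu>"
        using hp by (simp add: powr_mult)
      also have "\<dots> \<le> (2 * (1 + z) * (1 + real N * D)) powr \<mu>"
        unfolding z_def using height_product_le[OF _ h D(4), of "real N"] hp \<mu> by (intro powr_mono2) auto
      also have "\<dots> = (2 * (1 + z)) powr \<mu> * (1 + real N * D) powr \<mu>"
        by (rule powr_mult)
      also have "(2 * (1 + z)) powr \<mu> = 2 powr \<mu> * (1 + z) powr \<mu>"
        by (rule powr_mult)
      finally have "(1 + real N * height x) powr \<mu> * (1 + real N * height y) powr \<mu> \<le>
          2 powr \<mu> * (1 + z) powr \<mu> * (1 + real N * D) powr \<mu>" .
      moreover have "(1 + real N * height x) powr \<mu> > 0" "(1 + real N * height y) powr \<mu> > 0" "(1 + z) powr \<mu> > 0"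
        using hp z by auto
      ultimately show ?thesis unfolding powr_minus by (simp add: field_simps)
    qed
    \<comment> \<open>The constant 16 combines the 8 of \<open>one_minus_cos_ge\<close> with the 2
      of (1 + s)^2 \<le> 2 (1 + s^2).\<close>
    have 2: "(1 + P) powr (- k1) \<le> 16 powr k1 * (1 + real N * D) powr (- (k + \<mu>))"
    proof -
      have "(1 + real N * D)\<^sup>2 \<le> 2 * (1 + (real N * D)\<^sup>2)"
        using sum_squares_bound[of 1 "real N * D"] by (simp add: power2_sum)
      also have "\<dots> \<le> 16 * (1 + P)"
      proof -
        have "(real N)\<^sup>2 * (D\<^sup>2 / 8) \<le> P" unfolding P_def by (intro mult_left_mono one_minus_cos_ge D) auto
        then show ?thesis by (simp add: power_mult_distrib)
      qed
      finally have "((1 + real N * D)\<^sup>2) powr k1 \<le> (16 * (1 + P)) powr k1" using k1 by (intro powr_mono2) auto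
      moreover have "((1 + real N * D)\<^sup>2) powr k1 = (1 + real N * D) powr (k + \<mu>)"
        using ND by (simp add: k1_def powr_powr add_divide_distrib flip: powr_numeral)
      ultimately have "(1 + real N * D) powr (k + \<mu>) \<le> 16 powr k1 * (1 + P) powr k1"
        by (simp only: powr_mult)
      moreover have "(1 + P) powr k1 > 0" "(1 + real N * D) powr (k + \<mu>) > 0" using P ND by auto
      ultimately show ?thesis by (simp only: powr_minus) (simp add: field_simps)
    qed
    have "C2 * A * (1 + z) powr (- \<mu>) =
        C2 * C1 * real N powr (2 * l + 1) * ((1 + P) powr (- k1) * (1 + z) powr (- \<mu>))"
      by (simp add: A_def mult_ac)
    also have "\<dots> \<le> C2 * C1 * real N powr (2 * l + 1) *
        ((16 powr k1 * (1 + real N * D) powr (- (k + \<mu>))) * (2 powr \<mu> * (1 + real N * D) powr \<mu> *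
        ((1 + real N * height x) powr (- \<mu>) * (1 + real N * height y) powr (- \<mu>))))"
      using C1 C2 by (intro mult_left_mono mult_mono 1 2) auto
    also have "\<dots> = C * (real N powr (2 * l + 1) * (1 + real N * D) powr (- k) *
        ((1 + real N * height x) powr (- \<mu>) * (1 + real N * height y) powr (- \<mu>)))"
    proof -
      have "(1 + real N * D) powr (- (k + \<mu>)) * (1 + real N * D) powr \<mu> = (1 + real N * D) powr (- k)"
        by (simp flip: powr_add)
      then show ?thesis by (simp add: C_def mult_ac)
    qed
    also have "real N powr (2 * l + 1) = real N powr real CARD('d) * (real N powr \<mu> * real N powr \<mu>)"
    proof -
      have e: "2 * l + 1 = real CARD('d) + (\<mu> + \<mu>)" using d by (simp add: l_def of_nat_diff field_simps)
      show ?thesis unfolding e by (simp only: powr_add)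
    qed
    also have "C * (real N powr real CARD('d) * (real N powr \<mu> * real N powr \<mu>) * (1 + real N * D) powr (- k) *
        ((1 + real N * height x) powr (- \<mu>) * (1 + real N * height y) powr (- \<mu>))) =
      C * (real N powr real CARD('d) / (sqrt (local_weight \<mu> (real N) x) * sqrt (local_weight \<mu> (real N) y) *
        (1 + real N * D) powr k))"
      using N x y by (simp add: local_weight_sqrt powr_minus divide_inverse mult_ac)
    finally show ?thesis using T unfolding g_def D_def by linarith
  qed
  moreover have "C > 0" using C1 C2 by (simp add: C_def)
  ultimately show ?thesis by blast
qed

section \<open>Needlets\<close>

text \<open>The upper half of the degrees suffices: at least M / 2 terms, each at least
  \<open>A * (real M / 2) powr (2 * l)\<close>.\<close>

lemma zonal_at_1_sum_ge:
  assumes l: "l > 0"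
  shows "\<exists>c>0. \<forall>M\<ge>1. c * real M powr (2 * l + 1) \<le> (\<Sum>n\<le>M. poly (zonal l n) 1)"
proof -
  obtain A B where AB: "A > 0" "B > 0"
    "\<And>n. n \<ge> 1 \<Longrightarrow> A * real n powr (2 * l) \<le> poly (zonal l n) 1 \<and> poly (zonal l n) 1 \<le> B * real n powr (2 * l)"
    using zonal_at_1_growth[OF l] by blast
  have "A / 2 powr (2 * l + 1) * real M powr (2 * l + 1) \<le> (\<Sum>n\<le>M. poly (zonal l n) 1)" if M: "M \<ge> 1" for M
  proof -
    define Q where "Q = A * (real M / 2) powr (2 * l)"
    define m where "m = Suc M div 2"
    have m: "M \<le> 2 * m" "m \<ge> 1" "m \<le> M" "2 * m \<le> Suc M" using M by (auto simp: m_def)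
    have "A / 2 powr (2 * l + 1) * real M powr (2 * l + 1) = (real M / 2) * Q"
      using M by (simp add: Q_def powr_divide powr_add mult_ac)
    also have "\<dots> \<le> real (Suc M - m) * Q"
      using m AB(1) by (intro mult_right_mono) (auto simp: Q_def)
    also have "\<dots> = (\<Sum>n\<in>{m..M}. Q)" by simp
    also have "\<dots> \<le> (\<Sum>n\<in>{m..M}. poly (zonal l n) 1)"
    proof (rule sum_mono)
      fix n assume n: "n \<in> {m..M}"
      then have n1: "n \<ge> 1" using m by auto
      have "(real M / 2) powr (2 * l) \<le> real n powr (2 * l)"
        using n m l by (intro powr_mono2) auto
      then have "Q \<le> A * real n powr (2 * l)" unfolding Q_def using AB(1) by (intro mult_left_mono) auto
      then show "Q \<le> poly (zonal l n) 1" using AB(3)[OF n1] by linarith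
    qed
    also have "\<dots> \<le> (\<Sum>n\<le>M. poly (zonal l n) 1)"
      using zonal_at_1_pos[OF l] by (intro sum_mono2) (auto simp: less_imp_le)
    finally show ?thesis .
  qed
  moreover have "A / 2 powr (2 * l + 1) > 0" using AB(1) by simp
  ultimately show ?thesis by blast
qed

lemma mfun_zonal_sum_square:
  assumes l: "l > 0"
  shows "mfun (l + 1/2) (zonal_sum l M (\<lambda>_. 1) * zonal_sum l M (\<lambda>_. 1)) = (\<Sum>n\<le>M. poly (zonal l n) 1)"
proof -
  have "mfun (l + 1/2) (zonal_sum l M (\<lambda>_. 1) * zonal_sum l M (\<lambda>_. 1)) =
      (\<Sum>m\<le>M. \<Sum>n\<le>M. mfun (l + 1/2) (zonal l m * zonal l n))"
    by (simp add: zonal_sum_def sum_product mfun_sum)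
  then show ?thesis by (simp add: mfun_zonal_zonal[OF l])
qed

lemma zonal_sum_degree_le: "degree (zonal_sum l M F) \<le> M"
  unfolding zonal_sum_def
proof (rule degree_sum_le)
  fix n assume "n \<in> {..M}"
  then show "degree (smult (F n) (zonal l n)) \<le> M"
    using order.trans[OF degree_smult_le[of "F n" "zonal l n"] zonal_degree_le[of l n]] by simp
qed simp

text \<open>
  The coefficient of a positive quadrature formula at \<open>\<xi>\<close> is bounded by testing the formula with the
  nonnegative polynomial \<open>x \<mapsto> trans_poly \<mu> (h * h) x \<xi>\<close>, where \<open>h\<close> peaks at \<open>1\<close>.
\<close>

lemma quadrature_coefficient_le:
  fixes \<mu> :: real
  assumes \<mu>: "\<mu> \<ge> 0" and d: "CARD('d::finite) > 1"
  shows "\<exists>C>0. \<forall>M\<ge>1. \<forall>X :: (real ^ 'd) set. \<forall>lam. finite X \<longrightarrow> X \<subseteq> cball 0 1 \<longrightarrow> (\<forall>\<xi>\<in>X. lam \<xi> > 0) \<longrightarrow>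
    (\<forall>f. poly_deg_le (2 * M) f \<longrightarrow> weighted_integral \<mu> (cball 0 1) f = (\<Sum>\<xi>\<in>X. lam \<xi> * f \<xi>)) \<longrightarrow>
    (\<forall>\<xi>\<in>X. lam \<xi> \<le> C * (local_weight \<mu> (real M) \<xi> / real M powr real CARD('d)))"
proof -
  define l where "l = \<mu> + (CARD('d) - 1) / 2"
  have l: "l > 0" using \<mu> d by (auto simp: l_def intro: add_nonneg_pos)
  have \<nu>: "\<mu> + CARD('d) / 2 = l + 1/2" using d by (simp add: l_def of_nat_diff diff_divide_distrib)
  have l2: "2 * l + 1 = real CARD('d) + 2 * \<mu>" using d by (simp add: l_def of_nat_diff field_simps)
  define \<omega> where "\<omega> = ball_int (\<mu> - 1/2) (\<lambda>_ :: real ^ 'd. 1)"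
  have \<omega>: "\<omega> > 0" unfolding \<omega>_def by (rule ball_int_one_pos) (use \<mu> in auto)
  obtain c1 where c1: "c1 > 0" "\<And>M. M \<ge> 1 \<Longrightarrow> c1 * real M powr (2 * l + 1) \<le> (\<Sum>n\<le>M. poly (zonal l n) 1)"
    using zonal_at_1_sum_ge[OF l] by blast
  obtain c2 where c2: "c2 > 0" "\<And>p \<delta> A. 0 < \<delta> \<Longrightarrow> \<delta> \<le> 1 \<Longrightarrow> A \<ge> 0 \<Longrightarrow> (\<forall>u\<in>{-1..1}. poly p u \<ge> 0) \<Longrightarrow>
    (\<forall>u\<in>{1 - \<delta>..1}. poly p u \<ge> A) \<Longrightarrow> mfun \<mu> p \<ge> c2 * A * \<delta> powr \<mu>"
    using mfun_lower[OF \<mu>] by blast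
  \<comment> \<open>If M^2 (1 - t) \<le> \<epsilon> and t = cos \<theta>, then \<theta>^2 / 8 \<le>
    1 - t gives (M \<theta>)^2 \<le> 8 \<epsilon>, so this value forces (1 + l) M \<theta> \<le>
    1/2. Every zonal term up to degree \<open>M\<close> then keeps half of its peak.\<close>
  define \<epsilon> where "\<epsilon> = 1 / (32 * (1 + l)\<^sup>2)"
  have \<epsilon>: "\<epsilon> > 0" using l by (simp add: \<epsilon>_def)
  define C where "C = 4 * \<omega> / (c1 * c2) * ((\<epsilon> + 1) / \<epsilon>) powr \<mu>"
  have "lam \<xi> \<le> C * (local_weight \<mu> (real M) \<xi> / real M powr real CARD('d))"
    if M: "M \<ge> 1" and X: "finite X" "X \<subseteq> cball 0 1" and lam: "\<forall>\<xi>\<in>X. lam \<xi> > 0"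
      and quad: "\<forall>f. poly_deg_le (2 * M) f \<longrightarrow> weighted_integral \<mu> (cball 0 1) f = (\<Sum>\<xi>\<in>X. lam \<xi> * f \<xi>)"
      and \<xi>: "\<xi> \<in> X" for M and X :: "(real ^ 'd) set" and lam \<xi>
  proof -
    define h where "h = zonal_sum l M (\<lambda>_. 1)"
    define H where "H = (\<Sum>n\<le>M. poly (zonal l n) 1)"
    have H: "H \<ge> c1 * real M powr (2 * l + 1)" "H > 0"
      using c1(2)[OF M] c1(1) M by (auto simp: H_def intro: less_le_trans[rotated])
    have n\<xi>: "norm \<xi> \<le> 1" using \<xi> X by auto
    define p where "p x = trans_poly \<mu> (h * h) x \<xi>" for x
    have p_alt: "p x = trans_poly \<mu> (h * h) \<xi> x" for x unfolding p_def by (rule trans_poly_commute)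
    have dp: "degree (h * h) \<le> 2 * M"
      using degree_mult_le[of h h] zonal_sum_degree_le[of l M "\<lambda>_. 1"] by (simp add: h_def)
    have p_poly: "poly_deg_le (2 * M) p"
      unfolding p_alt[abs_def] by (rule sep_poly_right[OF sep_poly_trans_poly[OF dp]])
    \<comment> \<open>Nonnegativity of the mean of a square is the case \<open>A = 0\<close>,
      \<open>\<delta> = 1\<close> of the lower bound for \<open>mfun\<close>.\<close>
    have p_nonneg: "p x \<ge> 0" if "norm x \<le> 1" for x
      unfolding p_def trans_poly_eq_height[OF that n\<xi>]
      using c2(2)[of 1 0 "pcompose (h * h) [:x \<bullet> \<xi>, height x * height \<xi>:]"] by (simp add: poly_pcompose)
    have "lam \<xi> * p \<xi> \<le> (\<Sum>\<eta>\<in>X. lam \<eta> * p \<eta>)"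
      using X lam \<xi> p_nonneg by (intro member_le_sum) (auto intro!: mult_nonneg_nonneg simp: subset_iff less_imp_le)
    also have "\<dots> = weighted_integral \<mu> (cball 0 1) p" using quad p_poly by simp
    also have "\<dots> = ball_int (\<mu> - 1/2) (\<lambda>y. trans_poly \<mu> (h * h) \<xi> y * 1)"
      by (simp add: weighted_integral_ball p_alt[abs_def])
    \<comment> \<open>The constant 1 reproduces to \<open>r = 1\<close>, so the integral becomes the
      one-variable functional of \<open>h * h\<close>, which the reproducing property evaluates to
      \<open>H\<close>.\<close>
    also have "\<dots> = \<omega> * H"
    proof -
      obtain r where r: "degree r \<le> 0" "poly r 1 = 1"
        "\<And>g. ball_int (\<mu> - 1/2) (\<lambda>y. trans_poly \<mu> g \<xi> y * 1) = \<omega> * mfun (l + 1/2) (g * r)"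
        using trans_poly_reproducing[OF \<mu> n\<xi> poly_deg_le_const[of 0 1]] unfolding \<nu> \<omega>_def by blast
      have "r = 1" using r(1,2) by (auto elim!: degree_eq_zeroE simp: one_pCons)
      then show ?thesis unfolding r(3) using mfun_zonal_sum_square[OF l, of M] by (simp add: h_def H_def)
    qed
    finally have upper: "lam \<xi> * p \<xi> \<le> \<omega> * H" .
    define q where "q = (real M)\<^sup>2 * (height \<xi>)\<^sup>2"
    \<comment> \<open>For u in \<open>{1 - \<delta>..1}\<close> the argument t satisfies M^2 (1 - t)
      \<le> \<delta> q \<le> \<epsilon>, so \<open>h\<close> is at least half of its peak there. At
      the same time 1 / \<delta> is at most of order (1 + M height \<xi>)^2, whose power \<mu> is
      the local weight up to a power of M.\<close>
    define \<delta> where "\<delta> = \<epsilon> / (\<epsilon> + q)"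
    have q: "q \<ge> 0" by (simp add: q_def)
    have \<delta>: "0 < \<delta>" "\<delta> \<le> 1" "\<delta> * q \<le> \<epsilon>"
      using \<epsilon> q by (auto simp: \<delta>_def add_pos_nonneg pos_divide_le_eq mult_left_mono)
    have h_ge: "H / 2 \<le> poly h t" if t: "\<bar>t\<bar> \<le> 1" "(real M)\<^sup>2 * (1 - t) \<le> \<epsilon>" for t
    proof -
      define \<theta> where "\<theta> = arccos t"
      have \<theta>: "0 \<le> \<theta>" "\<theta> \<le> pi" "cos \<theta> = t" using t(1) by (auto simp: \<theta>_def abs_le_iff arccos_lbound arccos_ubound)
      have "(real M)\<^sup>2 * (\<theta>\<^sup>2 / 8) \<le> \<epsilon>"
        using one_minus_cos_ge[OF \<theta>(1,2)] by (intro order.trans[OF mult_left_mono t(2)]) (auto simp: \<theta>(3))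
      then have "4 * ((real M * \<theta>)\<^sup>2 * (1 + l)\<^sup>2) \<le> 1"
        using l by (simp add: \<epsilon>_def power_mult_distrib pos_le_divide_eq mult_ac)
      moreover have "4 * (x\<^sup>2 * B\<^sup>2) = (2 * (B * x))\<^sup>2" for B x :: real by (simp add: power_mult_distrib)
      ultimately have "(2 * ((1 + l) * (real M * \<theta>)))\<^sup>2 \<le> 1" by (simp only:)
      then have small: "(1 + l) * (real M * \<theta>) \<le> 1/2"
        unfolding abs_square_le_1 by linarith
      have "(1/2) * poly (zonal l n) 1 \<le> poly (zonal l n) t" if n: "n \<le> M" for n
      proof -
        have "l * 1 \<le> l * real M" using l M by (intro mult_left_mono) auto
        then have "(real n + l) * \<theta> \<le> ((1 + l) * real M) * \<theta>"
          using n \<theta>(1) by (intro mult_right_mono) (auto simp: distrib_right)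
        also have "\<dots> \<le> 1/2" using small by (simp add: mult.assoc)
        finally have "poly (zonal l n) 1 * (1/2) \<le> poly (zonal l n) 1 * (1 - (real n + l) * \<theta>)"
          using zonal_at_1_pos[OF l, of n] by (intro mult_left_mono) auto
        also have "\<dots> \<le> poly (zonal l n) t" using zonal_cos_ge[OF l \<theta>(1), of n] \<theta>(3) by simp
        finally show ?thesis by (simp add: mult.commute)
      qed
      then have "(\<Sum>n\<le>M. (1/2) * poly (zonal l n) 1) \<le> (\<Sum>n\<le>M. poly (zonal l n) t)" by (intro sum_mono) auto
      then show ?thesis unfolding H_def h_def zonal_sum_def poly_sum poly_smult sum_divide_distrib by simp
    qed
    have lower: "c2 * (H / 2)\<^sup>2 * \<delta> powr \<mu> \<le> p \<xi>"
      unfolding p_def trans_poly_eq_height[OF n\<xi> n\<xi>]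
    proof (intro c2(2) \<delta>(1,2) ballI)
      fix u assume u: "u \<in> {1 - \<delta>..1}"
      have u1: "\<bar>u\<bar> \<le> 1" using u \<delta> by auto
      define t where "t = \<xi> \<bullet> \<xi> + u * (height \<xi> * height \<xi>)"
      have t1: "1 - t = (1 - u) * (height \<xi>)\<^sup>2"
        using height_square[OF n\<xi>] by (simp add: t_def dot_square_norm power2_eq_square algebra_simps)
      have "(real M)\<^sup>2 * (1 - t) = (1 - u) * q" by (simp add: t1 q_def mult_ac)
      also have "\<dots> \<le> \<delta> * q" using u q by (intro mult_right_mono) auto
      finally have "H / 2 \<le> poly h t"
        using \<delta>(3) unfolding t_def by (intro h_ge inner_height_abs_le n\<xi> u1) auto
      then have "(H / 2)\<^sup>2 \<le> (poly h t)\<^sup>2" using H(2) by (intro power_mono) auto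
      then show "(H / 2)\<^sup>2 \<le> poly (pcompose (h * h) [:\<xi> \<bullet> \<xi>, height \<xi> * height \<xi>:]) u"
        by (simp add: poly_pcompose t_def power2_eq_square mult_ac)
    qed (auto simp: poly_pcompose)
    have lam\<xi>: "lam \<xi> > 0" using lam \<xi> by simp
    have "lam \<xi> * (c2 * (H / 2)\<^sup>2 * \<delta> powr \<mu>) \<le> \<omega> * H"
      using mult_left_mono[OF lower, of "lam \<xi>"] upper lam\<xi> by linarith
    \<comment> \<open>The value at the node is of order \<open>H ^ 2 * \<delta> powr \<mu>\<close>
      while the integral is only \<open>\<omega> * H\<close>; cancelling one \<open>H\<close> leaves
      the bound for the coefficient.\<close>
    then have "H * (lam \<xi> * (c2 * H * \<delta> powr \<mu>)) \<le> H * (4 * \<omega>)"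
      by (simp add: power2_eq_square algebra_simps)
    then have "lam \<xi> * (c2 * H * \<delta> powr \<mu>) \<le> 4 * \<omega>" using H(2) by simp
    moreover have "c2 * (c1 * real M powr (2 * l + 1)) * \<delta> powr \<mu> \<le> c2 * H * \<delta> powr \<mu>"
      using H(1) c2(1) by (intro mult_right_mono mult_left_mono) auto
    ultimately have "lam \<xi> * (c2 * (c1 * real M powr (2 * l + 1)) * \<delta> powr \<mu>) \<le> 4 * \<omega>"
      using lam\<xi> by (meson mult_left_mono order.trans less_imp_le)
    then have "lam \<xi> \<le> 4 * \<omega> / (c2 * (c1 * real M powr (2 * l + 1)) * \<delta> powr \<mu>)"
      using c1(1) c2(1) M \<delta>(1) by (subst pos_le_divide_eq) auto
    also have "\<dots> = 4 * \<omega> / (c1 * c2) * ((1 / \<delta>) powr \<mu> / real M powr (2 * l + 1))"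
      using \<delta>(1) by (simp add: powr_divide)
    also have "\<dots> \<le> 4 * \<omega> / (c1 * c2) * ((((\<epsilon> + 1) / \<epsilon>) * (1 + real M * height \<xi>)\<^sup>2) powr \<mu> / real M powr (2 * l + 1))"
    proof (intro mult_left_mono divide_right_mono powr_mono2)
      have h: "height \<xi> \<ge> 0" by (rule height_nonneg[OF n\<xi>])
      have "\<epsilon> + q \<le> (\<epsilon> + 1) * (1 + real M * height \<xi>)\<^sup>2"
        using h \<epsilon> by (simp add: q_def power2_eq_square algebra_simps)
      then show "1 / \<delta> \<le> (\<epsilon> + 1) / \<epsilon> * (1 + real M * height \<xi>)\<^sup>2"
        using \<epsilon> by (simp add: \<delta>_def divide_right_mono)
    qed (use \<mu> \<delta> \<omega> c1 c2 in auto)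
    also have "\<dots> = C * ((1 + real M * height \<xi>)\<^sup>2 powr \<mu> / real M powr (2 * l + 1))"
      unfolding C_def powr_mult by simp
    also have "(1 + real M * height \<xi>)\<^sup>2 powr \<mu> / real M powr (2 * l + 1) =
        local_weight \<mu> (real M) \<xi> / real M powr real CARD('d)"
    proof -
      have p: "1 + real M * height \<xi> > 0" using height_nonneg[OF n\<xi>] by (intro add_pos_nonneg) auto
      have e: "(1 + real M * height \<xi>)\<^sup>2 powr \<mu> = (1 + real M * height \<xi>) powr (2 * \<mu>)"
        using p by (simp add: powr_powr flip: powr_numeral)
      have h: "height \<xi> + 1 / real M = (1 + real M * height \<xi>) / real M" using M by (simp add: field_simps)
      show ?thesis
        unfolding e local_weight_def height_def[symmetric] h l2 using p M by (simp add: powr_divide powr_add)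
    qed
    finally show ?thesis .
  qed
  moreover have "C > 0" using \<omega> c1(1) c2(1) \<epsilon> by (simp add: C_def)
  ultimately show ?thesis by blast
qed

lemma needlet_kernel_eq:
  fixes x y :: "real ^ 'd"
  assumes \<mu>: "\<mu> \<ge> 0" and d: "CARD('d) > 1" and a: "admissible_cutoff a" and j: "j > 0"
  shows "needlet_kernel \<mu> a j x y =
    trans_poly \<mu> (zonal_sum (\<mu> + (CARD('d) - 1) / 2) (2 * 2 ^ (j - 1)) (\<lambda>n. a (real n / real (2 ^ (j - 1))))) x y"
proof -
  define N :: nat where "N = 2 ^ (j - 1)"
  have N: "N \<ge> 1" by (simp add: N_def)
  have "needlet_kernel \<mu> a j x y = (\<Sum>n. a (real n / real N) * proj_kernel \<mu> n x y)"
    using j by (simp add: needlet_kernel_def N_def)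
  also have "\<dots> = (\<Sum>n\<le>2 * N. a (real n / real N) * proj_kernel \<mu> n x y)"
  proof (rule suminf_finite)
    fix n assume "n \<notin> {..2 * N}"
    then have "real n / real N > 2" using N by (simp add: field_simps)
    then show "a (real n / real N) * proj_kernel \<mu> n x y = 0" using admissible_cutoffD(2)[OF a] by simp
  qed simp
  finally show ?thesis
    unfolding proj_kernel_eq[OF \<mu> d] N_def[symmetric] by (simp add: zonal_sum_def trans_poly_sum trans_poly_smult)
qed

theorem theorem6p2:
  fixes \<mu> cs css cd c1 c2 c3 c4 :: real
    and a :: "real \<Rightarrow> real"
  assumes "CARD('d::finite) > 1"
    and "\<mu> \<ge> 0"
    and "admissible_cutoff a"
    and "cs > 0" "css > 0" "cd > 0"
    and "c1 > 0" "c2 > 0" "c3 > 0" "c4 > 0"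
  shows "\<forall>k::real. k > 0 \<longrightarrow> (\<exists>c>0.
    \<forall>(X :: nat \<Rightarrow> (real ^ 'd) set) (lam :: nat \<Rightarrow> real ^ 'd \<Rightarrow> real).
      needlet_cubature \<mu> cs css cd c1 c2 c3 c4 X lam \<longrightarrow>
      (\<forall>j. \<forall>\<xi> \<in> X j. \<forall>x \<in> cball 0 1.
        \<bar>needlet \<mu> a lam j \<xi> x\<bar> \<le>
          c * (2 powr (real j * real CARD('d) / 2) /
               (sqrt (local_weight \<mu> (2 ^ j) x) * (1 + 2 ^ j * ball_dist x \<xi>) powr k))))"
proof (intro allI impI)
  note d = assms(1) and \<mu> = assms(2) and a = assms(3)
  fix k :: real assume k: "k > 0"
  define l where "l = \<mu> + (CARD('d) - 1) / 2"
  have "\<exists>C>0. \<forall>N\<ge>1. \<forall>x y :: real ^ 'd. norm x \<le> 1 \<longrightarrow> norm y \<le> 1 \<longrightarrow>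
    \<bar>trans_poly \<mu> (zonal_sum l (2 * N) (\<lambda>n. a (real n / real N))) x y\<bar> \<le>
      C * (real N powr real CARD('d) / (sqrt (local_weight \<mu> (real N) x) * sqrt (local_weight \<mu> (real N) y) *
        (1 + real N * ball_dist x y) powr k))"
    unfolding l_def by (rule localized_kernel_bound[OF \<mu> d a less_imp_le[OF k]])
  then obtain CL where CL: "CL > 0" "\<And>N (x :: real ^ 'd) y. N \<ge> 1 \<Longrightarrow> norm x \<le> 1 \<Longrightarrow> norm y \<le> 1 \<Longrightarrow>
    \<bar>trans_poly \<mu> (zonal_sum l (2 * N) (\<lambda>n. a (real n / real N))) x y\<bar> \<le>
      CL * (real N powr real CARD('d) / (sqrt (local_weight \<mu> (real N) x) * sqrt (local_weight \<mu> (real N) y) *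
        (1 + real N * ball_dist x y) powr k))"
    by blast
  obtain CQ where CQ: "CQ > 0" "\<forall>M\<ge>1. \<forall>X :: (real ^ 'd) set. \<forall>lam. finite X \<longrightarrow> X \<subseteq> cball 0 1 \<longrightarrow>
    (\<forall>\<xi>\<in>X. lam \<xi> > 0) \<longrightarrow>
    (\<forall>f. poly_deg_le (2 * M) f \<longrightarrow> weighted_integral \<mu> (cball 0 1) f = (\<Sum>\<xi>\<in>X. lam \<xi> * f \<xi>)) \<longrightarrow>
    (\<forall>\<xi>\<in>X. lam \<xi> \<le> CQ * (local_weight \<mu> (real M) \<xi> / real M powr real CARD('d)))"
    using quadrature_coefficient_le[OF \<mu> d] by (elim exE conjE) (rule that)
  \<comment> \<open>The first summand serves positive \<open>j\<close>, with \<open>2 powr k\<close>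
    from replacing 2^(j - 1) by 2^j. The second serves \<open>j = 0\<close>, where the kernel is 1,
    both weight roots are at most \<open>2 powr \<mu>\<close>, and 1 + D \<le> 5 as D \<le>
    pi.\<close>
  define c where "c = sqrt CQ * CL * 2 powr k + sqrt CQ * (2 powr \<mu> * 2 powr \<mu> * 5 powr k)"
  have "\<bar>needlet \<mu> a lam j \<xi> x\<bar> \<le> c * (2 powr (real j * real CARD('d) / 2) /
      (sqrt (local_weight \<mu> (2 ^ j) x) * (1 + 2 ^ j * ball_dist x \<xi>) powr k))"
    if cub: "needlet_cubature \<mu> cs css cd c1 c2 c3 c4 X lam" and \<xi>: "\<xi> \<in> X j" and x: "x \<in> cball 0 1"
    for X :: "nat \<Rightarrow> (real ^ 'd) set" and lam j \<xi> x
  proof -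
    define M :: nat where "M = 2 ^ j"
    have M: "M \<ge> 1" and rM: "(2 :: real) ^ j = real M" by (simp_all add: M_def)
    have X: "finite (X j)" "X j \<subseteq> cball 0 1" "\<forall>\<xi>\<in>X j. lam j \<xi> > 0"
      and quad: "\<forall>f. poly_deg_le (2 ^ (j + 2)) f \<longrightarrow> weighted_integral \<mu> (cball 0 1) f = (\<Sum>\<xi>\<in>X j. lam j \<xi> * f \<xi>)"
      using cub unfolding needlet_cubature_def by blast+
    have "2 * M \<le> 2 ^ (j + 2)" by (simp add: M_def)
    then have quad': "weighted_integral \<mu> (cball 0 1) f = (\<Sum>\<xi>\<in>X j. lam j \<xi> * f \<xi>)" if "poly_deg_le (2 * M) f" for f
      using quad poly_deg_le_mono[OF that] by simp
    have lam: "lam j \<xi> \<le> CQ * (local_weight \<mu> (real M) \<xi> / real M powr real CARD('d))"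
      by (rule CQ(2)[rule_format, OF M X(1,2) _ _ \<xi>]) (use X(3) quad' in auto)
    have n\<xi>: "norm \<xi> \<le> 1" and nx: "norm x \<le> 1" using \<xi> X(2) x by auto
    define D where "D = ball_dist x \<xi>"
    have D: "0 \<le> D" "D \<le> pi" using ball_dist_props[OF nx n\<xi>] by (simp_all add: D_def)
    define w where "w y = sqrt (local_weight \<mu> (real M) y)" for y :: "real ^ 'd"
    have w: "w y > 0" if "norm y \<le> 1" for y
    proof -
      have "height y + 1 / real M > 0" using height_nonneg[OF that] M by (intro add_nonneg_pos) auto
      then show ?thesis by (simp add: w_def local_weight_def height_def[symmetric])
    qed
    have Md: "2 powr (real j * real CARD('d) / 2) = real M powr (real CARD('d) / 2)"
      unfolding rM[symmetric] by (simp add: powr_powr flip: powr_realpow)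
    have Mpos: "real M powr (real CARD('d) / 2) > 0" using M by simp
    have sq: "sqrt (real M powr real CARD('d)) = real M powr (real CARD('d) / 2)"
      by (simp add: powr_half_sqrt[symmetric] powr_powr)
    \<comment> \<open>The factor \<open>w \<xi>\<close> here cancels the weight at \<xi> in the
      kernel bound, and the half power of M turns M^d into the required M^(d/2).\<close>
    have sl: "sqrt (lam j \<xi>) \<le> sqrt CQ * (w \<xi> / real M powr (real CARD('d) / 2))"
      using real_sqrt_le_mono[OF lam] by (simp add: real_sqrt_mult real_sqrt_divide w_def sq)
    have sl0: "sqrt (lam j \<xi>) \<ge> 0" using X(3) \<xi> by (simp add: less_imp_le)
    show ?thesis
    proof (cases "j = 0")
      case True
      have M1: "M = 1" by (simp add: M_def True)
      have w2: "w y \<le> 2 powr \<mu>" if "norm y \<le> 1" for y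
      proof -
        have "(1 + height y) powr \<mu> \<le> 2 powr \<mu>"
          using height_nonneg[OF that] height_le_1[OF that] \<mu> by (intro powr_mono2) auto
        then show ?thesis using local_weight_sqrt[OF _ that, of 1 \<mu>] by (simp add: w_def M1)
      qed
      have "(1 + D) powr k \<le> 5 powr k" using D k pi_less_4 by (intro powr_mono2) auto
      then have wD: "w x * (1 + D) powr k \<le> 2 powr \<mu> * 5 powr k" by (intro mult_mono w2 nx) auto
      have pos: "w x * (1 + D) powr k > 0" using w[OF nx] D by (intro mult_pos_pos) auto
      have "sqrt (lam j \<xi>) * (w x * (1 + D) powr k) \<le> (sqrt CQ * 2 powr \<mu>) * (2 powr \<mu> * 5 powr k)"
      proof (rule mult_mono[OF _ wD])
        have "sqrt CQ * w \<xi> \<le> sqrt CQ * 2 powr \<mu>" using CQ(1) by (intro mult_left_mono w2 n\<xi>) auto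
        then show "sqrt (lam j \<xi>) \<le> sqrt CQ * 2 powr \<mu>" using sl by (simp add: M1)
      qed (use sl0 pos CQ(1) in auto)
      also have "\<dots> \<le> c" using CQ(1) CL(1) by (simp add: c_def mult_ac)
      finally have "sqrt (lam j \<xi>) \<le> c / (w x * (1 + D) powr k)"
        using pos by (simp only: pos_le_divide_eq)
      then show ?thesis
        using sl0 by (simp add: needlet_def needlet_kernel_def True w_def D_def M1)
    next
      case False
      define N :: nat where "N = 2 ^ (j - 1)"
      have N: "N \<ge> 1" by (simp add: N_def)
      have MN: "M = 2 * N" using False by (simp add: M_def N_def power_eq_if)
      \<comment> \<open>The kernel bound is at scale N = M / 2. Local weights decrease in the scale,
        so passing to scale \<open>M\<close> only shrinks the denominator.\<close>
      have wN: "w y \<le> sqrt (local_weight \<mu> (real N) y)" if "norm y \<le> 1" for y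
      proof -
        have "1 / real M \<le> 1 / real N" using N by (simp add: MN frac_le)
        then have "local_weight \<mu> (real M) y \<le> local_weight \<mu> (real N) y"
          unfolding local_weight_def height_def[symmetric]
          using height_nonneg[OF that] \<mu> by (intro powr_mono2) auto
        then show ?thesis by (simp add: w_def)
      qed
      have ND: "1 + real N * D > 0" "1 + real M * D > 0" using D(1) by (auto intro!: add_pos_nonneg)
      have "1 + real M * D \<le> 2 * (1 + real N * D)" by (simp add: MN)
      then have "(1 + real M * D) powr k \<le> (2 * (1 + real N * D)) powr k"
        using ND k by (intro powr_mono2) auto
      also have "\<dots> = 2 powr k * (1 + real N * D) powr k" by (rule powr_mult)
      finally have kD: "(1 + real M * D) powr k / 2 powr k \<le> (1 + real N * D) powr k"
        by (simp add: pos_divide_le_eq mult.commute)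
      define K where "K = needlet_kernel \<mu> a j x \<xi>"
      have "\<bar>K\<bar> \<le> CL * (real N powr real CARD('d) / (sqrt (local_weight \<mu> (real N) x) *
          sqrt (local_weight \<mu> (real N) \<xi>) * (1 + real N * D) powr k))"
        using CL(2)[OF N nx n\<xi>] needlet_kernel_eq[OF \<mu> d a, of j x \<xi>] False
        by (simp add: K_def l_def N_def D_def)
      also have "\<dots> \<le> CL * (real M powr real CARD('d) / (w x * w \<xi> * ((1 + real M * D) powr k / 2 powr k)))"
        using CL(1) w[OF nx] w[OF n\<xi>] wN[OF nx] wN[OF n\<xi>] kD ND
        by (intro mult_left_mono frac_le mult_mono powr_mono2) (auto simp: MN local_weight_def intro!: mult_nonneg_nonneg mult_pos_pos)
      also have "\<dots> = CL * 2 powr k * (real M powr (real CARD('d) / 2) * real M powr (real CARD('d) / 2) /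
          (w x * w \<xi> * (1 + real M * D) powr k))"
        using M by (simp flip: powr_add)
      finally have Kb: "\<bar>K\<bar> \<le> CL * 2 powr k * (real M powr (real CARD('d) / 2) * real M powr (real CARD('d) / 2) /
          (w x * w \<xi> * (1 + real M * D) powr k))" .
      have "\<bar>needlet \<mu> a lam j \<xi> x\<bar> = sqrt (lam j \<xi>) * \<bar>K\<bar>"
        using sl0 by (simp add: needlet_def K_def abs_mult)
      also have "\<dots> \<le> sqrt CQ * (w \<xi> / real M powr (real CARD('d) / 2)) *
          (CL * 2 powr k * (real M powr (real CARD('d) / 2) * real M powr (real CARD('d) / 2) /
          (w x * w \<xi> * (1 + real M * D) powr k)))"
        using sl sl0 Kb by (intro mult_mono order.trans[OF sl0 sl]) auto
      also have "\<dots> = sqrt CQ * CL * 2 powr k * (real M powr (real CARD('d) / 2) / (w x * (1 + real M * D) powr k))"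
        using w[OF n\<xi>] Mpos by simp
      also have "\<dots> \<le> c * (real M powr (real CARD('d) / 2) / (w x * (1 + real M * D) powr k))"
        using CQ(1) CL(1) w[OF nx] by (intro mult_right_mono) (auto simp: c_def)
      finally show ?thesis unfolding Md rM D_def w_def .
    qed
  qed
  moreover have "c > 0" using CQ(1) CL(1) by (simp add: c_def add_pos_pos)
  ultimately show "\<exists>c>0. \<forall>(X :: nat \<Rightarrow> (real ^ 'd) set) (lam :: nat \<Rightarrow> real ^ 'd \<Rightarrow> real).
      needlet_cubature \<mu> cs css cd c1 c2 c3 c4 X lam \<longrightarrow>
      (\<forall>j. \<forall>\<xi> \<in> X j. \<forall>x \<in> cball 0 1.
        \<bar>needlet \<mu> a lam j \<xi> x\<bar> \<le>
          c * (2 powr (real j * real CARD('d) / 2) /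
               (sqrt (local_weight \<mu> (2 ^ j) x) * (1 + 2 ^ j * ball_dist x \<xi>) powr k)))"
    by blast
qed

end
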